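(* Let $\mathcal{C}$ be an algebraically closed field of arbitrary characteristic, $(\mathcal{E},o)$ an elliptic curve over $\mathcal{C}$ with function field $\mathcal{K}$, $s\in\mathcal{E}(\mathcal{C})$ a non-torsion point, and $\tau$ the automorphism of $\mathcal{K}$ induced by addition by $s$. Let $\mathbf{P}=(\mathcal{R},\mathcal{U})$ be any $\tau$-pinning of $\mathcal{E}$ and let $f\in\mathcal{K}$. Then $f$ is elliptically summable (i.e. $f=\tau(g)-g$ for some $g\in\mathcal{K}$) if and only if $\mathrm{Ores}^{\mathcal{U}}(f,\omega,k)=0$ for every $\omega\in\mathcal{E}/\tau$ and every $k\geq 1$, and $\mathrm{PanOres}^{\mathbf{P}}(f,0)=0$, and $\mathrm{PanOres}^{\mathbf{P}}(f,1)=0$.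
   Context: Setting: $\mathcal{C}$ is an algebraically closed field of arbitrary characteristic; $\mathcal{E}$ is an elliptic curve over $\mathcal{C}$ with identity $o$ and group law $\oplus$; $\mathcal{K}=\mathcal{C}(\mathcal{E})$; $\nu_\alpha$ is the valuation of $\mathcal{K}$ at $\alpha\in\mathcal{E}(\mathcal{C})$; $s\in\mathcal{E}(\mathcal{C})$ is a fixed non-torsion point; $\tau$ is the $\mathcal{C}$-linear automorphism of $\mathcal{K}$ induced by $\alpha\mapsto\alpha\oplus s$, so $\nu_\alpha(\tau(f))=\nu_{\alpha\oplus s}(f)$. The set of $\tau$-orbits $\mathcal{E}/\tau$ is the set of cosets of $\mathbb{Z}s$ in $\mathcal{E}(\mathcal{C})$. $\mathbb{N}=\{1,2,\dots\}$. For a divisor $D$, $\mathcal{L}(D)=\{f\in\mathcal{K}: f=0 \text{ or } \mathrm{div}(f)+D\geq 0\}$. Uniformizers: a $\tau$-compatible set of local uniformizers is $\mathcal{U}=\{u_\alpha\in\mathcal{K}:\alpha\in\mathcal{E}(\mathcal{C})\}$ with $\nu_\alpha(u_\alpha)=1$ and $\tau(u_{\alpha\oplus s})=u_\alpha$ for all $\alpha$. For $f\in\mathcal{K}$, the coefficients $c_k^{\mathcal{U}}(f,\alpha)\in\mathcal{C}$, $k\geq 0$, are defined by the expansion $f=\sum_{k\geq 0}c_k^{\mathcal{U}}(f,\alpha)u_\alpha^{-k}+u_\alpha h$ with $h\in\mathcal{C}[[u_\alpha]]$ in $\mathcal{C}((u_\alpha))$. Orbital residues: $\mathrm{Ores}^{\mathcal{U}}(f,\omega,k):=\sum_{\alpha\in\omega}c_k^{\mathcal{U}}(f,\alpha)$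 for $\omega\in\mathcal{E}/\tau$, $k\geq 1$. A $\tau$-pinning is a pair $\mathbf{P}=(\mathcal{R},\mathcal{U})$ with $\mathcal{R}=\{\alpha_\omega\in\omega:\omega\in\mathcal{E}/\tau\}$ a choice of one representative of each orbit and $\mathcal{U}$ a $\tau$-compatible set of local uniformizers. Ancillary functions: $\zeta^{\mathcal{U}}_{(1,0)}$ is the unique element of $\mathcal{L}([s]+[o])$ with $c_1^{\mathcal{U}}(\zeta^{\mathcal{U}}_{(1,0)},s)=1$, $c_1^{\mathcal{U}}(\zeta^{\mathcal{U}}_{(1,0)},o)=-1$, $c_0^{\mathcal{U}}(\zeta^{\mathcal{U}}_{(1,0)},o)=0$. For $\ell,m\in\mathbb{Z}$, $\zeta^{\mathcal{U}}_{(\ell,m)}$ is $\sum_{i=m}^{\ell-1}\tau^{-i}(\zeta^{\mathcal{U}}_{(1,0)})$ if $\ell>m$, $0$ if $\ell=m$, and $-\sum_{i=\ell}^{m-1}\tau^{-i}(\zeta^{\mathcal{U}}_{(1,0)})$ if $\ell<m$. If $\alpha_\omega\neq o$, then for $n\in\mathbb{Z}$, $k\geq 1$, $\varphi^{\mathbf{P}}_{\omega,n,k}$ is the unique element of $\mathcal{L}(k[\alpha_\omega\oplus ns]+[ns])$ with $c_k^{\mathcal{U}}(\cdot,\alpha_\omega\oplus ns)=1$, $c_j^{\mathcal{U}}(\cdot,\alpha_\omega\oplus ns)=0$ for $j\in\mathbb{N}-\{k\}$, and $c_0^{\mathcal{U}}(\cdot,ns)=0$. For $n\in\mathbb{Z}$,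 $k\geq 2$, $\hat\varphi^{\mathcal{U}}_{\mathbb{Z}s,n,k}$ is the unique element of $\mathcal{L}(k[ns])$ with $c_k^{\mathcal{U}}(\cdot,ns)=1$ and $c_j^{\mathcal{U}}(\cdot,ns)=0$ for all $j\in\mathbb{Z}_{\geq 0}-\{1,k\}$. If $\alpha_{\mathbb{Z}s}=o$, put $\varphi^{\mathbf{P}}_{\mathbb{Z}s,n,1}:=0$ and $\varphi^{\mathbf{P}}_{\mathbb{Z}s,n,k}:=\hat\varphi^{\mathcal{U}}_{\mathbb{Z}s,n,k}$ for $k\geq 2$. Structural constants: $d^{\mathcal{U}}_{\omega,k}:=-c_1^{\mathcal{U}}(\varphi^{\mathbf{P}}_{\omega,n,k},ns)$ (independent of $n$ and of $\mathcal{R}$) if $\alpha_\omega\neq o$ or $k\geq 2$, and $d^{\mathcal{U}}_{\omega,k}:=1$ if $\alpha_\omega=o$ and $k=1$; and $e^{\mathbf{P}}_{\omega,n,k}:=c_0^{\mathcal{U}}(\varphi^{\mathbf{P}}_{\omega,n,k}+d^{\mathcal{U}}_{\omega,k}\zeta^{\mathcal{U}}_{(n,0)},\,o)$. Panorbital residues: $\mathrm{PanOres}^{\mathbf{P}}(f,0):=c_0^{\mathcal{U}}(f,o)-\sum_{\omega\in\mathcal{E}/\tau}\sum_{n\in\mathbb{Z}}\sum_{k\geq 1}c_k^{\mathcal{U}}(f,\alpha_\omega\oplus ns)\,e^{\mathbf{P}}_{\omega,n,k}$ and $\mathrm{PanOres}^{\mathbf{P}}(f,1):=\sum_{\omega\in\mathcal{E}/\tau}\sum_{n\in\mathbb{Z}}\sum_{k\geq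 1}n\,c_k^{\mathcal{U}}(f,\alpha_\omega\oplus ns)\,d^{\mathcal{U}}_{\omega,k}$. *)

theory Defs
  imports "HOL-Computational_Algebra.Computational_Algebra"
begin

section \<open>Weierstrass curves and their function fields\<close>

text \<open>
  The first five fields are the coefficients of the long Weierstrass equation
  \<open>Y\<^sup>2 + a\<^sub>1 X Y + a\<^sub>3 Y = X\<^sup>3 + a\<^sub>2 X\<^sup>2 + a\<^sub>4 X + a\<^sub>6\<close>, which covers every characteristic.
  The type \<open>'k\<close> carries the function field; \<open>emb\<close> is the inclusion of the
  constants, and \<open>xfun\<close>, \<open>yfun\<close> are the coordinate functions.
\<close>

record ('c, 'k) curve =
  a1 :: 'c
  a2 :: 'c
  a3 :: 'c
  a4 :: 'c
  a6 :: 'c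
  emb :: "'c \<Rightarrow> 'k"
  xfun :: 'k
  yfun :: 'k

text \<open>
  A bivariate polynomial over \<open>'c\<close> is an element of \<open>'c poly poly\<close>, read as
  \<open>C[X][Y]\<close>: the outer variable is \<open>Y\<close>, the inner one \<open>X\<close>.
\<close>

definition weierstrass_poly :: "('c::field, 'k) curve \<Rightarrow> 'c poly poly" where
  "weierstrass_poly E = [: [:- a6 E, - a4 E, - a2 E, - 1:], [:a3 E, a1 E:], 1 :]"

definition eval2 :: "'c::field poly poly \<Rightarrow> 'c \<Rightarrow> 'c \<Rightarrow> 'c" where
  "eval2 F a b = poly (poly F [:b:]) a"

definition subst2 :: "('c::field, 'k::field) curve \<Rightarrow> 'c poly poly \<Rightarrow> 'k \<Rightarrow> 'k \<Rightarrow> 'k" where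
  "subst2 E F p q = poly (map_poly (\<lambda>c. poly (map_poly (emb E) c) p) F) q"

text \<open>
  Smoothness needs to be required at the affine points only: the point at infinity of a
  Weierstrass cubic is always smooth.
\<close>

definition smooth_curve :: "('c::field, 'k) curve \<Rightarrow> bool" where
  "smooth_curve E \<longleftrightarrow>
     (\<forall>a b. eval2 (weierstrass_poly E) a b = 0 \<longrightarrow>
        eval2 (map_poly pderiv (weierstrass_poly E)) a b \<noteq> 0 \<or>
        eval2 (pderiv (weierstrass_poly E)) a b \<noteq> 0)"

definition constant_embedding :: "('c::field \<Rightarrow> 'k::field) \<Rightarrow> bool" where
  "constant_embedding i \<longleftrightarrow>
     i 1 = 1 \<and> (\<forall>a b. i (a + b) = i a + i b) \<and> (\<forall>a b. i (a * b) = i a * i b)"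

text \<open>
  \<open>'k\<close> is the field of fractions of the coordinate ring \<open>C[X,Y]/(W)\<close>: the substitution
  of the coordinate functions has kernel \<open>(W)\<close>, and every element is a quotient of two values.
\<close>

definition is_function_field :: "('c::field, 'k::field) curve \<Rightarrow> bool" where
  "is_function_field E \<longleftrightarrow>
     constant_embedding (emb E) \<and>
     (\<forall>F. subst2 E F (xfun E) (yfun E) = 0 \<longleftrightarrow> weierstrass_poly E dvd F) \<and>
     (\<forall>f. \<exists>F G. subst2 E G (xfun E) (yfun E) \<noteq> 0 \<and>
        f = subst2 E F (xfun E) (yfun E) / subst2 E G (xfun E) (yfun E))"

definition elliptic_curve :: "('c::field, 'k::field) curve \<Rightarrow> bool" where
  "elliptic_curve E \<longleftrightarrow> smooth_curve E \<and> is_function_field E"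


section \<open>Points and the group law\<close>

datatype 'c point = Infinity | Affine 'c 'c

definition points :: "('c::field, 'k) curve \<Rightarrow> 'c point set" where
  "points E = insert Infinity {Affine a b | a b. eval2 (weierstrass_poly E) a b = 0}"

fun pneg :: "('c::field, 'k) curve \<Rightarrow> 'c point \<Rightarrow> 'c point" where
  "pneg E Infinity = Infinity"
| "pneg E (Affine a b) = Affine a (- b - a1 E * a - a3 E)"

text \<open>Chord-tangent addition; \<open>l\<close> is the slope of the chord, respectively of the tangent.\<close>

fun padd :: "('c::field, 'k) curve \<Rightarrow> 'c point \<Rightarrow> 'c point \<Rightarrow> 'c point" where
  "padd E Infinity Q = Q"
| "padd E P Infinity = P"
| "padd E (Affine x1 y1) (Affine x2 y2) =
     (if Affine x2 y2 = pneg E (Affine x1 y1) then Infinity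
      else
        (let l = (if x1 \<noteq> x2 then (y2 - y1) / (x2 - x1)
                  else (3 * x1 ^ 2 + 2 * a2 E * x1 + a4 E - a1 E * y1) /
                       (2 * y1 + a1 E * x1 + a3 E));
             x3 = l ^ 2 + a1 E * l - a2 E - x1 - x2;
             y3 = l * (x3 - x1) + y1
         in pneg E (Affine x3 y3)))"

definition pmult :: "('c::field, 'k) curve \<Rightarrow> int \<Rightarrow> 'c point \<Rightarrow> 'c point" where
  "pmult E n P =
     (if 0 \<le> n then (padd E P ^^ nat n) Infinity
      else pneg E ((padd E P ^^ nat (- n)) Infinity))"

definition non_torsion :: "('c::field, 'k) curve \<Rightarrow> 'c point \<Rightarrow> bool" where
  "non_torsion E P \<longleftrightarrow> (\<forall>n::int. n > 0 \<longrightarrow> pmult E n P \<noteq> Infinity)"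


section \<open>Local rings, valuations and the translation automorphism\<close>

text \<open>
  \<open>value_at E P f c\<close>: the function \<open>f\<close> is regular at \<open>P\<close> with value \<open>c\<close>. The point at
  infinity is \<open>[0:1:0]\<close>; it is the origin of the affine chart with
  coordinates \<open>X/Y\<close> and \<open>1/Y\<close>.
\<close>

fun value_at :: "('c::field, 'k::field) curve \<Rightarrow> 'c point \<Rightarrow> 'k \<Rightarrow> 'c \<Rightarrow> bool" where
  "value_at E (Affine a b) f c \<longleftrightarrow>
     (\<exists>F G. eval2 G a b \<noteq> 0 \<and>
        f = subst2 E F (xfun E) (yfun E) / subst2 E G (xfun E) (yfun E) \<and>
        c = eval2 F a b / eval2 G a b)"
| "value_at E Infinity f c \<longleftrightarrow>
     (\<exists>F G. eval2 G 0 0 \<noteq> 0 \<and>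
        f = subst2 E F (xfun E / yfun E) (1 / yfun E) /
            subst2 E G (xfun E / yfun E) (1 / yfun E) \<and>
        c = eval2 F 0 0 / eval2 G 0 0)"

definition local_ring :: "('c::field, 'k::field) curve \<Rightarrow> 'c point \<Rightarrow> 'k set" where
  "local_ring E P = {f. \<exists>c. value_at E P f c}"

text \<open>
  Integer-valued valuations are meaningful on nonzero elements only; the value at \<open>0\<close>
  (mathematically infinite) is fixed to the junk value \<open>0\<close> to make the valuation unique, and
  is excluded wherever the valuation is used.
\<close>

definition normalized_valuation_with_ring :: "'k::field set \<Rightarrow> ('k \<Rightarrow> int) \<Rightarrow> bool" where
  "normalized_valuation_with_ring R v \<longleftrightarrow>
     v 0 = 0 \<and>
     (\<forall>f g. f \<noteq> 0 \<longrightarrow> g \<noteq> 0 \<longrightarrow> v (f * g) = v f + v g) \<and>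
     (\<forall>f g. f \<noteq> 0 \<longrightarrow> g \<noteq> 0 \<longrightarrow> f + g \<noteq> 0 \<longrightarrow> min (v f) (v g) \<le> v (f + g)) \<and>
     (\<exists>f. f \<noteq> 0 \<and> v f = 1) \<and>
     R = {f. f = 0 \<or> 0 \<le> v f}"

definition val :: "('c::field, 'k::field) curve \<Rightarrow> 'c point \<Rightarrow> 'k \<Rightarrow> int" where
  "val E P = (THE v. normalized_valuation_with_ring (local_ring E P) v)"

text \<open>
  \<open>t\<close> is the automorphism of the function field over the constants given by pullback along
  \<open>P \<mapsto> P \<oplus> s\<close>, that is \<open>(t f)(P) = f (P \<oplus> s)\<close>. It is unique, since a function is determined
  by its values.
\<close>

definition translation_automorphism ::
    "('c::field, 'k::field) curve \<Rightarrow> 'c point \<Rightarrow> ('k \<Rightarrow> 'k) \<Rightarrow> bool" where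
  "translation_automorphism E s t \<longleftrightarrow>
     bij t \<and>
     (\<forall>f g. t (f + g) = t f + t g) \<and> (\<forall>f g. t (f * g) = t f * t g) \<and>
     (\<forall>c. t (emb E c) = emb E c) \<and>
     (\<forall>P\<in>points E. \<forall>f c. value_at E P (t f) c \<longleftrightarrow> value_at E (padd E P s) f c)"

definition tau_power :: "('k \<Rightarrow> 'k) \<Rightarrow> int \<Rightarrow> 'k \<Rightarrow> 'k" where
  "tau_power t i = (if 0 \<le> i then t ^^ nat i else inv t ^^ nat (- i))"

definition elliptically_summable :: "('k::field \<Rightarrow> 'k) \<Rightarrow> 'k \<Rightarrow> bool" where
  "elliptically_summable t f \<longleftrightarrow> (\<exists>g. f = t g - g)"

text \<open>The cosets of \<open>\<int> s\<close>.\<close>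

definition orbits :: "('c::field, 'k) curve \<Rightarrow> 'c point \<Rightarrow> 'c point set set" where
  "orbits E s = (\<lambda>P. range (\<lambda>n::int. padd E P (pmult E n s))) ` points E"


section \<open>Riemann-Roch spaces, uniformizers and coefficients\<close>

definition pt_div :: "int \<Rightarrow> 'c point \<Rightarrow> 'c point \<Rightarrow> int" where
  "pt_div k P = (\<lambda>Q. if Q = P then k else 0)"

definition RR_space ::
    "('c::field, 'k::field) curve \<Rightarrow> ('c point \<Rightarrow> int) \<Rightarrow> 'k set" where
  "RR_space E D = {f. f = 0 \<or> (\<forall>P\<in>points E. 0 \<le> val E P f + D P)}"

definition compatible_uniformizers ::
    "('c::field, 'k::field) curve \<Rightarrow> 'c point \<Rightarrow> ('k \<Rightarrow> 'k) \<Rightarrow> ('c point \<Rightarrow> 'k) \<Rightarrow> bool" where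
  "compatible_uniformizers E s t u \<longleftrightarrow>
     (\<forall>P\<in>points E. u P \<noteq> 0 \<and> val E P (u P) = 1 \<and> t (u (padd E P s)) = u P)"

text \<open>
  The representatives are given by the choice function \<open>r\<close> sending an orbit to its
  representative.
\<close>

definition tau_pinning ::
    "('c::field, 'k::field) curve \<Rightarrow> 'c point \<Rightarrow> ('k \<Rightarrow> 'k) \<Rightarrow>
     ('c point set \<Rightarrow> 'c point) \<Rightarrow> ('c point \<Rightarrow> 'k) \<Rightarrow> bool" where
  "tau_pinning E s t r u \<longleftrightarrow>
     (\<forall>w\<in>orbits E s. r w \<in> w) \<and> compatible_uniformizers E s t u"

text \<open>
  The nonpositive-degree coefficients of the expansion
  \<open>f = (\<Sum>k\<ge>0. c\<^sub>k u\<^sub>P\<^sup>-\<^sup>k) + u\<^sub>P h\<close> in \<open>C((u\<^sub>P))\<close>. The remainder \<open>h\<close> automatically lies in the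
  function field, and an element of the function field is a power series in \<open>u\<^sub>P\<close> iff it
  belongs to the local ring at \<open>P\<close>.
\<close>

definition polar_coeffs ::
    "('c::field, 'k::field) curve \<Rightarrow> ('c point \<Rightarrow> 'k) \<Rightarrow> 'k \<Rightarrow> 'c point \<Rightarrow> nat \<Rightarrow> 'c" where
  "polar_coeffs E u f P =
     (THE c. finite {k. c k \<noteq> 0} \<and>
        (\<exists>h\<in>local_ring E P.
           f = (\<Sum>k | c k \<noteq> 0. emb E (c k) * inverse (u P) ^ k) + u P * h))"

abbreviation coeff_at ::
    "('c::field, 'k::field) curve \<Rightarrow> ('c point \<Rightarrow> 'k) \<Rightarrow> nat \<Rightarrow> 'k \<Rightarrow> 'c point \<Rightarrow> 'c" where
  "coeff_at E u k f P \<equiv> polar_coeffs E u f P k"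

text \<open>
  The sums below range over infinite index sets but have finitely many nonzero terms;
  the ordinary \<^const>\<open>sum\<close> over the whole index set would be \<open>0\<close>.
\<close>

definition supp_sum :: "('i \<Rightarrow> 'a::comm_monoid_add) \<Rightarrow> 'i set \<Rightarrow> 'a" where
  "supp_sum g A = (\<Sum>i\<in>{i\<in>A. g i \<noteq> 0}. g i)"

definition Ores ::
    "('c::field, 'k::field) curve \<Rightarrow> ('c point \<Rightarrow> 'k) \<Rightarrow> 'k \<Rightarrow> 'c point set \<Rightarrow> nat \<Rightarrow> 'c" where
  "Ores E u f w k = supp_sum (\<lambda>P. coeff_at E u k f P) w"


section \<open>Ancillary functions\<close>

definition zeta_basic ::
    "('c::field, 'k::field) curve \<Rightarrow> 'c point \<Rightarrow> ('c point \<Rightarrow> 'k) \<Rightarrow> 'k" where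
  "zeta_basic E s u =
     (THE g. g \<in> RR_space E (\<lambda>Q. pt_div 1 s Q + pt_div 1 Infinity Q) \<and>
        coeff_at E u 1 g s = 1 \<and> coeff_at E u 1 g Infinity = - 1 \<and>
        coeff_at E u 0 g Infinity = 0)"

definition zeta ::
    "('c::field, 'k::field) curve \<Rightarrow> 'c point \<Rightarrow> ('k \<Rightarrow> 'k) \<Rightarrow> ('c point \<Rightarrow> 'k) \<Rightarrow>
     int \<Rightarrow> int \<Rightarrow> 'k" where
  "zeta E s t u l m =
     (if l > m then (\<Sum>i\<in>{m..l - 1}. tau_power t (- i) (zeta_basic E s u))
      else if l = m then 0
      else - (\<Sum>i\<in>{l..m - 1}. tau_power t (- i) (zeta_basic E s u)))"

definition phi_hat ::
    "('c::field, 'k::field) curve \<Rightarrow> 'c point \<Rightarrow> ('c point \<Rightarrow> 'k) \<Rightarrow> int \<Rightarrow> nat \<Rightarrow> 'k" where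
  "phi_hat E s u n k =
     (THE g. g \<in> RR_space E (pt_div (int k) (pmult E n s)) \<and>
        coeff_at E u k g (pmult E n s) = 1 \<and>
        (\<forall>j. j \<noteq> 1 \<longrightarrow> j \<noteq> k \<longrightarrow> coeff_at E u j g (pmult E n s) = 0))"

text \<open>
  Used for \<open>k \<ge> 1\<close> only. The case \<open>r w = Infinity\<close> can only occur for the orbit \<open>\<int> s\<close>.
\<close>

definition phi ::
    "('c::field, 'k::field) curve \<Rightarrow> 'c point \<Rightarrow> ('c point set \<Rightarrow> 'c point) \<Rightarrow>
     ('c point \<Rightarrow> 'k) \<Rightarrow> 'c point set \<Rightarrow> int \<Rightarrow> nat \<Rightarrow> 'k" where
  "phi E s r u w n k =
     (if r w \<noteq> Infinity then
        (let P = padd E (r w) (pmult E n s); N = pmult E n s in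
         THE g. g \<in> RR_space E (\<lambda>Q. pt_div (int k) P Q + pt_div 1 N Q) \<and>
           coeff_at E u k g P = 1 \<and>
           (\<forall>j\<ge>1. j \<noteq> k \<longrightarrow> coeff_at E u j g P = 0) \<and>
           coeff_at E u 0 g N = 0)
      else if k = 1 then 0
      else phi_hat E s u n k)"


section \<open>Structural constants and panorbital residues\<close>

text \<open>
  The coefficient of \<open>phi\<close> at \<open>n s\<close> does not depend on \<open>n\<close>
  (\<open>phi\<close> at \<open>n\<close> is the image of \<open>phi\<close> at \<open>0\<close> under the \<open>(-n)\<close>-th power of the translation
  automorphism), so the constant is read off at \<open>n = 0\<close>.
\<close>

definition d_const ::
    "('c::field, 'k::field) curve \<Rightarrow> 'c point \<Rightarrow> ('c point set \<Rightarrow> 'c point) \<Rightarrow>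
     ('c point \<Rightarrow> 'k) \<Rightarrow> 'c point set \<Rightarrow> nat \<Rightarrow> 'c" where
  "d_const E s r u w k =
     (if r w = Infinity \<and> k = 1 then 1
      else - coeff_at E u 1 (phi E s r u w 0 k) (pmult E 0 s))"

definition e_const ::
    "('c::field, 'k::field) curve \<Rightarrow> 'c point \<Rightarrow> ('k \<Rightarrow> 'k) \<Rightarrow>
     ('c point set \<Rightarrow> 'c point) \<Rightarrow> ('c point \<Rightarrow> 'k) \<Rightarrow> 'c point set \<Rightarrow> int \<Rightarrow> nat \<Rightarrow> 'c" where
  "e_const E s t r u w n k =
     coeff_at E u 0
       (phi E s r u w n k + emb E (d_const E s r u w k) * zeta E s t u n 0) Infinity"

definition PanOres0 ::
    "('c::field, 'k::field) curve \<Rightarrow> 'c point \<Rightarrow> ('k \<Rightarrow> 'k) \<Rightarrow>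
     ('c point set \<Rightarrow> 'c point) \<Rightarrow> ('c point \<Rightarrow> 'k) \<Rightarrow> 'k \<Rightarrow> 'c" where
  "PanOres0 E s t r u f =
     coeff_at E u 0 f Infinity -
     supp_sum (\<lambda>w. supp_sum (\<lambda>n. supp_sum (\<lambda>k.
         coeff_at E u k f (padd E (r w) (pmult E n s)) * e_const E s t r u w n k)
       {1..}) (UNIV :: int set)) (orbits E s)"

definition PanOres1 ::
    "('c::field, 'k::field) curve \<Rightarrow> 'c point \<Rightarrow>
     ('c point set \<Rightarrow> 'c point) \<Rightarrow> ('c point \<Rightarrow> 'k) \<Rightarrow> 'k \<Rightarrow> 'c" where
  "PanOres1 E s r u f =
     supp_sum (\<lambda>w. supp_sum (\<lambda>n. supp_sum (\<lambda>k.
         of_int n * coeff_at E u k f (padd E (r w) (pmult E n s)) * d_const E s r u w k)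
       {1..}) (UNIV :: int set)) (orbits E s)"

end

theory Submission
  imports Defs
begin

text \<open>
  The polar coefficients of a function determine it up to a constant, even if one simple pole
  is left unspecified, because no function has exactly one simple pole. Comparing coefficients gives
  \<open>f = PanOres(f,0) + (\<Sum> c\<^sub>k(f, \<alpha>\<^sub>\<omega> + n s) (\<phi>\<^bsub>\<omega>,n,k\<^esub> + d\<^bsub>\<omega>,k\<^esub> \<zeta>\<^bsub>(n,0)\<^esub>))\<close>. Modulo functions \<open>\<tau>(g) - g\<close>
  one may replace \<open>\<phi>\<^bsub>\<omega>,n,k\<^esub>\<close> by \<open>\<phi>\<^bsub>\<omega>,0,k\<^esub>\<close> and \<open>\<zeta>\<^bsub>(n,0)\<^esub>\<close> by \<open>n \<zeta>\<^bsub>(1,0)\<^esub>\<close>, so that \<open>f\<close> is congruent to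
  \<open>PanOres(f,0) + PanOres(f,1) \<zeta>\<^bsub>(1,0)\<^esub>\<close> plus a combination of the \<open>\<phi>\<^bsub>\<omega>,0,k\<^esub>\<close> whose coefficients are the
  orbital residues. Orbital residues of \<open>\<tau>(g) - g\<close> vanish, and \<open>A + B \<zeta>\<^bsub>(1,0)\<^esub> = \<tau>(g) - g\<close>
  makes the coefficients of \<open>g\<close> along the orbit of \<open>o\<close> an eventually zero solution of a first-order
  recurrence, which forces \<open>g\<close> to have at most a simple pole at \<open>s\<close>, hence to be constant.

  All valuation theory is explicit in the Weierstrass coordinates: every function is
  \<open>(p(x) + q(x) y) / r(x)\<close>, the functions with two simple poles are slopes of chords, and the
  group axioms follow from the divisors of lines.
\<close>

section \<open>The function field of a Weierstrass curve\<close>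

text \<open>The obstacle is that most objects of the statement are definite descriptions
  (\<open>val\<close>, \<open>polar_coeffs\<close>, \<open>zeta_basic\<close>, \<open>phi\<close>,
  \<open>phi_hat\<close>), so existence and uniqueness come before any computation. Uniqueness of
  the ancillary functions rests on the constancy of functions with at most one simple pole.
  Existence rests on functions with one pole of order k >= 2, functions with two simple poles, and
  the residue theorem for the pair o, s: with \<tau>-compatible uniformizers, the two polar
  coefficients of a function in L([s] + [o]) are opposite. The constants d arise because
  \<open>phi\<close> has an unprescribed simple pole at n s; adding d times \<open>zeta\<close>
  moves it to o, so that the coefficient of order 1 at o is the single one omitted in all
  comparisons. The constant still undetermined is read off at o, which is the origin of the
  constants e. Non-torsion makes every orbit a copy of the integers, where a constant sequence with
  finite support is 0; this argument is insensitive to the characteristic.\<close>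

lemma poly_map_poly_add:
  assumes "h 0 = 0" and "\<And>a b. h (a + b) = h a + h b"
  shows "poly (map_poly h (p + q)) x = poly (map_poly h p) x + poly (map_poly h q) x"
proof (induction p q rule: poly_induct2)
  case (pCons a p b q)
  then show ?case using assms by (simp add: map_poly_pCons algebra_simps)
qed simp

text \<open>Stated for an arbitrary map respecting sums and products because substitution is nested:
  the map is \<open>emb E\<close> on the inner polynomials and the inner evaluation on the outer
  ones.\<close>

lemma poly_map_poly_mult:
  fixes h :: "'a::comm_semiring_0 \<Rightarrow> 'b::comm_semiring_0"
  assumes "h 0 = 0" and "\<And>a b. h (a + b) = h a + h b" and "\<And>a b. h (a * b) = h a * h b"
  shows "poly (map_poly h (p * q)) x = poly (map_poly h p) x * poly (map_poly h q) x"
proof (induction p)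
  case (pCons a p)
  have "poly (map_poly h (smult a q)) x = h a * poly (map_poly h q) x"
    using assms by (simp add: map_poly_smult)
  with pCons show ?case
    using assms by (simp add: map_poly_pCons poly_map_poly_add algebra_simps)
qed simp

locale weierstrass =
  fixes E :: "('c::alg_closed_field, 'k::field) curve"
  assumes elliptic: "elliptic_curve E"
begin

abbreviation "\<iota> \<equiv> emb E"
abbreviation "X \<equiv> xfun E"
abbreviation "Y \<equiv> yfun E"

lemma emb_1 [simp]: "\<iota> 1 = 1"
  and emb_add [simp]: "\<iota> (a + b) = \<iota> a + \<iota> b"
  and emb_mult [simp]: "\<iota> (a * b) = \<iota> a * \<iota> b"
  using elliptic
  by (auto simp: elliptic_curve_def is_function_field_def constant_embedding_def)

lemma emb_0 [simp]: "\<iota> 0 = 0"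
  by (metis add.right_neutral add_left_cancel emb_add)

lemma emb_minus [simp]: "\<iota> (- a) = - \<iota> a"
  using emb_add[of a "- a"] by (simp add: add_eq_0_iff2)

lemma emb_diff [simp]: "\<iota> (a - b) = \<iota> a - \<iota> b"
  using emb_add[of a "- b"] by simp

lemma emb_eq_0 [simp]: "\<iota> a = 0 \<longleftrightarrow> a = 0"
proof
  show "a = 0" if "\<iota> a = 0"
    using that emb_mult[of a "inverse a"] by (cases "a = 0") auto
qed simp

lemma emb_inverse [simp]: "\<iota> (inverse a) = inverse (\<iota> a)"
  using emb_mult[of a "inverse a"] by (cases "a = 0") (auto intro: inverse_unique[symmetric])

lemma emb_divide [simp]: "\<iota> (a / b) = \<iota> a / \<iota> b"
  by (simp add: field_class.field_divide_inverse)

lemma emb_of_nat [simp]: "\<iota> (of_nat n) = of_nat n"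
  by (induction n) auto

lemma emb_numeral [simp]: "\<iota> (numeral n) = numeral n"
  using emb_of_nat[of "numeral n"] by simp

lemma emb_sum: "\<iota> (sum g A) = (\<Sum>i\<in>A. \<iota> (g i))"
  by (induction A rule: infinite_finite_induct) auto

definition peval :: "'c poly \<Rightarrow> 'k \<Rightarrow> 'k"
  where "peval p z = poly (map_poly \<iota> p) z"

lemma peval_0 [simp]: "peval 0 z = 0"
  and peval_pCons [simp]: "peval (pCons c p) z = \<iota> c + z * peval p z"
  and peval_add [simp]: "peval (p + q) z = peval p z + peval q z"
  and peval_mult [simp]: "peval (p * q) z = peval p z * peval q z"
  and peval_smult [simp]: "peval (smult c p) z = \<iota> c * peval p z"
  by (simp_all add: peval_def map_poly_pCons poly_map_poly_add poly_map_poly_mult map_poly_smult)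

lemma peval_1 [simp]: "peval 1 z = 1"
  using peval_pCons[of 1 0 z] by (simp add: one_pCons del: peval_pCons)

lemma peval_minus [simp]: "peval (- p) z = - peval p z"
  using peval_add[of p "- p" z] by (simp add: add_eq_0_iff2 del: peval_add)

lemma peval_diff [simp]: "peval (p - q) z = peval p z - peval q z"
  using peval_add[of p "- q" z] by simp

lemma peval_power [simp]: "peval (p ^ n) z = peval p z ^ n"
  by (induction n) auto

lemma subst2_0 [simp]: "subst2 E 0 u v = 0"
  by (simp add: subst2_def)

lemma subst2_pCons [simp]: "subst2 E (pCons c F) u v = peval c u + v * subst2 E F u v"
  by (simp add: subst2_def peval_def map_poly_pCons)

lemma subst2_add [simp]: "subst2 E (F + G) u v = subst2 E F u v + subst2 E G u v"
  using poly_map_poly_add[of "\<lambda>c. peval c u" F G v] by (simp add: subst2_def peval_def[symmetric])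

lemma subst2_mult [simp]: "subst2 E (F * G) u v = subst2 E F u v * subst2 E G u v"
  using poly_map_poly_mult[of "\<lambda>c. peval c u" F G v] by (simp add: subst2_def peval_def[symmetric])

lemma subst2_1 [simp]: "subst2 E 1 u v = 1"
  using subst2_pCons[of 1 0 u v] by (simp add: one_pCons del: subst2_pCons)

lemma subst2_minus [simp]: "subst2 E (- F) u v = - subst2 E F u v"
  using subst2_add[of F "- F" u v] by (simp add: add_eq_0_iff2 del: subst2_add)

lemma subst2_diff [simp]: "subst2 E (F - G) u v = subst2 E F u v - subst2 E G u v"
  using subst2_add[of F "- G" u v] by simp

lemma eval2_simps [simp]:
  "eval2 0 a b = 0" "eval2 1 a b = 1" "eval2 (pCons c F) a b = poly c a + b * eval2 F a b"
  "eval2 (F + G) a b = eval2 F a b + eval2 G a b" "eval2 (F - G) a b = eval2 F a b - eval2 G a b"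
  "eval2 (F * G) a b = eval2 F a b * eval2 G a b" "eval2 (- F) a b = - eval2 F a b"
  for F G :: "'c poly poly"
  by (simp_all add: eval2_def)

section \<open>The coordinate ring and its field of fractions\<close>

definition linear_coeff :: "'c poly" where "linear_coeff = [:a3 E, a1 E:]"
definition cubic :: "'c poly" where "cubic = [:a6 E, a4 E, a2 E, 1:]"

lemma weierstrass_poly_eq: "weierstrass_poly E = [: - cubic, linear_coeff, 1:]"
  by (simp add: weierstrass_poly_def cubic_def linear_coeff_def)

lemma subst2_eq_0_iff: "subst2 E F X Y = 0 \<longleftrightarrow> weierstrass_poly E dvd F"
  using elliptic by (auto simp: elliptic_curve_def is_function_field_def)

lemma Y_squared: "Y * Y = peval cubic X - peval linear_coeff X * Y"
  using subst2_eq_0_iff[of "weierstrass_poly E"] by (simp add: weierstrass_poly_eq algebra_simps)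

text \<open>The affine coordinate ring is free over C[X] with basis 1, Y; this is the element with
  coordinates p, q.\<close>

definition elem :: "'c poly \<Rightarrow> 'c poly \<Rightarrow> 'k" where "elem p q = peval p X + peval q X * Y"

lemma elem_add: "elem p q + elem p' q' = elem (p + p') (q + q')"
  by (simp add: elem_def algebra_simps)

lemma elem_mult:
  "elem p q * elem p' q' = elem (p * p' + q * q' * cubic) (p * q' + q * p' - q * q' * linear_coeff)"
proof -
  have "elem p q * elem p' q' = peval p X * peval p' X + peval p X * peval q' X * Y
      + peval q X * peval p' X * Y + peval q X * peval q' X * (Y * Y)"
    by (simp add: elem_def algebra_simps)
  then show ?thesis unfolding Y_squared by (simp add: elem_def algebra_simps)
qed

text \<open>The Weierstrass polynomial has Y-degree 2 and cannot divide a nonzero polynomial of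
  Y-degree at most 1.\<close>

lemma elem_eq_0_iff: "elem p q = 0 \<longleftrightarrow> p = 0 \<and> q = 0"
proof
  assume "elem p q = 0"
  then have "subst2 E [:p, q:] X Y = 0" by (simp add: elem_def algebra_simps)
  then have *: "weierstrass_poly E dvd [:p, q:]" using subst2_eq_0_iff by blast
  have "degree (weierstrass_poly E) = 2" by (simp add: weierstrass_poly_eq)
  moreover have "degree [:p, q:] \<le> 1" by simp
  ultimately have "[:p, q:] = 0" using dvd_imp_degree_le[OF *] by linarith
  then show "p = 0 \<and> q = 0" by simp
qed (simp add: elem_def)

lemma peval_X_eq_0_iff [simp]: "peval p X = 0 \<longleftrightarrow> p = 0"
  using elem_eq_0_iff[of p 0] by (simp add: elem_def)

lemma X_neq_emb: "X \<noteq> \<iota> a"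
  using peval_X_eq_0_iff[of "[:- a, 1:]"] by (simp del: peval_X_eq_0_iff)

lemma Y_neq_0: "Y \<noteq> 0"
  using elem_eq_0_iff[of 0 1] by (simp add: elem_def)

lemma X_neq_0: "X \<noteq> 0"
  using X_neq_emb[of 0] by simp

lemma subst2_eq_elem: "\<exists>p q. subst2 E F X Y = elem p q"
proof (induction F)
  case 0
  show ?case by (rule exI[of _ 0], rule exI[of _ 0]) (simp add: elem_def)
next
  case (pCons c F)
  then obtain p q where pq: "subst2 E F X Y = elem p q" by blast
  have "subst2 E (pCons c F) X Y = elem c 0 + elem 0 1 * elem p q"
    by (simp add: pq elem_def)
  then show ?case unfolding elem_mult elem_add by blast
qed

text \<open>The norm of p + q Y down to C[X]: its product with the conjugate under Y -> -Y - a1 X -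
  a3, the involution induced by negation on the curve.\<close>

definition norm_poly :: "'c poly \<Rightarrow> 'c poly \<Rightarrow> 'c poly" where
  "norm_poly p q = p * p - p * q * linear_coeff - q * q * cubic"

lemma elem_mult_conj: "elem p q * elem (p - q * linear_coeff) (- q) = peval (norm_poly p q) X"
  unfolding elem_mult by (simp add: elem_def norm_poly_def algebra_simps)

lemma norm_poly_eq_0_iff: "norm_poly p q = 0 \<longleftrightarrow> p = 0 \<and> q = 0"
proof -
  have "norm_poly p q = 0 \<longleftrightarrow> elem p q * elem (p - q * linear_coeff) (- q) = 0"
    unfolding elem_mult_conj by simp
  then show ?thesis unfolding mult_eq_0_iff elem_eq_0_iff by auto
qed

text \<open>Multiplying by the conjugate of the denominator turns the denominator into its norm, a
  polynomial in X alone.\<close>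

lemma normal_form:
  obtains p q r where "r \<noteq> 0" "f = elem p q / peval r X"
proof -
  obtain F G where G: "subst2 E G X Y \<noteq> 0" and f: "f = subst2 E F X Y / subst2 E G X Y"
    using elliptic unfolding elliptic_curve_def is_function_field_def by metis
  obtain p q where F': "subst2 E F X Y = elem p q" using subst2_eq_elem by blast
  obtain p' q' where G': "subst2 E G X Y = elem p' q'" using subst2_eq_elem by blast
  let ?c = "elem (p' - q' * linear_coeff) (- q')"
  have nz: "norm_poly p' q' \<noteq> 0" using G unfolding G' elem_eq_0_iff norm_poly_eq_0_iff by simp
  then have "?c \<noteq> 0" using elem_mult_conj[of p' q'] by auto
  then have "f = (elem p q * ?c) / (elem p' q' * ?c)" by (simp add: f F' G')
  then have "f = (elem p q * ?c) / peval (norm_poly p' q') X" by (simp only: elem_mult_conj)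
  then show thesis using nz that unfolding elem_mult by blast
qed

section \<open>Values of functions at a point of a chart\<close>

definition gval :: "'k \<Rightarrow> 'k \<Rightarrow> 'c \<Rightarrow> 'c \<Rightarrow> 'k \<Rightarrow> 'c \<Rightarrow> bool" where
  "gval u v a b f c \<longleftrightarrow> (\<exists>F G. eval2 G a b \<noteq> 0 \<and>
      f = subst2 E F u v / subst2 E G u v \<and> c = eval2 F a b / eval2 G a b)"

text \<open>Every relation between u and v holds at (a, b): the point lies on the curve in the chart
  with coordinates u, v. This makes values well defined, and one treatment covers the affine points
  and the origin of the chart at infinity.\<close>

definition specializes :: "'k \<Rightarrow> 'k \<Rightarrow> 'c \<Rightarrow> 'c \<Rightarrow> bool" where
  "specializes u v a b \<longleftrightarrow> (\<forall>F. subst2 E F u v = 0 \<longrightarrow> eval2 F a b = 0)"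

lemma gval_subst2: "gval u v a b (subst2 E F u v) (eval2 F a b)"
  unfolding gval_def by (rule exI[of _ F], rule exI[of _ 1]) simp

lemma gval_emb: "gval u v a b (\<iota> c) c"
  using gval_subst2[of u v a b "[:[:c:]:]"] by simp

lemma gval_fst: "gval u v a b u a"
  using gval_subst2[of u v a b "[:[:0, 1:]:]"] by simp

lemma gval_snd: "gval u v a b v b"
  using gval_subst2[of u v a b "[:0, 1:]"] by simp

context
  fixes u v a b
  assumes sp: "specializes u v a b"
begin

lemma specializes_nz: "eval2 F a b \<noteq> 0 \<Longrightarrow> subst2 E F u v \<noteq> 0"
  using sp unfolding specializes_def by blast

lemma gval_unique:
  assumes "gval u v a b f c" "gval u v a b f d"
  shows "c = d"
proof -
  obtain F G where G: "eval2 G a b \<noteq> 0" "f = subst2 E F u v / subst2 E G u v"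
      "c = eval2 F a b / eval2 G a b"
    using assms(1) unfolding gval_def by blast
  obtain F' G' where G': "eval2 G' a b \<noteq> 0" "f = subst2 E F' u v / subst2 E G' u v"
      "d = eval2 F' a b / eval2 G' a b"
    using assms(2) unfolding gval_def by blast
  have "subst2 E (F * G' - F' * G) u v = 0"
    using G(2) G'(2) specializes_nz[OF G(1)] specializes_nz[OF G'(1)]
    by (simp add: frac_eq_eq)
  then have "eval2 (F * G' - F' * G) a b = 0" using sp unfolding specializes_def by blast
  then show ?thesis unfolding G(3) G'(3) using G(1) G'(1) by (simp add: frac_eq_eq)
qed

lemma gval_add:
  assumes "gval u v a b f c" "gval u v a b g d"
  shows "gval u v a b (f + g) (c + d)"
proof -
  obtain F G where G: "eval2 G a b \<noteq> 0" "f = subst2 E F u v / subst2 E G u v"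
      "c = eval2 F a b / eval2 G a b"
    using assms(1) unfolding gval_def by blast
  obtain F' G' where G': "eval2 G' a b \<noteq> 0" "g = subst2 E F' u v / subst2 E G' u v"
      "d = eval2 F' a b / eval2 G' a b"
    using assms(2) unfolding gval_def by blast
  have "eval2 (G * G') a b \<noteq> 0" using G G' by simp
  moreover have "f + g = subst2 E (F * G' + F' * G) u v / subst2 E (G * G') u v"
    unfolding G(2) G'(2) using specializes_nz[OF G(1)] specializes_nz[OF G'(1)]
    by (simp add: add_frac_eq)
  moreover have "c + d = eval2 (F * G' + F' * G) a b / eval2 (G * G') a b"
    unfolding G(3) G'(3) using G(1) G'(1) by (simp add: add_frac_eq)
  ultimately show ?thesis unfolding gval_def by blast
qed

lemma gval_mult:
  assumes "gval u v a b f c" "gval u v a b g d"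
  shows "gval u v a b (f * g) (c * d)"
proof -
  obtain F G where G: "eval2 G a b \<noteq> 0" "f = subst2 E F u v / subst2 E G u v"
      "c = eval2 F a b / eval2 G a b"
    using assms(1) unfolding gval_def by blast
  obtain F' G' where G': "eval2 G' a b \<noteq> 0" "g = subst2 E F' u v / subst2 E G' u v"
      "d = eval2 F' a b / eval2 G' a b"
    using assms(2) unfolding gval_def by blast
  have "eval2 (G * G') a b \<noteq> 0" using G G' by simp
  moreover have "f * g = subst2 E (F * F') u v / subst2 E (G * G') u v"
    using G(2) G'(2) by simp
  moreover have "c * d = eval2 (F * F') a b / eval2 (G * G') a b"
    using G G' by simp
  ultimately show ?thesis unfolding gval_def by blast
qed

lemma gval_inverse:
  assumes "gval u v a b f c" "c \<noteq> 0"
  shows "gval u v a b (inverse f) (inverse c)"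
proof -
  obtain F G where G: "eval2 G a b \<noteq> 0" "f = subst2 E F u v / subst2 E G u v"
      "c = eval2 F a b / eval2 G a b"
    using assms(1) unfolding gval_def by blast
  moreover have "eval2 F a b \<noteq> 0" using G assms(2) by auto
  ultimately show ?thesis unfolding gval_def
    by (intro exI[of _ G] exI[of _ F]) auto
qed

text \<open>First-order Taylor expansion: F - F(a, b) lies in the ideal generated by u - a and v -
  b. The induction runs over the powers of Y and, inside each coefficient, over the powers of
  X.\<close>

lemma subst2_maximal_ideal:
  "\<exists>F1 F2. subst2 E F u v = \<iota> (eval2 F a b) + (u - \<iota> a) * subst2 E F1 u v + (v - \<iota> b) * subst2 E F2 u v"
proof (induction F)
  case 0
  show ?case by (rule exI[of _ 0], rule exI[of _ 0]) simp
next
  case (pCons c F)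
  have c: "\<exists>q. peval c u = \<iota> (poly c a) + (u - \<iota> a) * peval q u"
  proof (induction c)
    case 0
    show ?case by (rule exI[of _ 0]) simp
  next
    case (pCons d c)
    then obtain q where q: "peval c u = \<iota> (poly c a) + (u - \<iota> a) * peval q u" by blast
    show ?case
      by (rule exI[of _ "[:poly c a:] + [:0, 1:] * q"]) (simp add: q algebra_simps)
  qed
  then obtain q where q: "peval c u = \<iota> (poly c a) + (u - \<iota> a) * peval q u" by blast
  from pCons obtain F1 F2 where
    F: "subst2 E F u v = \<iota> (eval2 F a b) + (u - \<iota> a) * subst2 E F1 u v + (v - \<iota> b) * subst2 E F2 u v"
    by blast
  show ?case
    by (rule exI[of _ "[:q:] + [:0, 1:] * F1"], rule exI[of _ "[:[:eval2 F a b:]:] + [:0, 1:] * F2"])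
       (simp add: q F algebra_simps)
qed

text \<open>The maximal ideal of the local ring is generated by u - a and v - b, so divisibility by
  a uniformizer has to be checked on these two generators only.\<close>

lemma gval_zero_decomp:
  assumes "gval u v a b f 0"
  obtains g1 g2 d1 d2 where "gval u v a b g1 d1" "gval u v a b g2 d2"
    "f = (u - \<iota> a) * g1 + (v - \<iota> b) * g2"
proof -
  obtain F G where G: "eval2 G a b \<noteq> 0" "f = subst2 E F u v / subst2 E G u v" "eval2 F a b = 0"
    using assms(1) unfolding gval_def by auto
  obtain F1 F2 where
    F: "subst2 E F u v = \<iota> (eval2 F a b) + (u - \<iota> a) * subst2 E F1 u v + (v - \<iota> b) * subst2 E F2 u v"
    using subst2_maximal_ideal by blast
  have "gval u v a b (subst2 E F1 u v / subst2 E G u v) (eval2 F1 a b / eval2 G a b)"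
       "gval u v a b (subst2 E F2 u v / subst2 E G u v) (eval2 F2 a b / eval2 G a b)"
    using G unfolding gval_def by blast+
  then show thesis
    using that G F specializes_nz[OF G(1)] by (simp add: field_simps)
qed

end

section \<open>The two charts and the pole order at infinity\<close>

lemma value_at_eq_gval:
  "value_at E (Affine a b) = gval X Y a b" "value_at E Infinity = gval (X / Y) (1 / Y) 0 0"
  by (simp_all add: fun_eq_iff gval_def)

lemma specializes_affine:
  assumes "Affine a b \<in> points E"
  shows "specializes X Y a b"
  unfolding specializes_def subst2_eq_0_iff
proof safe
  fix F assume "weierstrass_poly E dvd F"
  then obtain G where "F = weierstrass_poly E * G" by blast
  then show "eval2 F a b = 0" using assms by (simp add: points_def)
qed

text \<open>Elements of the coordinate ring with a pole of order at most n at infinity, where X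
  counts 2 and Y counts 3. Degrees stand in for the valuation at infinity, which is constructed only
  after values there are known to be well defined. The case q = 0 is separate because
  \<open>degree 0 = 0\<close> would otherwise impose n >= 3.\<close>

definition filt :: "nat \<Rightarrow> 'k set" where
  "filt n = {elem p q | p q. 2 * degree p \<le> n \<and> (q = 0 \<or> 2 * degree q + 3 \<le> n)}"

lemma filtI: "2 * degree p \<le> n \<Longrightarrow> q = 0 \<or> 2 * degree q + 3 \<le> n \<Longrightarrow> elem p q \<in> filt n"
  unfolding filt_def by blast

lemma filt_mono: "m \<le> n \<Longrightarrow> f \<in> filt m \<Longrightarrow> f \<in> filt n"
  unfolding filt_def by fastforce

lemma filt_add:
  assumes "f \<in> filt n" "g \<in> filt n" shows "f + g \<in> filt n"
proof -
  obtain p q p' q' where *: "f = elem p q" "g = elem p' q'"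
    "2 * degree p \<le> n" "q = 0 \<or> 2 * degree q + 3 \<le> n"
    "2 * degree p' \<le> n" "q' = 0 \<or> 2 * degree q' + 3 \<le> n"
    using assms unfolding filt_def by blast
  have "2 * degree (p + p') \<le> n" using degree_add_le_max[of p p'] *(3,5) by linarith
  moreover have "q + q' = 0 \<or> 2 * degree (q + q') + 3 \<le> n"
    using degree_add_le_max[of q q'] *(4,6) by (auto simp: max_def split: if_splits)
  ultimately show ?thesis unfolding *(1,2) elem_add by (rule filtI)
qed

lemma filt_emb_mult:
  assumes "f \<in> filt n" shows "\<iota> c * f \<in> filt n"
proof -
  obtain p q where *: "f = elem p q" "2 * degree p \<le> n" "q = 0 \<or> 2 * degree q + 3 \<le> n"
    using assms unfolding filt_def by blast
  have "\<iota> c * f = elem (smult c p) (smult c q)" by (simp add: *(1) elem_def algebra_simps)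
  then show ?thesis using * by (auto intro!: filtI split: if_splits)
qed

lemma filt_X_mult:
  assumes "f \<in> filt n" shows "X * f \<in> filt (n + 2)"
proof -
  obtain p q where *: "f = elem p q" "2 * degree p \<le> n" "q = 0 \<or> 2 * degree q + 3 \<le> n"
    using assms unfolding filt_def by blast
  have "X * f = elem (pCons 0 p) (pCons 0 q)" by (simp add: *(1) elem_def algebra_simps)
  then show ?thesis using * by (auto intro!: filtI simp: degree_pCons_eq_if split: if_splits)
qed

lemma degree_cubic: "degree cubic = 3"
  by (simp add: cubic_def)

lemma degree_linear_coeff: "degree linear_coeff \<le> 1"
  by (simp add: linear_coeff_def)

lemma filt_Y_mult:
  assumes "f \<in> filt n" shows "Y * f \<in> filt (n + 3)"
proof -
  obtain p q where *: "f = elem p q" "2 * degree p \<le> n" "q = 0 \<or> 2 * degree q + 3 \<le> n"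
    using assms unfolding filt_def by blast
  have "Y * f = elem 0 1 * elem p q" by (simp add: *(1) elem_def)
  also have "\<dots> = elem (q * cubic) (p - q * linear_coeff)" unfolding elem_mult by simp
  finally have Yf: "Y * f = elem (q * cubic) (p - q * linear_coeff)" .
  have "degree (q * cubic) \<le> degree q + 3" using degree_mult_le[of q cubic] degree_cubic by simp
  moreover have "degree (q * linear_coeff) \<le> degree q + 1"
    using degree_mult_le[of q linear_coeff] degree_linear_coeff by linarith
  moreover have "degree (p - q * linear_coeff) \<le> max (degree p) (degree (q * linear_coeff))"
    by (rule degree_diff_le_max)
  ultimately show ?thesis unfolding Yf using *(2,3)
    by (intro filtI) (auto simp: max_def split: if_splits)
qed

text \<open>An element and its conjugate both have pole order at most n, so the norm has pole order
  at most 2 n; as X counts 2, its X-degree is at most n.\<close>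

lemma degree_norm_le:
  assumes "elem p q \<in> filt n" shows "degree (norm_poly p q) \<le> n"
proof -
  \<comment> \<open>Coordinates with respect to 1, Y are unique, so the witnesses supplied by
    \<open>filt\<close> are p and q themselves.\<close>
  have *: "2 * degree p \<le> n \<and> (q = 0 \<or> 2 * degree q + 3 \<le> n)"
  proof -
    obtain p' q' where e: "elem p q = elem p' q'" "2 * degree p' \<le> n" "q' = 0 \<or> 2 * degree q' + 3 \<le> n"
      using assms unfolding filt_def by blast
    have "elem (p - p') (q - q') = 0" using e(1) by (simp add: elem_def algebra_simps)
    then show ?thesis using e elem_eq_0_iff by auto
  qed
  have 1: "degree (p * p) \<le> n" using degree_mult_le[of p p] * by linarith
  have 2: "degree (p * q * linear_coeff) \<le> n"
  proof (cases "q = 0")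
    case False
    then show ?thesis
      using degree_mult_le[of "p * q" linear_coeff] degree_mult_le[of p q] degree_linear_coeff *
      by linarith
  qed simp
  have 3: "degree (q * q * cubic) \<le> n"
  proof (cases "q = 0")
    case False
    then show ?thesis
      using degree_mult_le[of "q * q" cubic] degree_mult_le[of q q] degree_cubic *
      by linarith
  qed simp
  show ?thesis unfolding norm_poly_def using 1 2 3 by (intro degree_diff_le)
qed

text \<open>Multiplication by Y multiplies the norm by the norm of Y, which is
  \<open>- cubic\<close>.\<close>

lemma Y_power_norm: "\<exists>p q. Y ^ m = elem p q \<and> norm_poly p q = (- cubic) ^ m"
proof (induction m)
  case 0
  show ?case by (rule exI[of _ 1], rule exI[of _ 0]) (simp add: elem_def norm_poly_def)
next
  case (Suc m)
  then obtain p q where *: "Y ^ m = elem p q" "norm_poly p q = (- cubic) ^ m" by blast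
  have "Y ^ Suc m = elem 0 1 * elem p q" by (simp add: *(1) elem_def)
  also have "\<dots> = elem (q * cubic) (p - q * linear_coeff)" unfolding elem_mult by simp
  finally have "Y ^ Suc m = elem (q * cubic) (p - q * linear_coeff)" .
  moreover have "norm_poly (q * cubic) (p - q * linear_coeff) = - cubic * norm_poly p q"
    by (simp add: norm_poly_def algebra_simps)
  ultimately show ?case using *(2) by auto
qed

text \<open>The norm of Y^m has degree 3 m, whereas elements of \<open>filt n\<close> have norms of
  degree at most n.\<close>

lemma Y_power_notin_filt: "n < 3 * m \<Longrightarrow> Y ^ m \<notin> filt n"
proof
  assume "Y ^ m \<in> filt n" "n < 3 * m"
  moreover obtain p q where *: "Y ^ m = elem p q" "norm_poly p q = (- cubic) ^ m"
    using Y_power_norm by blast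
  ultimately have "degree ((- cubic) ^ m) \<le> n" using degree_norm_le by force
  moreover have "degree ((- cubic) ^ m) = m * 3"
    using degree_power_eq[of "- cubic" m] degree_cubic by force
  ultimately show False using \<open>n < 3 * m\<close> by simp
qed

lemma filt_Y_power_mult: "f \<in> filt n \<Longrightarrow> Y ^ k * f \<in> filt (n + 3 * k)"
proof (induction k)
  case (Suc k)
  then have "Y * (Y ^ k * f) \<in> filt ((n + 3 * k) + 3)" using filt_Y_mult by blast
  then show ?case by (simp add: algebra_simps)
qed simp

text \<open>X/Y and 1/Y have no pole at infinity, so neither has a polynomial in them; multiplied by
  a high power Y^m it has no denominator and pole order at most 3 m.\<close>

lemma Y_power_clears: "\<exists>m. Y ^ m * subst2 E F (X / Y) (1 / Y) \<in> filt (3 * m)"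
proof (induction F)
  case 0
  have "elem 0 0 \<in> filt 0" by (rule filtI) auto
  then show ?case by (intro exI[of _ 0]) (simp add: elem_def)
next
  case (pCons c F)
  have "\<exists>m. Y ^ m * peval c (X / Y) \<in> filt (3 * m)"
  proof (induction c)
    case 0
    have "elem 0 0 \<in> filt 0" by (rule filtI) auto
    then show ?case by (intro exI[of _ 0]) (simp add: elem_def)
  next
    case (pCons d c)
    then obtain m where m: "Y ^ m * peval c (X / Y) \<in> filt (3 * m)" by blast
    have "elem [:d:] 0 \<in> filt 0" by (rule filtI) auto
    then have "Y ^ Suc m * \<iota> d \<in> filt (3 * Suc m)"
      using filt_Y_power_mult[of "\<iota> d" 0 "Suc m"] by (simp add: elem_def)
    moreover have "X * (Y ^ m * peval c (X / Y)) \<in> filt (3 * Suc m)"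
      using filt_X_mult[OF m] by (rule filt_mono[rotated]) simp
    moreover have "Y ^ Suc m * peval (pCons d c) (X / Y)
        = Y ^ Suc m * \<iota> d + X * (Y ^ m * peval c (X / Y))"
      using Y_neq_0 by (simp add: field_simps)
    ultimately show ?case using filt_add by metis
  qed
  then obtain m where m: "Y ^ m * peval c (X / Y) \<in> filt (3 * m)" by blast
  obtain m' where m': "Y ^ m' * subst2 E F (X / Y) (1 / Y) \<in> filt (3 * m')"
    using pCons by blast
  let ?n = "m + m' + 1"
  have "Y ^ (m' + 1) * (Y ^ m * peval c (X / Y)) \<in> filt (3 * ?n)"
    using filt_Y_power_mult[OF m, of "m' + 1"] by (simp add: algebra_simps)
  moreover have "Y ^ m * (Y ^ m' * subst2 E F (X / Y) (1 / Y)) \<in> filt (3 * ?n)"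
    using filt_Y_power_mult[OF m', of m] by (rule filt_mono[rotated]) simp
  moreover have "Y ^ ?n * subst2 E (pCons c F) (X / Y) (1 / Y)
     = Y ^ (m' + 1) * (Y ^ m * peval c (X / Y)) + Y ^ m * (Y ^ m' * subst2 E F (X / Y) (1 / Y))"
    using Y_neq_0 by (simp add: field_simps power_add)
  ultimately show ?case using filt_add by metis
qed

text \<open>Suppose a relation F had nonzero constant term c. Multiplied by Y^(m+1), this term
  becomes c Y^(m+1) with pole order 3 m + 3, while the remaining terms have pole order at most 3 m +
  2 because each contains a factor X/Y or 1/Y. They cannot cancel.\<close>

lemma specializes_infinity: "specializes (X / Y) (1 / Y) 0 0"
  unfolding specializes_def
proof safe
  fix F assume F0: "subst2 E F (X / Y) (1 / Y) = 0"
  let ?S = "\<lambda>F. subst2 E F (X / Y) (1 / Y)"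
  have "\<exists>F1 F2. ?S F = \<iota> (eval2 F 0 0) + (X / Y - \<iota> 0) * ?S F1 + (1 / Y - \<iota> 0) * ?S F2"
  proof (induction F)
    case 0
    show ?case by (rule exI[of _ 0], rule exI[of _ 0]) simp
  next
    case (pCons c F)
    obtain d q where "c = pCons d q" by (cases c) auto
    then show ?case
      by (intro exI[of _ "[:q:]"] exI[of _ F]) simp
  qed
  then obtain F1 F2 where
    F: "?S F = \<iota> (eval2 F 0 0) + (X / Y - \<iota> 0) * ?S F1 + (1 / Y - \<iota> 0) * ?S F2"
    by blast
  obtain m1 where m1: "Y ^ m1 * ?S F1 \<in> filt (3 * m1)" using Y_power_clears by blast
  obtain m2 where m2: "Y ^ m2 * ?S F2 \<in> filt (3 * m2)" using Y_power_clears by blast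
  let ?m = "m1 + m2"
  have "X * (Y ^ m2 * (Y ^ m1 * ?S F1)) \<in> filt (3 * ?m + 2)"
    using filt_X_mult[OF filt_Y_power_mult[OF m1, of m2]] by (simp add: algebra_simps)
  moreover have "Y ^ m1 * (Y ^ m2 * ?S F2) \<in> filt (3 * ?m + 2)"
    using filt_Y_power_mult[OF m2, of m1] by (rule filt_mono[rotated]) simp
  ultimately have in_filt: "X * (Y ^ m2 * (Y ^ m1 * ?S F1)) + Y ^ m1 * (Y ^ m2 * ?S F2) \<in> filt (3 * ?m + 2)"
    by (rule filt_add)
  show "eval2 F 0 0 = 0"
  proof (rule ccontr)
    assume nz: "eval2 F 0 0 \<noteq> 0"
    have "0 = Y ^ (?m + 1) * ?S F" using F0 by simp
    also have "\<dots> = \<iota> (eval2 F 0 0) * Y ^ (?m + 1) + (X * (Y ^ m2 * (Y ^ m1 * ?S F1)) + Y ^ m1 * (Y ^ m2 * ?S F2))"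
      unfolding F using Y_neq_0 by (simp add: field_simps power_add)
    finally have "\<iota> (eval2 F 0 0) * Y ^ (?m + 1)
        = - (X * (Y ^ m2 * (Y ^ m1 * ?S F1)) + Y ^ m1 * (Y ^ m2 * ?S F2))"
      using eq_neg_iff_add_eq_0 by metis
    then have "Y ^ (?m + 1) = \<iota> (- inverse (eval2 F 0 0)) * (X * (Y ^ m2 * (Y ^ m1 * ?S F1)) + Y ^ m1 * (Y ^ m2 * ?S F2))"
      using nz by (simp add: field_simps)
    then have "Y ^ (?m + 1) \<in> filt (3 * ?m + 2)" using filt_emb_mult[OF in_filt] by metis
    then show False using Y_power_notin_filt[of "3 * ?m + 2" "?m + 1"] by simp
  qed
qed

end

section \<open>Discrete valuations\<close>

context
  fixes R :: "'k::field set" and v :: "'k \<Rightarrow> int"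
  assumes v: "normalized_valuation_with_ring R v"
begin

lemma nval_mult: "f \<noteq> 0 \<Longrightarrow> g \<noteq> 0 \<Longrightarrow> v (f * g) = v f + v g"
  and nval_add: "f \<noteq> 0 \<Longrightarrow> g \<noteq> 0 \<Longrightarrow> f + g \<noteq> 0 \<Longrightarrow> min (v f) (v g) \<le> v (f + g)"
  and nval_0: "v 0 = 0"
  and nval_ring: "f \<in> R \<longleftrightarrow> f = 0 \<or> 0 \<le> v f"
  and nval_uniformizer: "\<exists>f. f \<noteq> 0 \<and> v f = 1"
  using v unfolding normalized_valuation_with_ring_def by auto

lemma nval_1: "v 1 = 0"
  using nval_mult[of 1 1] by simp

lemma nval_inverse: "v (inverse f) = - v f"
  using nval_mult[of f "inverse f"] nval_1 nval_0 by (cases "f = 0") auto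

lemma nval_minus: "v (- f) = v f"
proof -
  have "2 * v (- 1) = 0" using nval_mult[of "- 1" "- 1"] nval_1 by simp
  then show ?thesis using nval_mult[of "- 1" f] by (cases "f = 0") auto
qed

lemma nval_power: "f \<noteq> 0 \<Longrightarrow> v (f ^ n) = int n * v f"
  by (induction n) (auto simp: nval_1 nval_mult algebra_simps)

lemma nval_power_int: "f \<noteq> 0 \<Longrightarrow> v (f powi n) = n * v f"
  by (cases n rule: int_cases2) (auto simp: power_int_minus nval_inverse nval_power)

end

text \<open>For nonzero f the quotient f / t^(v f) is a unit of R, and units have value 0 under
  every valuation with ring R. Hence w is w t times v, and normalization gives w t = 1.\<close>

lemma normalized_valuation_unique:
  fixes R :: "'k::field set"
  assumes v: "normalized_valuation_with_ring R v" and w: "normalized_valuation_with_ring R w"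
  shows "v = w"
proof -
  obtain t where t: "t \<noteq> 0" "v t = 1" using nval_uniformizer[OF v] by blast
  have w_eq: "w f = v f * w t" if "f \<noteq> 0" for f
  proof -
    define g where "g = f * t powi (- v f)"
    have g: "g \<noteq> 0" using that t by (simp add: g_def)
    have "v g = 0"
      unfolding g_def using that t by (simp add: nval_mult[OF v] nval_power_int[OF v])
    then have "g \<in> R" "inverse g \<in> R"
      by (auto simp: nval_ring[OF v] nval_inverse[OF v])
    then have "w g = 0" using g by (auto simp: nval_ring[OF w] nval_inverse[OF w])
    then show ?thesis
      unfolding g_def using that t by (simp add: nval_mult[OF w] nval_power_int[OF w])
  qed
  obtain f where f: "f \<noteq> 0" "w f = 1" using nval_uniformizer[OF w] by blast
  have "t \<in> R" using t by (simp add: nval_ring[OF v])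
  then have "0 \<le> w t" using t by (simp add: nval_ring[OF w])
  moreover have "v f * w t = 1" using w_eq f by metis
  ultimately have "w t = 1" by (auto simp: zmult_eq_1_iff)
  show ?thesis
  proof
    show "v f = w f" for f
      using w_eq[of f] \<open>w t = 1\<close> nval_0[OF v] nval_0[OF w] by (cases "f = 0") auto
  qed
qed

text \<open>
  A Noetherian hypothesis is replaced by the requirement that every element of the field
  is carried into the ring by a power of the uniformizer.
\<close>

lemma normalized_valuation_exists:
  fixes R :: "'k::field set"
  assumes R1: "1 \<in> R" and R_add: "\<And>f g. f \<in> R \<Longrightarrow> g \<in> R \<Longrightarrow> f + g \<in> R"
    and R_mult: "\<And>f g. f \<in> R \<Longrightarrow> g \<in> R \<Longrightarrow> f * g \<in> R"
    and t: "t \<in> R" "t \<noteq> 0" "inverse t \<notin> R"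
    and unit_or_div: "\<And>f. f \<in> R \<Longrightarrow> f \<noteq> 0 \<Longrightarrow> inverse f \<in> R \<or> f / t \<in> R"
    and bounded: "\<And>f. \<exists>n. t ^ n * f \<in> R"
  shows "\<exists>v. normalized_valuation_with_ring R v \<and> v t = 1"
proof -
  have R_power: "t ^ n \<in> R" for n by (induction n) (auto intro: R1 R_mult t)
  have not_inverse_power: "inverse (t ^ n) \<notin> R" if n: "n > 0" for n
  proof
    assume *: "inverse (t ^ n) \<in> R"
    obtain m where m: "n = Suc m" using n by (cases n) auto
    have "t ^ m * inverse (t ^ n) \<in> R" using R_mult[OF R_power *] .
    then show False using t by (simp add: m field_simps)
  qed
  define unit where "unit f \<longleftrightarrow> f \<noteq> 0 \<and> f \<in> R \<and> inverse f \<in> R" for f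
  have unit_mult: "unit (f * g)" if "unit f" "unit g" for f g
    using that R_mult by (auto simp: unit_def)
  have unit_inv: "unit (inverse f)" if "unit f" for f using that by (auto simp: unit_def)
  have R_fact: "\<exists>k u. f = t ^ k * u \<and> unit u" if f: "f \<in> R" "f \<noteq> 0" for f
  proof -
    obtain n where n: "t ^ n * inverse f \<in> R" using bounded by blast
    \<comment> \<open>If k exceeded n, the product of t^n / f and f / t^k would put a negative power
      of t into R.\<close>
    have bound: "k \<le> n" if k: "f / t ^ k \<in> R" for k
    proof (rule ccontr)
      assume "\<not> k \<le> n"
      then have "k = n + (k - n)" by simp
      then have "t ^ k = t ^ n * t ^ (k - n)" by (metis power_add)
      then have "t ^ n * inverse f * (f / t ^ k) = inverse (t ^ (k - n))"
        using f t by (simp add: field_simps)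
      then show False using R_mult[OF n k] not_inverse_power[of "k - n"] \<open>\<not> k \<le> n\<close> by simp
    qed
    \<comment> \<open>The largest power of t is split off; what remains is not divisible by t in R
      and is therefore a unit.\<close>
    define k where "k = (GREATEST k. f / t ^ k \<in> R)"
    have 1: "f / t ^ k \<in> R" unfolding k_def
      by (rule GreatestI_nat[of _ 0 n]) (use f bound in auto)
    have "\<not> f / t ^ k / t \<in> R"
    proof
      assume "f / t ^ k / t \<in> R"
      then have "f / t ^ Suc k \<in> R" by (simp add: field_simps)
      then have "Suc k \<le> k" unfolding k_def
        using Greatest_le_nat[of "\<lambda>k. f / t ^ k \<in> R" "Suc k" n] bound by (simp add: k_def)
      then show False by simp
    qed
    then have "unit (f / t ^ k)" using unit_or_div[OF 1] 1 f t by (auto simp: unit_def)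
    then show ?thesis using t by (intro exI[of _ k] exI[of _ "f / t ^ k"]) auto
  qed
  have fact: "\<exists>n u. f = t powi n * u \<and> unit u" if f: "f \<noteq> 0" for f
  proof -
    obtain m where m: "t ^ m * f \<in> R" using bounded by blast
    then obtain k u where k: "t ^ m * f = t ^ k * u" "unit u" using R_fact f t by fastforce
    have "f = t powi (int k - int m) * u"
      using k t by (simp add: power_int_diff field_simps)
    then show ?thesis using k by blast
  qed
  then obtain w u where w: "\<And>f. f \<noteq> 0 \<Longrightarrow> f = t powi (w f) * u f \<and> unit (u f)" by metis
  have R_iff: "t powi n * z \<in> R \<longleftrightarrow> 0 \<le> n" if "unit z" for n z
  proof
    assume *: "t powi n * z \<in> R"
    show "0 \<le> n"
    proof (rule ccontr)
      assume "\<not> 0 \<le> n"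
      have "z \<noteq> 0" using that by (simp add: unit_def)
      have "t powi n * z * inverse z \<in> R"
        by (rule R_mult[OF *]) (use that in \<open>simp add: unit_def\<close>)
      then have "t powi n \<in> R" using \<open>z \<noteq> 0\<close> by (simp add: mult.assoc)
      then show False using not_inverse_power[of "nat (- n)"] \<open>\<not> 0 \<le> n\<close>
        by (simp add: power_int_def power_inverse)
    qed
  next
    assume "0 \<le> n"
    then show "t powi n * z \<in> R" using that R_power R_mult
      by (auto simp: unit_def power_int_def)
  qed
  have uniq: "n \<le> m" if "t powi n * z = t powi m * y" "unit z" "unit y" for n m z y
  proof -
    have "t powi (m - n) * (y * inverse z) = 1"
      using that t by (simp add: unit_def power_int_diff field_simps)
    then show ?thesis using R_iff[OF unit_mult[OF that(3) unit_inv[OF that(2)]], of "m - n"] R1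
      by simp
  qed
  have w_eq: "w f = n" if "f = t powi n * z" "unit z" for f n z
  proof -
    have "f \<noteq> 0" using that t by (auto simp: unit_def)
    then show ?thesis using w[of f] uniq[of n z "w f" "u f"] uniq[of "w f" "u f" n z] that by simp
  qed
  \<comment> \<open>The valuation is read off from membership of t^(-m) f in R, which reduces the
    inequality for sums to closure of R under addition.\<close>
  have shift: "t powi (- m) * f \<in> R \<longleftrightarrow> m \<le> w f" if "f \<noteq> 0" for f m
  proof -
    have "t powi (- m) * f = t powi (w f - m) * u f"
      using w[OF that] t by (simp add: power_int_diff power_int_minus field_simps)
    then show ?thesis using R_iff w[OF that] by simp
  qed
  define v where "v f = (if f = 0 then 0 else w f)" for f
  have "normalized_valuation_with_ring R v"
    unfolding normalized_valuation_with_ring_def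
  proof (intro conjI allI impI)
    show "v 0 = 0" by (simp add: v_def)
  next
    fix f g :: 'k assume fg: "f \<noteq> 0" "g \<noteq> 0"
    have "f * g = (t powi w f * u f) * (t powi w g * u g)" using w fg by metis
    also have "\<dots> = t powi (w f + w g) * (u f * u g)" using t by (simp add: power_int_add)
    finally have "w (f * g) = w f + w g" using w_eq unit_mult w fg by blast
    then show "v (f * g) = v f + v g" using fg by (simp add: v_def)
  next
    fix f g :: 'k assume fg: "f \<noteq> 0" "g \<noteq> 0" "f + g \<noteq> 0"
    let ?m = "min (w f) (w g)"
    have "t powi (- ?m) * f + t powi (- ?m) * g \<in> R"
      using shift fg by (intro R_add) auto
    then have "t powi (- ?m) * (f + g) \<in> R" by (simp add: distrib_left)
    then show "min (v f) (v g) \<le> v (f + g)" using shift fg by (simp add: v_def)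
  next
    have "w t = 1" by (rule w_eq[of _ _ 1]) (use R1 in \<open>auto simp: unit_def\<close>)
    then show "\<exists>f. f \<noteq> 0 \<and> v f = 1" using t by (auto simp: v_def)
  next
    have "0 \<in> R" using bounded[of 0] by simp
    then have "f \<in> R \<longleftrightarrow> f = 0 \<or> 0 \<le> v f" for f
      using shift[of f 0] by (cases "f = 0") (simp_all add: v_def)
    then show "R = {f. f = 0 \<or> 0 \<le> v f}" by blast
  qed
  moreover have "v t = 1"
    using w_eq[of t 1 1] t R1 by (simp add: v_def unit_def)
  ultimately show ?thesis by blast
qed


section \<open>The local rings of the curve as discrete valuation rings\<close>

context weierstrass
begin

text \<open>As u - a and v - b generate the maximal ideal and t divides both, every non-unit of the
  local ring is divisible by t. Clearing denominators (\<open>bounded\<close>) depends on the chart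
  and is supplied separately.\<close>

lemma gval_nval:
  assumes sp: "specializes u v a b" and t: "gval u v a b t 0" "t \<noteq> 0"
    and g1: "u - \<iota> a = t * g1" "gval u v a b g1 d1" and g2: "v - \<iota> b = t * g2" "gval u v a b g2 d2"
    and bounded: "\<And>f. \<exists>n c. gval u v a b (t ^ n * f) c"
  shows "\<exists>w. normalized_valuation_with_ring {f. \<exists>c. gval u v a b f c} w \<and> w t = 1"
proof (rule normalized_valuation_exists)
  let ?R = "{f. \<exists>c. gval u v a b f c}"
  show "1 \<in> ?R" using gval_emb[of u v a b 1] by auto
  show "f + g \<in> ?R" "f * g \<in> ?R" if "f \<in> ?R" "g \<in> ?R" for f g
    using that gval_add[OF sp] gval_mult[OF sp] by blast+
  show "t \<in> ?R" "t \<noteq> 0" using t by auto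
  show "inverse t \<notin> ?R"
  proof
    assume "inverse t \<in> ?R"
    then obtain c where "gval u v a b (inverse t) c" by blast
    then have "gval u v a b (t * inverse t) (0 * c)" using gval_mult[OF sp t(1)] by blast
    moreover have "gval u v a b (t * inverse t) 1" using t gval_emb[of u v a b 1] by simp
    ultimately show False using gval_unique[OF sp] by force
  qed
  show "\<exists>n. t ^ n * f \<in> ?R" for f using bounded by auto
  show "inverse f \<in> ?R \<or> f / t \<in> ?R" if f: "f \<in> ?R" for f
  proof -
    obtain c where c: "gval u v a b f c" using f by blast
    show ?thesis
    proof (cases "c = 0")
      case True
      obtain h1 h2 e1 e2 where h: "gval u v a b h1 e1" "gval u v a b h2 e2"
        "f = (u - \<iota> a) * h1 + (v - \<iota> b) * h2"
        using gval_zero_decomp[OF sp] c True by metis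
      have "f / t = g1 * h1 + g2 * h2" using h(3) t unfolding g1(1) g2(1) by (simp add: field_simps)
      then show ?thesis
        using gval_add[OF sp gval_mult[OF sp g1(2) h(1)] gval_mult[OF sp g2(2) h(2)]] by auto
    next
      case False
      then show ?thesis using gval_inverse[OF sp c] by blast
    qed
  qed
qed

text \<open>The Y-derivative of the Weierstrass polynomial at (a, b); on the curve it vanishes
  exactly at the affine points fixed by negation.\<close>

definition deriv_Y :: "'c \<Rightarrow> 'c \<Rightarrow> 'c" where "deriv_Y a b = 2 * b + a1 E * a + a3 E"
text \<open>The negative of the X-derivative, so that the tangent slope is
  \<open>deriv_X / deriv_Y\<close>.\<close>

definition deriv_X :: "'c \<Rightarrow> 'c \<Rightarrow> 'c" where
  "deriv_X a b = 3 * a\<^sup>2 + 2 * a2 E * a + a4 E - a1 E * b"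
text \<open>Subtracting the equation at (a, b) from the equation of the curve gives (Y - b) U = (X -
  a) V; U and V are these cofactors, with values \<open>deriv_Y\<close> and \<open>deriv_X\<close>
  at (a, b).\<close>

definition fun_U :: "'c \<Rightarrow> 'k" where "fun_U b = Y + \<iota> b + \<iota> (a1 E) * X + \<iota> (a3 E)"
definition fun_V :: "'c \<Rightarrow> 'c \<Rightarrow> 'k" where
  "fun_V a b = X\<^sup>2 + \<iota> a * X + \<iota> (a\<^sup>2) + \<iota> (a2 E) * (X + \<iota> a) + \<iota> (a4 E) - \<iota> (a1 E * b)"

lemma eval_weierstrass:
  "eval2 (weierstrass_poly E) a b = b\<^sup>2 + a1 E * a * b + a3 E * b - (a ^ 3 + a2 E * a\<^sup>2 + a4 E * a + a6 E)"
  by (simp add: weierstrass_poly_def algebra_simps power2_eq_square power3_eq_cube)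

lemma affine_in_points_iff:
  "Affine a b \<in> points E \<longleftrightarrow>
     b\<^sup>2 + a1 E * a * b + a3 E * b = a ^ 3 + a2 E * a\<^sup>2 + a4 E * a + a6 E"
  by (simp add: points_def eval_weierstrass)

lemma Infinity_in_points [simp]: "Infinity \<in> points E"
  by (simp add: points_def)

lemma Y_squared':
  "Y\<^sup>2 + \<iota> (a1 E) * X * Y + \<iota> (a3 E) * Y
     = X ^ 3 + \<iota> (a2 E) * X\<^sup>2 + \<iota> (a4 E) * X + \<iota> (a6 E)"
  using Y_squared by (simp add: cubic_def linear_coeff_def algebra_simps power2_eq_square power3_eq_cube)

lemma smooth: "Affine a b \<in> points E \<Longrightarrow> deriv_X a b \<noteq> 0 \<or> deriv_Y a b \<noteq> 0"
proof -
  assume "Affine a b \<in> points E"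
  then have "eval2 (map_poly pderiv (weierstrass_poly E)) a b \<noteq> 0 \<or>
        eval2 (pderiv (weierstrass_poly E)) a b \<noteq> 0"
    using elliptic by (simp add: elliptic_curve_def smooth_curve_def points_def)
  moreover have "eval2 (map_poly pderiv (weierstrass_poly E)) a b = - deriv_X a b"
    by (simp add: weierstrass_poly_def map_poly_pCons pderiv_pCons deriv_X_def algebra_simps
        power2_eq_square)
  moreover have "eval2 (pderiv (weierstrass_poly E)) a b = deriv_Y a b"
    by (simp add: weierstrass_poly_def pderiv_pCons deriv_Y_def algebra_simps)
  ultimately show ?thesis by auto
qed

lemma UV_identity:
  assumes "Affine a b \<in> points E"
  shows "(Y - \<iota> b) * fun_U b = (X - \<iota> a) * fun_V a b"
proof -
  have "\<iota> (b\<^sup>2 + a1 E * a * b + a3 E * b) = \<iota> (a ^ 3 + a2 E * a\<^sup>2 + a4 E * a + a6 E)"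
    using assms affine_in_points_iff by simp
  then show ?thesis using Y_squared' unfolding fun_U_def fun_V_def
    by (simp add: algebra_simps power2_eq_square power3_eq_cube)
qed

lemma gval_peval_fst: "gval u v a b (peval p u) (poly p a)"
  using gval_subst2[of u v a b "[:p:]"] by simp

lemma gval_U: "gval X Y a b (fun_U b) (deriv_Y a b)"
  using gval_subst2[of X Y a b "[:[:b + a3 E, a1 E:], 1:]"]
  by (simp add: fun_U_def deriv_Y_def algebra_simps)

lemma gval_V: "gval X Y a b (fun_V a b) (deriv_X a b)"
  using gval_subst2[of X Y a b "[:[:a\<^sup>2 + a2 E * a + a4 E - a1 E * b, a + a2 E, 1:]:]"]
  by (simp add: fun_V_def deriv_X_def algebra_simps power2_eq_square)

lemma gval_elem: "gval X Y a b (elem p q) (poly p a + poly q a * b)"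
  using gval_subst2[of X Y a b "[:p, q:]"] by (simp add: elem_def algebra_simps)

text \<open>Write the denominator as (X - a)^d r' with r' nonzero at a. Each factor X - a is
  absorbed by t^2, since t^2 / (X - a) is regular, and r' is a unit. The square is taken because X -
  a may vanish to order 2.\<close>

lemma gval_bounded_affine:
  assumes P: "Affine a b \<in> points E" and t: "gval X Y a b t 0" "t \<noteq> 0"
    and g: "t\<^sup>2 / (X - \<iota> a) = g" "gval X Y a b g d"
  shows "\<exists>n c. gval X Y a b (t ^ n * f) c"
proof -
  note sp = specializes_affine[OF P]
  obtain p q r where r: "r \<noteq> 0" "f = elem p q / peval r X" by (rule normal_form)
  define d where "d = order a r"
  obtain r' where r': "r = [:- a, 1:] ^ d * r'" "\<not> [:- a, 1:] dvd r'"
    using order_decomp[OF r(1)] d_def by blast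
  have "poly r' a \<noteq> 0" using r'(2) by (simp add: poly_eq_0_iff_dvd)
  then have "gval X Y a b (inverse (peval r' X)) (inverse (poly r' a))"
    using gval_inverse[OF sp gval_peval_fst] by blast
  moreover have "\<exists>c. gval X Y a b (g ^ d) c"
  proof (induction d)
    case 0
    show ?case using gval_emb[of X Y a b 1] by auto
  next
    case (Suc d)
    then show ?case using gval_mult[OF sp g(2)] by auto
  qed
  ultimately obtain c where "gval X Y a b (elem p q * (g ^ d * inverse (peval r' X))) c"
    using gval_mult[OF sp] gval_elem by metis
  moreover have "elem p q * (g ^ d * inverse (peval r' X)) = t ^ (2 * d) * f"
    using r(2) g(1)[symmetric] by (simp add: r'(1) power_divide field_simps flip: power_mult)
  ultimately show ?thesis by metis
qed

text \<open>U is a unit at (a, b), so Y - b is a multiple of X - a in the local ring, and X - a is a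
  uniformizer.\<close>

lemma nval_affine_unramified:
  assumes P: "Affine a b \<in> points E" and Y0: "deriv_Y a b \<noteq> 0"
  shows "\<exists>w. normalized_valuation_with_ring (local_ring E (Affine a b)) w \<and> w (X - \<iota> a) = 1"
proof -
  note sp = specializes_affine[OF P]
  have Xa: "gval X Y a b (X - \<iota> a) 0"
    using gval_add[OF sp gval_fst gval_emb[of _ _ _ _ "- a"]] by simp
  have U: "gval X Y a b (fun_V a b * inverse (fun_U b)) (deriv_X a b * inverse (deriv_Y a b))"
    using gval_mult[OF sp gval_V gval_inverse[OF sp gval_U Y0]] .
  have "fun_U b \<noteq> 0" using gval_U[of a b] Y0 gval_unique[OF sp _ gval_emb[of _ _ _ _ 0]] by force
  then have "Y - \<iota> b = (X - \<iota> a) * (fun_V a b * inverse (fun_U b))"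
    using UV_identity[OF P] by (simp add: field_simps)
  moreover have "X - \<iota> a \<noteq> 0" using X_neq_emb by simp
  moreover have "(X - \<iota> a)\<^sup>2 / (X - \<iota> a) = X - \<iota> a" by (simp add: power2_eq_square)
  ultimately show ?thesis
    unfolding local_ring_def value_at_eq_gval
    using gval_nval[OF sp Xa _ _ gval_emb[of _ _ _ _ 1] _ U] gval_bounded_affine[OF P Xa _ _ Xa]
    by simp
qed

text \<open>Where \<open>deriv_Y\<close> vanishes, U equals (Y - b) + a1 (X - a); inserting this
  into (Y - b) U = (X - a) V leaves (Y - b)^2 on one side.\<close>

lemma ramified_identity:
  assumes P: "Affine a b \<in> points E" and Y0: "deriv_Y a b = 0"
  shows "(X - \<iota> a) * (fun_V a b - \<iota> (a1 E) * (Y - \<iota> b)) = (Y - \<iota> b)\<^sup>2"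
proof -
  have "\<iota> (2 * b + a1 E * a + a3 E) = 0" using Y0 by (simp add: deriv_Y_def del: emb_add emb_mult)
  then have U: "fun_U b = (Y - \<iota> b) + \<iota> (a1 E) * (X - \<iota> a)"
    unfolding fun_U_def by (simp add: algebra_simps)
  show ?thesis using UV_identity[OF P] unfolding U by (simp add: algebra_simps power2_eq_square)
qed

text \<open>By smoothness \<open>deriv_X\<close> is nonzero, so the cofactor of X - a is a unit: Y -
  b is a uniformizer and X - a has a double zero.\<close>

lemma nval_affine_ramified:
  assumes P: "Affine a b \<in> points E" and Y0: "deriv_Y a b = 0"
  shows "\<exists>w. normalized_valuation_with_ring (local_ring E (Affine a b)) w \<and>
           w (Y - \<iota> b) = 1 \<and> w (X - \<iota> a) = 2"
proof -
  note sp = specializes_affine[OF P]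
  let ?g = "fun_V a b - \<iota> (a1 E) * (Y - \<iota> b)"
  have X0: "deriv_X a b \<noteq> 0" using smooth[OF P] Y0 by simp
  have Yb: "gval X Y a b (Y - \<iota> b) 0"
    using gval_add[OF sp gval_snd gval_emb[of _ _ _ _ "- b"]] by simp
  have g: "gval X Y a b ?g (deriv_X a b)"
    using gval_add[OF sp gval_V gval_mult[OF sp gval_emb[of _ _ _ _ "- a1 E"] Yb]] by simp
  have g0: "?g \<noteq> 0" using g X0 gval_unique[OF sp _ gval_emb[of _ _ _ _ 0]] by force
  have Yb0: "Y - \<iota> b \<noteq> 0" using elem_eq_0_iff[of "[:- b:]" 1] by (simp add: elem_def)
  have Xa0: "X - \<iota> a \<noteq> 0" using X_neq_emb by simp
  note id = ramified_identity[OF P Y0]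
  have inv: "gval X Y a b (inverse ?g) (inverse (deriv_X a b))" by (rule gval_inverse[OF sp g X0])
  have "X - \<iota> a = (Y - \<iota> b) * ((Y - \<iota> b) * inverse ?g)"
    using id g0 by (simp add: field_simps power2_eq_square)
  moreover have "(Y - \<iota> b)\<^sup>2 / (X - \<iota> a) = ?g" unfolding id[symmetric] using Xa0 by simp
  ultimately obtain w where w: "normalized_valuation_with_ring (local_ring E (Affine a b)) w"
      "w (Y - \<iota> b) = 1"
    unfolding local_ring_def value_at_eq_gval
    using gval_nval[OF sp Yb Yb0 _ gval_mult[OF sp Yb inv] _ gval_emb[of _ _ _ _ 1]]
      gval_bounded_affine[OF P Yb Yb0 _ g]
    by auto
  have "?g \<in> local_ring E (Affine a b)" "inverse ?g \<in> local_ring E (Affine a b)"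
    unfolding local_ring_def value_at_eq_gval using g inv by blast+
  then have "w ?g = 0" using g0 by (auto simp: nval_ring[OF w(1)] nval_inverse[OF w(1)])
  moreover have "w (X - \<iota> a) + w ?g = 2 * w (Y - \<iota> b)"
    using nval_mult[OF w(1) Xa0 g0] nval_power[OF w(1) Yb0, of 2] unfolding id by simp
  ultimately show ?thesis using w by auto
qed

text \<open>With z = X/Y and w = 1/Y the Weierstrass equation reads w T = z^3, where T has value 1
  at infinity.\<close>

definition inf_T :: 'k where
  "inf_T = 1 + \<iota> (a1 E) * (X / Y) + \<iota> (a3 E) * (1 / Y) - \<iota> (a2 E) * (X / Y)\<^sup>2
     - \<iota> (a4 E) * (X / Y) * (1 / Y) - \<iota> (a6 E) * (1 / Y)\<^sup>2"

lemma gval_inf_T: "gval (X / Y) (1 / Y) 0 0 inf_T 1"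
  using gval_subst2[of "X / Y" "1 / Y" 0 0 "[:[:1, a1 E, - a2 E:], [:a3 E, - a4 E:], [:- a6 E:]:]"]
  by (simp add: inf_T_def algebra_simps power2_eq_square)

lemma inf_identity: "(1 / Y) * inf_T = (X / Y) ^ 3"
proof -
  have "inf_T * Y\<^sup>2 = Y\<^sup>2 + \<iota> (a1 E) * X * Y + \<iota> (a3 E) * Y - \<iota> (a2 E) * X\<^sup>2 - \<iota> (a4 E) * X - \<iota> (a6 E)"
    using Y_neq_0 by (simp add: inf_T_def field_simps power2_eq_square)
  also have "\<dots> = X ^ 3" using Y_squared' by (simp add: algebra_simps)
  finally show ?thesis using Y_neq_0 by (simp add: field_simps power2_eq_square power3_eq_cube)
qed

text \<open>z = X/Y is a uniformizer: w = z^3 / T, X = T / z^2 and Y = T / z^3 with T a unit.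
  Polynomials in X are handled by reflecting them into polynomials in 1/X, which are regular at
  infinity.\<close>

lemma nval_infinity:
  "\<exists>w. normalized_valuation_with_ring (local_ring E Infinity) w \<and> w (X / Y) = 1"
proof -
  note sp = specializes_infinity
  let ?g = "gval (X / Y) (1 / Y) 0 0"
  let ?z = "X / Y"
  have z: "?g ?z 0" "?z \<noteq> 0" using gval_fst X_neq_0 Y_neq_0 by auto
  have T0: "inf_T \<noteq> 0" using gval_inf_T gval_unique[OF sp _ gval_emb[of _ _ _ _ 0]] by force
  have Ti: "?g (inverse inf_T) 1" using gval_inverse[OF sp gval_inf_T] by simp
  have w: "1 / Y = ?z * (?z\<^sup>2 * inverse inf_T)"
  proof -
    have "1 / Y = (1 / Y * inf_T) * inverse inf_T" using T0 by (simp add: mult.assoc)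
    then show ?thesis unfolding inf_identity by (simp add: power2_eq_square power3_eq_cube mult.assoc)
  qed
  have z2: "?g (?z\<^sup>2) 0" using gval_mult[OF sp z(1) z(1)] by (simp add: power2_eq_square)
  have z2T: "?g (?z\<^sup>2 * inverse inf_T) 0" using gval_mult[OF sp z2 Ti] by simp
  have X_eq: "?z\<^sup>2 * X = inf_T"
    using inf_identity z Y_neq_0 X_neq_0 by (simp add: field_simps power2_eq_square power3_eq_cube)
  have Y_eq: "?z ^ 3 * Y = inf_T" using inf_identity Y_neq_0 by (simp add: field_simps)
  have "\<exists>n c. ?g (?z ^ n * f) c" for f
  proof -
    obtain p q r where r: "r \<noteq> 0" "f = elem p q / peval r X" by (rule normal_form)
    have inv_X: "?g (inverse X) 0"
    proof -
      have "inverse X = ?z\<^sup>2 * inverse inf_T" using X_eq X_neq_0 Y_neq_0 T0 by (simp add: field_simps)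
      then show ?thesis using z2T by simp
    qed
    have pow: "\<exists>c. ?g (x ^ n) c" if "?g x d" for x d n
    proof (induction n)
      case 0
      show ?case using gval_emb[of ?z "1 / Y" 0 0 1] by auto
    next
      case (Suc n)
      then show ?case using gval_mult[OF sp that] by auto
    qed
    have refl: "peval p X = X ^ degree p * peval (reflect_poly p) (inverse X)" for p
    proof -
      have "map_poly \<iota> (reflect_poly p) = reflect_poly (map_poly \<iota> p)"
        by (rule poly_eqI) (simp add: coeff_map_poly coeff_reflect_poly degree_map_poly)
      then show ?thesis unfolding peval_def
        using poly_reflect_poly_nz[of "inverse X" "map_poly \<iota> p"] X_neq_0
        by (simp add: degree_map_poly power_inverse)
    qed
    have poly_at_inf: "?g (peval p (inverse X)) (poly p 0)" for p
    proof (induction p)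
      case 0
      show ?case using gval_emb[of ?z "1 / Y" 0 0 0] by simp
    next
      case (pCons c p)
      then show ?case
        using gval_add[OF sp gval_emb gval_mult[OF sp inv_X pCons.IH], of c] by simp
    qed
    have poly_bound: "\<exists>n c. ?g (?z ^ n * peval p X) c" for p
    proof -
      have "\<exists>c. ?g (inf_T ^ degree p) c" using pow[OF gval_inf_T] .
      then have "\<exists>c. ?g (inf_T ^ degree p * peval (reflect_poly p) (inverse X)) c"
        using gval_mult[OF sp _ poly_at_inf] by blast
      moreover have "inf_T ^ degree p * peval (reflect_poly p) (inverse X) = ?z ^ (2 * degree p) * peval p X"
        by (simp add: refl[of p] X_eq[symmetric] power_mult_distrib power_mult)
      ultimately show ?thesis by metis
    qed
    obtain n c where n: "?g (?z ^ n * peval p X) c" using poly_bound by blast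
    obtain m d where m: "?g (?z ^ m * peval q X) d" using poly_bound by blast
    obtain e1 where e1: "?g (?z ^ (m + 3)) e1" using pow[OF z(1)] by blast
    obtain e2 where e2: "?g (?z ^ n) e2" using pow[OF z(1)] by blast
    have "?g (?z ^ (m + 3) * (?z ^ n * peval p X) + ?z ^ n * (?z ^ m * peval q X * inf_T))
       (e1 * c + e2 * (d * 1))"
      by (intro gval_add[OF sp] gval_mult[OF sp] n m e1 e2 gval_inf_T)
    moreover have "?z ^ (m + 3) * (?z ^ n * peval p X) + ?z ^ n * (?z ^ m * peval q X * inf_T)
       = ?z ^ (m + 3 + n) * elem p q"
      by (simp add: Y_eq[symmetric] elem_def power_add algebra_simps)
    ultimately have 1: "?g (?z ^ (m + 3 + n) * elem p q) (e1 * c + e2 * (d * 1))" by simp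
    \<comment> \<open>The constant coefficient of the reflected polynomial is the leading
      coefficient of r, so it gives a unit at infinity.\<close>
    have "poly (reflect_poly r) 0 \<noteq> 0" using r(1) by simp
    then have 2: "?g (inverse (peval (reflect_poly r) (inverse X))) (inverse (poly (reflect_poly r) 0))"
      using gval_inverse[OF sp poly_at_inf] by blast
    obtain e3 where e3: "?g (inverse X ^ degree r) e3" using pow[OF inv_X] by blast
    have "?g (?z ^ (m + 3 + n) * elem p q * (inverse X ^ degree r * inverse (peval (reflect_poly r) (inverse X))))
       ((e1 * c + e2 * (d * 1)) * (e3 * inverse (poly (reflect_poly r) 0)))"
      by (intro gval_mult[OF sp] 1 2 e3)
    moreover have "?z ^ (m + 3 + n) * elem p q * (inverse X ^ degree r * inverse (peval (reflect_poly r) (inverse X)))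
       = ?z ^ (m + 3 + n) * f"
      unfolding r(2) refl[of r] by (simp add: field_class.field_divide_inverse power_inverse)
    ultimately show ?thesis by metis
  qed
  then show ?thesis
    unfolding local_ring_def value_at_eq_gval
  proof (intro gval_nval[OF sp z _ gval_emb[of _ _ _ _ 1] _ z2T])
    show "1 / Y - \<iota> 0 = ?z * (?z\<^sup>2 * inverse inf_T)" unfolding emb_0 diff_zero by (rule w)
  qed auto
qed

end

section \<open>Functions with prescribed poles\<close>

text \<open>Over a finite field, 1 plus the product of all X - a has positive degree and no
  root.\<close>

lemma infinite_alg_closed: "infinite (UNIV :: 'a::alg_closed_field set)"
proof
  assume fin: "finite (UNIV :: 'a set)"
  define p where "p = (\<Prod>a\<in>(UNIV :: 'a set). [:- a, 1:])"
  have "degree p = (\<Sum>a\<in>(UNIV :: 'a set). degree [:- a, 1:])"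
    unfolding p_def by (rule degree_prod_eq_sum_degree) auto
  then have deg: "degree p = card (UNIV :: 'a set)" by simp
  have pos: "card (UNIV :: 'a set) > 0" using fin by (simp add: card_gt_0_iff)
  have "degree (p + 1) = degree p" using deg pos by (intro degree_add_eq_left) simp
  then obtain x where x: "poly (p + 1) x = 0"
    using alg_closed_imp_poly_has_root[of "p + 1"] deg pos by auto
  have "poly p x = 0" unfolding p_def poly_prod using fin by (intro prod_zero) auto
  then show False using x by simp
qed

section \<open>Calculus of valuations and values at points\<close>

context weierstrass
begin

lemma val_nval:
  assumes "P \<in> points E"
  shows "normalized_valuation_with_ring (local_ring E P) (val E P)"
proof -
  have "\<exists>w. normalized_valuation_with_ring (local_ring E P) w"
  proof (cases P)
    case Infinity
    then show ?thesis using nval_infinity by blast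
  next
    case (Affine a b)
    then show ?thesis using nval_affine_ramified[of a b] nval_affine_unramified[of a b] assms by blast
  qed
  then show ?thesis unfolding val_def using normalized_valuation_unique by (metis theI)
qed

lemma val_eqI:
  assumes "P \<in> points E" "normalized_valuation_with_ring (local_ring E P) w"
  shows "val E P = w"
  using normalized_valuation_unique[OF val_nval[OF assms(1)] assms(2)] .

lemma value_at_rules:
  assumes "P \<in> points E"
  shows value_at_unique: "value_at E P f c \<Longrightarrow> value_at E P f d \<Longrightarrow> c = d"
    and value_at_add: "value_at E P f c \<Longrightarrow> value_at E P g d \<Longrightarrow> value_at E P (f + g) (c + d)"
    and value_at_mult: "value_at E P f c \<Longrightarrow> value_at E P g d \<Longrightarrow> value_at E P (f * g) (c * d)"
    and value_at_inverse: "value_at E P f c \<Longrightarrow> c \<noteq> 0 \<Longrightarrow> value_at E P (inverse f) (inverse c)"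
    and value_at_emb: "value_at E P (\<iota> c) c"
proof -
  obtain u v a b where *: "specializes u v a b" "value_at E P = gval u v a b"
    using assms specializes_affine specializes_infinity by (cases P) (metis value_at_eq_gval)+
  show "value_at E P f c \<Longrightarrow> value_at E P f d \<Longrightarrow> c = d"
    using gval_unique[OF *(1)] by (simp add: *(2))
  show "value_at E P f c \<Longrightarrow> value_at E P g d \<Longrightarrow> value_at E P (f + g) (c + d)"
    using gval_add[OF *(1)] by (simp add: *(2))
  show "value_at E P f c \<Longrightarrow> value_at E P g d \<Longrightarrow> value_at E P (f * g) (c * d)"
    using gval_mult[OF *(1)] by (simp add: *(2))
  show "value_at E P f c \<Longrightarrow> c \<noteq> 0 \<Longrightarrow> value_at E P (inverse f) (inverse c)"
    using gval_inverse[OF *(1)] by (simp add: *(2))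
  show "value_at E P (\<iota> c) c" using gval_emb by (simp add: *(2))
qed

text \<open>Order at least n, with 0 counted as having infinite order. Since \<open>val\<close>
  takes the value 0 at 0, estimates are stated with this predicate instead.\<close>

definition vge :: "'c point \<Rightarrow> int \<Rightarrow> 'k \<Rightarrow> bool" where
  "vge P n f \<longleftrightarrow> f = 0 \<or> n \<le> val E P f"

context
  fixes P assumes P: "P \<in> points E"
begin

lemma value_at_diff:
  assumes "value_at E P f c" "value_at E P g d" shows "value_at E P (f - g) (c - d)"
  using value_at_add[OF P assms(1) value_at_mult[OF P value_at_emb[OF P, of "- 1"] assms(2)]] by simp

lemma value_at_divide:
  assumes "value_at E P f c" "value_at E P g d" "d \<noteq> 0" shows "value_at E P (f / g) (c / d)"
  using value_at_mult[OF P assms(1) value_at_inverse[OF P assms(2,3)]]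
  by (simp add: field_class.field_divide_inverse)

lemmas val_mult = nval_mult[OF val_nval[OF P]]
  and val_inverse = nval_inverse[OF val_nval[OF P]]
  and val_minus = nval_minus[OF val_nval[OF P]]
  and val_1 = nval_1[OF val_nval[OF P]]
  and val_0 = nval_0[OF val_nval[OF P]]
  and val_power = nval_power[OF val_nval[OF P]]

lemma val_divide: "f \<noteq> 0 \<Longrightarrow> g \<noteq> 0 \<Longrightarrow> val E P (f / g) = val E P f - val E P g"
  by (simp add: field_class.field_divide_inverse val_mult val_inverse)

lemma vge_0_iff: "vge P 0 f \<longleftrightarrow> (\<exists>c. value_at E P f c)"
  using nval_ring[OF val_nval[OF P], of f] by (auto simp: vge_def local_ring_def)

lemma vge_zero [simp]: "vge P n 0" by (simp add: vge_def)

lemma vge_mono: "vge P n f \<Longrightarrow> m \<le> n \<Longrightarrow> vge P m f" by (auto simp: vge_def)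

lemma vge_minus: "vge P n (- f) \<longleftrightarrow> vge P n f" by (simp add: vge_def val_minus)

lemma vge_add: "vge P n f \<Longrightarrow> vge P n g \<Longrightarrow> vge P n (f + g)"
  using nval_add[OF val_nval[OF P], of f g] by (fastforce simp: vge_def)

lemma vge_diff: "vge P n f \<Longrightarrow> vge P n g \<Longrightarrow> vge P n (f - g)"
  using vge_add[of n f "- g"] by (simp add: vge_minus)

lemma vge_mult: "vge P m f \<Longrightarrow> vge P n g \<Longrightarrow> vge P (m + n) (f * g)"
  by (cases "f = 0"; cases "g = 0") (auto simp: vge_def val_mult)

lemma vge_emb: "vge P 0 (\<iota> c)"
  using value_at_emb[OF P] vge_0_iff by blast

lemma vge_emb_mult: "vge P n f \<Longrightarrow> vge P n (\<iota> c * f)"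
  using vge_mult[OF vge_emb, of n f] by simp

lemma vge_sum: "(\<And>i. i \<in> A \<Longrightarrow> vge P n (g i)) \<Longrightarrow> vge P n (sum g A)"
  by (induction A rule: infinite_finite_induct) (auto intro: vge_add)

lemma vge_cancel: "f \<noteq> 0 \<Longrightarrow> vge P n (f * g) \<longleftrightarrow> vge P (n - val E P f) g"
  by (cases "g = 0") (auto simp: vge_def val_mult)

lemma value_at_nz:
  assumes "value_at E P f c" "c \<noteq> 0"
  shows "f \<noteq> 0" "val E P f = 0"
proof -
  show nz: "f \<noteq> 0" using assms value_at_unique[OF P _ value_at_emb[OF P, of 0]] by force
  have "vge P 0 f" "vge P 0 (inverse f)"
    using assms value_at_inverse[OF P] vge_0_iff by blast+
  then show "val E P f = 0" using nz by (auto simp: vge_def val_inverse)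
qed

text \<open>Positive order and vanishing agree: a function of order 0 has a regular inverse, so its
  value cannot be 0.\<close>

lemma vge_1_iff: "vge P 1 f \<longleftrightarrow> value_at E P f 0"
proof
  assume *: "vge P 1 f"
  then obtain c where c: "value_at E P f c" using vge_0_iff vge_mono[of 1 f 0] by auto
  have "c = 0"
  proof (rule ccontr)
    assume "c \<noteq> 0"
    then show False using value_at_nz[OF c] * by (simp add: vge_def)
  qed
  then show "value_at E P f 0" using c by simp
next
  assume *: "value_at E P f 0"
  then have ge: "vge P 0 f" using vge_0_iff by blast
  have "\<not> (f \<noteq> 0 \<and> val E P f = 0)"
  proof
    assume f: "f \<noteq> 0 \<and> val E P f = 0"
    then have "vge P 0 (inverse f)" by (simp add: vge_def val_inverse)
    then obtain d where "value_at E P (inverse f) d" using vge_0_iff by blast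
    then have "value_at E P (f * inverse f) (0 * d)" using value_at_mult[OF P *] by blast
    then show False using f value_at_unique[OF P _ value_at_emb[OF P, of 1]] by force
  qed
  then show "vge P 1 f" using ge by (auto simp: vge_def)
qed

lemma val_0_value:
  assumes "f \<noteq> 0" "val E P f = 0"
  obtains c where "c \<noteq> 0" "value_at E P f c"
proof -
  obtain c where c: "value_at E P f c" using assms vge_0_iff[of f] by (auto simp: vge_def)
  have "c \<noteq> 0" using c vge_1_iff[of f] assms by (auto simp: vge_def)
  then show thesis using that c by blast
qed

lemma val_add_dominant:
  assumes "f \<noteq> 0" "vge P (val E P f + 1) g"
  shows "f + g \<noteq> 0 \<and> val E P (f + g) = val E P f"
proof -
  have "vge P (val E P f) (f + g)"
    using assms by (intro vge_add) (auto simp: vge_def)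
  moreover have "\<not> vge P (val E P f + 1) (f + g)"
  proof
    assume "vge P (val E P f + 1) (f + g)"
    then have "vge P (val E P f + 1) (f + g - g)" using vge_diff assms(2) by blast
    then show False using assms(1) by (simp add: vge_def)
  qed
  ultimately show ?thesis by (auto simp: vge_def)
qed

end

section \<open>Orders of the coordinate functions\<close>

lemma X_sub_neq_0: "X - \<iota> a \<noteq> 0" using X_neq_emb by simp

lemma Y_sub_neq_0: "Y - \<iota> b \<noteq> 0"
  using elem_eq_0_iff[of "[:- b:]" 1] by (simp add: elem_def)

lemma value_at_X: "value_at E (Affine a b) X a"
  unfolding value_at_eq_gval by (rule gval_fst)

lemma value_at_Y: "value_at E (Affine a b) Y b"
  unfolding value_at_eq_gval by (rule gval_snd)

lemma value_at_peval: "value_at E (Affine a b) (peval p X) (poly p a)"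
  unfolding value_at_eq_gval by (rule gval_peval_fst)

lemma value_at_elem: "value_at E (Affine a b) (elem p q) (poly p a + poly q a * b)"
  unfolding value_at_eq_gval by (rule gval_elem)

lemma val_X_sub:
  assumes P: "Affine a b \<in> points E"
  shows "val E (Affine a b) (X - \<iota> c) = (if c \<noteq> a then 0 else if deriv_Y a b = 0 then 2 else 1)"
proof (cases "c = a")
  case False
  have "value_at E (Affine a b) (X - \<iota> c) (a - c)"
    by (intro value_at_diff[OF P] value_at_X value_at_emb[OF P])
  then show ?thesis using value_at_nz[OF P] False by auto
next
  case True
  then show ?thesis
    using nval_affine_ramified[OF P] nval_affine_unramified[OF P] val_eqI[OF P] by auto
qed

lemma val_Y_sub: 
  assumes P: "Affine a b \<in> points E" and "deriv_Y a b = 0"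
  shows "val E (Affine a b) (Y - \<iota> b) = 1"
  using nval_affine_ramified[OF assms] val_eqI[OF P] by auto

lemma val_inf_z: "val E Infinity (X / Y) = 1"
  using nval_infinity val_eqI[OF Infinity_in_points] by auto

lemma val_inf_XY: "val E Infinity X = - 2" "val E Infinity Y = - 3"
proof -
  note P = Infinity_in_points
  have T: "inf_T \<noteq> 0" "val E Infinity inf_T = 0"
    using value_at_nz[OF P, of inf_T 1] gval_inf_T unfolding value_at_eq_gval by auto
  have "val E Infinity ((1 / Y) * inf_T) = val E Infinity ((X / Y) ^ 3)"
    by (simp only: inf_identity)
  then show Y: "val E Infinity Y = - 3"
    using T Y_neq_0 X_neq_0
    by (simp add: val_mult[OF P] val_power[OF P] val_divide[OF P] val_1[OF P] val_inf_z
          del: times_divide_eq_left)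
  show "val E Infinity X = - 2"
    using val_inf_z Y Y_neq_0 X_neq_0 by (simp add: val_divide[OF P])
qed

lemma val_inf_peval: "p \<noteq> 0 \<Longrightarrow> val E Infinity (peval p X) = - 2 * int (degree p)"
proof (induction p)
  case (pCons c p)
  note P = Infinity_in_points
  show ?case
  proof (cases "p = 0")
    case True
    then show ?thesis using pCons value_at_nz(2)[OF P value_at_emb[OF P], of c] by simp
  next
    case False
    then have v: "val E Infinity (X * peval p X) = - 2 - 2 * int (degree p)"
      using pCons X_neq_0 by (simp add: val_mult[OF P] val_inf_XY)
    have "val E Infinity (X * peval p X + \<iota> c) = val E Infinity (X * peval p X)"
      using val_add_dominant[OF P, of "X * peval p X" "\<iota> c"] X_neq_0 False v
        vge_mono[OF P vge_emb[OF P]] by simp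
    then show ?thesis using v False by (simp add: add.commute)
  qed
qed simp

text \<open>p(X) has even and q(X) Y odd order at infinity, so they never cancel, and a nonconstant
  element of the coordinate ring has a pole of order at least 2 there.\<close>

lemma vge_inf_elem:
  assumes "vge Infinity (- 1) (elem p q)"
  shows "q = 0 \<and> degree p = 0"
proof (rule ccontr)
  assume *: "\<not> (q = 0 \<and> degree p = 0)"
  note P = Infinity_in_points
  have vq: "val E Infinity (peval q X * Y) = - 2 * int (degree q) - 3" if "q \<noteq> 0"
    using that Y_neq_0 by (simp add: val_mult[OF P] val_inf_XY val_inf_peval)
  have nz: "elem p q \<noteq> 0" using * elem_eq_0_iff by auto
  consider "q = 0" | "q \<noteq> 0" "p = 0" | "q \<noteq> 0" "p \<noteq> 0" by blast
  then have "val E Infinity (elem p q) \<le> - 2"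
  proof cases
    case 1
    then show ?thesis using * val_inf_peval[of p] by (cases "p = 0") (auto simp: elem_def)
  next
    case 2
    then show ?thesis using vq by (simp add: elem_def)
  next
    case 3
    have "- 2 * int (degree p) \<noteq> - 2 * int (degree q) - 3" by presburger
    then consider "- 2 * int (degree p) < - 2 * int (degree q) - 3"
      | "- 2 * int (degree p) > - 2 * int (degree q) - 3" by linarith
    then show ?thesis
    proof cases
      case 1
      then show ?thesis
        using val_add_dominant[OF P, of "peval p X" "peval q X * Y"] 3 vq val_inf_peval[of p]
        by (simp add: elem_def vge_def)
    next
      case 2
      then show ?thesis
        using val_add_dominant[OF P, of "peval q X * Y" "peval p X"] 3 vq val_inf_peval[of p] Y_neq_0
        by (simp add: elem_def vge_def add.commute)
    qed
  qed
  then show False using assms nz by (simp add: vge_def)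
qed

lemma affine_point_exists: "\<exists>b. Affine a b \<in> points E"
proof -
  let ?p = "[: - (a ^ 3 + a2 E * a\<^sup>2 + a4 E * a + a6 E), a1 E * a + a3 E, 1:]"
  obtain b where "poly ?p b = 0" using alg_closed_imp_poly_has_root[of ?p] by auto
  then show ?thesis
    by (intro exI[of _ b]) (simp add: affine_in_points_iff algebra_simps power2_eq_square)
qed

lemma infinite_points: "infinite (points E)"
proof
  assume fin: "finite (points E)"
  obtain b where b: "\<And>a. Affine a (b a) \<in> points E" using affine_point_exists by metis
  have "inj (\<lambda>a. Affine a (b a))" by (auto simp: inj_def)
  then have "infinite (range (\<lambda>a. Affine a (b a)))"
    using infinite_alg_closed finite_imageD by blast
  then show False using fin b by (meson finite_subset image_subsetI)
qed

lemma conj_in_points: "Affine a b \<in> points E \<Longrightarrow> Affine a (- b - a1 E * a - a3 E) \<in> points E"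
  by (simp add: affine_in_points_iff algebra_simps power2_eq_square)

lemma points_same_x:
  assumes "Affine a b \<in> points E" "Affine a c \<in> points E"
  shows "c = b \<or> c = - b - a1 E * a - a3 E"
proof -
  have "(c - b) * (c + b + a1 E * a + a3 E) = 0"
    using assms by (simp add: affine_in_points_iff algebra_simps power2_eq_square)
  then have "c - b = 0 \<or> c + b + a1 E * a + a3 E = 0" by (simp only: mult_eq_0_iff)
  then show ?thesis
  proof
    assume "c + b + a1 E * a + a3 E = 0"
    then have "c = - b - a1 E * a - a3 E" by algebra
    then show ?thesis ..
  qed simp
qed

text \<open>Two points above a give two linear equations for p(a) and q(a), with different
  Y-coordinates unless negation fixes the point. In that case X - a has a double zero but Y - b only
  a simple one, and the condition of order 2 forces q(a) = 0.\<close>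

lemma elem_split:
  assumes "\<And>b. Affine a b \<in> points E \<Longrightarrow> vge (Affine a b) 0 (elem p q / (X - \<iota> a))"
  shows "[:- a, 1:] dvd p \<and> [:- a, 1:] dvd q"
proof -
  obtain b where P: "Affine a b \<in> points E" using affine_point_exists by blast
  have vge: "vge (Affine a b) (val E (Affine a b) (X - \<iota> a)) (elem p q)"
    if P: "Affine a b \<in> points E" for b
  proof -
    have "elem p q = (X - \<iota> a) * (elem p q / (X - \<iota> a))" using X_sub_neq_0 by simp
    then show ?thesis using vge_cancel[OF P X_sub_neq_0] assms[OF P] by (metis diff_self)
  qed
  have zero: "poly p a + poly q a * b = 0" if P: "Affine a b \<in> points E" for b
  proof -
    have "vge (Affine a b) 1 (elem p q)" 
      by (rule vge_mono[OF P vge[OF P]]) (simp add: val_X_sub[OF P])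
    then have "value_at E (Affine a b) (elem p q) 0" using vge_1_iff[OF P] by simp
    then show ?thesis using value_at_unique[OF P value_at_elem] by metis
  qed
  have "poly q a = 0"
  proof (cases "deriv_Y a b = 0")
    case False
    have "poly p a + poly q a * (- b - a1 E * a - a3 E) = 0"
      using zero[OF conj_in_points[OF P]] .
    then have "poly q a * deriv_Y a b = 0"
      using zero[OF P] unfolding deriv_Y_def by algebra
    then show ?thesis using False by simp
  next
    case True
    let ?P = "Affine a b"
    have v2: "val E ?P (X - \<iota> a) = 2" using val_X_sub[OF P] True by simp
    \<comment> \<open>Replacing p and q by their values at a changes the element by terms of order
      at least 2 only.\<close>
    have div: "vge ?P 2 (peval r X - \<iota> (poly r a))" for r
    proof -
      have "[:- a, 1:] dvd r - [:poly r a:]" by (simp add: poly_eq_0_iff_dvd[symmetric])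
      then obtain r' where "r - [:poly r a:] = [:- a, 1:] * r'" by blast
      then have "peval (r - [:poly r a:]) X = peval ([:- a, 1:] * r') X" by simp
      then have "peval r X - \<iota> (poly r a) = (X - \<iota> a) * peval r' X" by (simp add: algebra_simps)
      moreover have "vge ?P 0 (peval r' X)" using value_at_peval vge_0_iff[OF P] by blast
      ultimately show ?thesis using vge_cancel[OF P X_sub_neq_0, of 2 a] v2 by simp
    qed
    have "vge ?P 0 Y" using value_at_Y vge_0_iff[OF P] by blast
    then have "vge ?P 2 ((peval q X - \<iota> (poly q a)) * Y)" using vge_mult[OF P div] by fastforce
    then have "vge ?P 2 (elem p q - (peval p X - \<iota> (poly p a)) - (peval q X - \<iota> (poly q a)) * Y)"
      using vge_diff[OF P vge_diff[OF P _ div]] vge[OF P] v2 by simp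
    also have "elem p q - (peval p X - \<iota> (poly p a)) - (peval q X - \<iota> (poly q a)) * Y
       = \<iota> (poly q a) * (Y - \<iota> b) + \<iota> (poly p a + poly q a * b)"
      by (simp add: elem_def algebra_simps)
    also have "\<dots> = \<iota> (poly q a) * (Y - \<iota> b)" using zero[OF P] by (simp del: emb_add emb_mult)
    finally have *: "vge ?P 2 (\<iota> (poly q a) * (Y - \<iota> b))" .
    show ?thesis
    proof (rule ccontr)
      assume nz: "poly q a \<noteq> 0"
      then have "val E ?P (\<iota> (poly q a)) = 0"
        using value_at_nz(2)[OF P value_at_emb[OF P]] by simp
      then have "val E ?P (\<iota> (poly q a) * (Y - \<iota> b)) = 1"
        using val_mult[OF P] nz Y_sub_neq_0 val_Y_sub[OF P True] by simp
      then show False using * nz Y_sub_neq_0[of b] by (simp add: vge_def)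
    qed
  qed
  moreover have "poly p a = 0" using zero[OF P] calculation by simp
  ultimately show ?thesis by (simp add: poly_eq_0_iff_dvd)
qed

text \<open>Functions without affine poles lie in the coordinate ring: a root of the denominator
  cancels against both coordinates of the numerator, which lowers the degree of the
  denominator.\<close>

lemma regular_affine:
  assumes "\<And>P. P \<in> points E \<Longrightarrow> P \<noteq> Infinity \<Longrightarrow> vge P 0 f"
  shows "\<exists>p q. f = elem p q"
proof -
  have "\<exists>p q. f = elem p q" if "r \<noteq> 0" "f = elem p q / peval r X" for p q r
    using that
  proof (induction "degree r" arbitrary: p q r rule: less_induct)
    case less
    show ?case
    proof (cases "degree r = 0")
      case True
      then obtain c where c: "r = [:c:]" by (metis degree_eq_zeroE)
      then have "f = elem (smult (inverse c) p) (smult (inverse c) q)"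
        using less.prems by (simp add: elem_def field_simps)
      then show ?thesis by blast
    next
      case False
      then obtain a where "poly r a = 0" using alg_closed_imp_poly_has_root by blast
      then obtain r' where r': "r = [:- a, 1:] * r'" unfolding poly_eq_0_iff_dvd by blast
      then have r'0: "r' \<noteq> 0" using less.prems by auto
      have eq: "elem p q / (X - \<iota> a) = f * peval r' X"
      proof -
        have "peval r X = (X - \<iota> a) * peval r' X" by (simp add: r' algebra_simps)
        moreover have "peval r' X \<noteq> 0" using r'0 by simp
        ultimately show ?thesis unfolding less.prems(2) by simp
      qed
      have "vge (Affine a b) 0 (elem p q / (X - \<iota> a))" if P: "Affine a b \<in> points E" for b
      proof -
        have "vge (Affine a b) 0 (peval r' X)" using value_at_peval vge_0_iff[OF P] by blast
        then show ?thesis unfolding eq using vge_mult[OF P assms[OF P]] by fastforce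
      qed
      then obtain p' q' where pq: "p = [:- a, 1:] * p'" "q = [:- a, 1:] * q'"
        using elem_split[of a p q] by blast
      have "f = elem p' q' / peval r' X"
      proof -
        have "peval r X = (X - \<iota> a) * peval r' X" by (simp add: r' algebra_simps)
        moreover have "elem p q = (X - \<iota> a) * elem p' q'" by (simp add: pq elem_def algebra_simps)
        ultimately show ?thesis unfolding less.prems(2) using X_sub_neq_0[of a] by simp
      qed
      moreover have "degree r = degree [:- a, 1:] + degree r'"
        unfolding r' by (rule degree_mult_eq) (use r'0 in auto)
      then have "degree r' < degree r" by simp
      ultimately show ?thesis using less.hyps r'0 by blast
    qed
  qed
  then show ?thesis using normal_form by metis
qed

text \<open>Affine poles lie above the roots of a denominator in X, and at most two points share an
  X-coordinate.\<close>

lemma finite_poles: "finite {P \<in> points E. \<not> vge P 0 f}"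
proof -
  obtain p q r where r: "r \<noteq> 0" "f = elem p q / peval r X" by (rule normal_form)
  obtain b where b: "\<And>a. Affine a (b a) \<in> points E" using affine_point_exists by metis
  let ?A = "{a. poly r a = 0}"
  let ?S = "insert Infinity ((\<lambda>a. Affine a (b a)) ` ?A \<union> (\<lambda>a. Affine a (- b a - a1 E * a - a3 E)) ` ?A)"
  have "finite ?S" using poly_roots_finite[OF r(1)] by simp
  moreover have "{P \<in> points E. \<not> vge P 0 f} \<subseteq> ?S"
  proof
    fix P assume *: "P \<in> {P \<in> points E. \<not> vge P 0 f}"
    show "P \<in> ?S"
    proof (cases P)
      case (Affine a c)
      then have P: "Affine a c \<in> points E" using * by simp
      have "poly r a = 0"
      proof (rule ccontr)
        assume "poly r a \<noteq> 0"
        then have "value_at E (Affine a c) f ((poly p a + poly q a * c) / poly r a)"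
          unfolding r(2) by (intro value_at_divide[OF P] value_at_elem value_at_peval)
        then show False using * Affine vge_0_iff[OF P] by auto
      qed
      then show ?thesis using points_same_x[OF b P] Affine by auto
    qed simp
  qed
  ultimately show ?thesis using finite_subset by blast
qed

text \<open>The slope of the chord from a variable point to the negative of (a, b). Its poles are
  simple and lie at (a, b) and infinity; at the negative of (a, b), if different, numerator and
  denominator vanish together.\<close>

definition slope_fun :: "'c \<Rightarrow> 'c \<Rightarrow> 'k" where
  "slope_fun a b = (Y - \<iota> (- b - a1 E * a - a3 E)) / (X - \<iota> a)"

lemma slope_fun_at_pole: "value_at E (Affine a b) (slope_fun a b * (X - \<iota> a)) (deriv_Y a b)" 
  if P: "Affine a b \<in> points E"
proof -
  have "slope_fun a b * (X - \<iota> a) = Y - \<iota> (- b - a1 E * a - a3 E)"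
    unfolding slope_fun_def using X_sub_neq_0[of a] by simp
  moreover have "value_at E (Affine a b) (Y - \<iota> (- b - a1 E * a - a3 E)) (b - (- b - a1 E * a - a3 E))"
    by (intro value_at_diff[OF P] value_at_Y value_at_emb[OF P])
  moreover have "b - (- b - a1 E * a - a3 E) = deriv_Y a b" by (simp add: deriv_Y_def)
  ultimately show ?thesis by simp
qed

lemma value_at_inf_inverse: "value_at E Infinity (1 / X) 0" "value_at E Infinity (1 / Y) 0"
proof -
  note P = Infinity_in_points
  have "vge Infinity 1 (1 / X)" "vge Infinity 1 (1 / Y)"
    using X_neq_0 Y_neq_0 by (simp_all add: vge_def val_divide[OF P] val_1[OF P] val_inf_XY)
  then show "value_at E Infinity (1 / X) 0" "value_at E Infinity (1 / Y) 0"
    using vge_1_iff[OF P] by auto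
qed

lemma slope_fun_at_inf: "value_at E Infinity (slope_fun a b * (X / Y)) 1"
proof -
  note P = Infinity_in_points
  define c where "c = - b - a1 E * a - a3 E"
  have "slope_fun a b * (X / Y) = (\<iota> 1 - \<iota> c * (1 / Y)) / (\<iota> 1 - \<iota> a * (1 / X))"
    unfolding slope_fun_def c_def[symmetric] using X_neq_0 Y_neq_0 X_sub_neq_0[of a]
    by (simp add: field_simps)
  moreover have "value_at E Infinity ((\<iota> 1 - \<iota> c * (1 / Y)) / (\<iota> 1 - \<iota> a * (1 / X))) ((1 - c * 0) / (1 - a * 0))"
    by (intro value_at_divide[OF P] value_at_diff[OF P] value_at_mult[OF P] value_at_emb[OF P]
          value_at_inf_inverse) simp
  ultimately show ?thesis by simp
qed

lemma slope_fun_neq_0: "slope_fun a b \<noteq> 0"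
  by (simp only: slope_fun_def divide_eq_0_iff X_sub_neq_0 Y_sub_neq_0 simp_thms)

lemma val_slope_fun_inf: "val E Infinity (slope_fun a b) = - 1"
proof -
  note P = Infinity_in_points
  have "val E Infinity (slope_fun a b * (X / Y)) = 0"
    using value_at_nz(2)[OF P slope_fun_at_inf] by simp
  then show ?thesis using val_mult[OF P slope_fun_neq_0, of "X / Y"] X_neq_0 Y_neq_0 val_inf_z by simp
qed

lemma val_slope_fun_pole:
  assumes P: "Affine a b \<in> points E"
  shows "val E (Affine a b) (slope_fun a b) = - 1"
proof (cases "deriv_Y a b = 0")
  case False
  then have "val E (Affine a b) (slope_fun a b * (X - \<iota> a)) = 0"
    using value_at_nz(2)[OF P slope_fun_at_pole[OF P]] by simp
  then show ?thesis
    using val_mult[OF P slope_fun_neq_0 X_sub_neq_0, of a b a] val_X_sub[OF P] False by simp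
next
  case True
  then have "- b - a1 E * a - a3 E = b" by (simp add: deriv_Y_def) algebra
  then show ?thesis
    using val_divide[OF P Y_sub_neq_0 X_sub_neq_0] val_X_sub[OF P] val_Y_sub[OF P True] True
    by (simp only: slope_fun_def) simp
qed

lemma slope_fun_regular:
  assumes P: "Affine c d \<in> points E" and Q: "Affine a b \<in> points E" and ne: "Affine c d \<noteq> Affine a b"
  shows "vge (Affine c d) 0 (slope_fun a b)"
proof (cases "c = a")
  case False
  have "value_at E (Affine c d) (slope_fun a b) ((d - (- b - a1 E * a - a3 E)) / (c - a))"
    unfolding slope_fun_def
    by (intro value_at_divide[OF P] value_at_diff[OF P] value_at_X value_at_Y value_at_emb[OF P])
       (use False in simp)
  then show ?thesis using vge_0_iff[OF P] by blast
next
  case True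
  then have d: "d = - b - a1 E * a - a3 E" "d \<noteq> b"
    using points_same_x[OF Q] P ne by auto
  have "deriv_Y c d \<noteq> 0" using d True by (simp add: deriv_Y_def) algebra
  then have v: "val E (Affine c d) (X - \<iota> a) = 1" using val_X_sub[OF P] True by simp
  have "value_at E (Affine c d) (Y - \<iota> d) (d - d)"
    by (intro value_at_diff[OF P] value_at_Y value_at_emb[OF P])
  then have "vge (Affine c d) 1 (Y - \<iota> d)" using vge_1_iff[OF P] by simp
  moreover have "Y - \<iota> d = (X - \<iota> a) * slope_fun a b"
    unfolding slope_fun_def d(1) using X_sub_neq_0[of a] by simp
  ultimately show ?thesis using vge_cancel[OF P X_sub_neq_0, of 1 a "slope_fun a b"] v by simp
qed

lemma constant_if_no_affine_pole:
  assumes "\<And>P. P \<in> points E \<Longrightarrow> P \<noteq> Infinity \<Longrightarrow> vge P 0 f" and "vge Infinity (- 1) f"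
  shows "\<exists>c. f = \<iota> c"
proof -
  obtain p q where f: "f = elem p q" using regular_affine assms(1) by blast
  then have "q = 0" "degree p = 0" using vge_inf_elem assms(2) by auto
  then obtain c where "p = [:c:]" by (metis degree_eq_zeroE)
  then show ?thesis using f \<open>q = 0\<close> by (auto simp: elem_def)
qed

text \<open>Subtracting a multiple c of the slope function cancels an affine pole and leaves a
  constant. If c were nonzero, the slope function would inherit regularity at infinity from
  f.\<close>

lemma constant_if_one_simple_pole:
  assumes P: "P \<in> points E" and f: "vge P (- 1) f"
    and reg: "\<And>Q. Q \<in> points E \<Longrightarrow> Q \<noteq> P \<Longrightarrow> vge Q 0 f"
  shows "\<exists>c. f = \<iota> c"
proof (cases P)
  case Infinity
  then show ?thesis using assms constant_if_no_affine_pole by blast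
next
  case (Affine a b)
  let ?l = "slope_fun a b"
  note PA = P[unfolded Affine] and PI = Infinity_in_points
  have "vge P 0 (f / ?l)"
    using vge_cancel[OF P slope_fun_neq_0, of "- 1" a b "f / ?l"] f slope_fun_neq_0[of a b]
      val_slope_fun_pole[OF PA] Affine by simp
  then obtain c where "value_at E P (f / ?l) c" using vge_0_iff[OF P] by blast
  then have "value_at E P (f / ?l - \<iota> c) (c - c)"
    by (intro value_at_diff[OF P] value_at_emb[OF P])
  then have "vge P 1 (f / ?l - \<iota> c)" using vge_1_iff[OF P] by simp
  then have "vge P 0 (?l * (f / ?l - \<iota> c))"
    using vge_cancel[OF P slope_fun_neq_0, of 0 a b] val_slope_fun_pole[OF PA] Affine by simp
  moreover have eq: "?l * (f / ?l - \<iota> c) = f - \<iota> c * ?l"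
    using slope_fun_neq_0[of a b] by (simp add: field_simps)
  ultimately have regP: "vge P 0 (f - \<iota> c * ?l)" by simp
  have "vge Q 0 (f - \<iota> c * ?l)" if Q: "Q \<in> points E" "Q \<noteq> Infinity" for Q
  proof (cases "Q = P")
    case False
    obtain x y where "Q = Affine x y" using Q(2) by (cases Q) auto
    then have "vge Q 0 ?l" using slope_fun_regular[of x y a b] Q PA Affine False by simp
    then show ?thesis by (intro vge_diff[OF Q(1)] vge_emb_mult[OF Q(1)] reg[OF Q(1) False])
  qed (use regP in simp)
  moreover have "vge Infinity (- 1) (f - \<iota> c * ?l)"
    using vge_mono[OF PI reg[OF PI]] Affine
    by (intro vge_diff[OF PI] vge_emb_mult[OF PI]) (auto simp: vge_def val_slope_fun_inf)
  ultimately obtain k where k: "f - \<iota> c * ?l = \<iota> k" using constant_if_no_affine_pole by blast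
  have "c = 0"
  proof (rule ccontr)
    assume "c \<noteq> 0"
    then have "?l = \<iota> (inverse c) * (f - \<iota> k)" using k by (simp add: field_simps)
    moreover have "vge Infinity 0 (\<iota> (inverse c) * (f - \<iota> k))"
      using reg[OF PI] Affine by (intro vge_emb_mult[OF PI] vge_diff[OF PI] vge_emb[OF PI]) simp
    ultimately have "vge Infinity 0 ?l" by simp
    then show False using slope_fun_neq_0[of a b] by (simp add: vge_def val_slope_fun_inf)
  qed
  then show ?thesis using k by auto
qed

text \<open>For two affine points the difference of their slope functions works: both behave like
  Y/X at infinity with leading coefficient 1, so the poles there cancel.\<close>

lemma two_simple_poles_aux:
  assumes "P = Affine a b" "P \<in> points E" "N \<in> points E" "P \<noteq> N"
  shows "\<exists>g. g \<noteq> 0 \<and> val E P g = - 1 \<and> val E N g = - 1 \<and>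
     (\<forall>Q\<in>points E. Q \<noteq> P \<longrightarrow> Q \<noteq> N \<longrightarrow> vge Q 0 g)"
proof (cases N)
  case Infinity
  have "vge Q 0 (slope_fun a b)" if "Q \<in> points E" "Q \<noteq> P" "Q \<noteq> N" for Q
    using slope_fun_regular[of _ _ a b] that assms Infinity by (cases Q) auto
  then show ?thesis
    using assms val_slope_fun_pole val_slope_fun_inf slope_fun_neq_0 Infinity by blast
next
  case (Affine c d)
  note PI = Infinity_in_points
  let ?f = "slope_fun a b" and ?g = "slope_fun c d"
  have at_P: "?f + - ?g \<noteq> 0 \<and> val E P (?f + - ?g) = - 1"
    using val_add_dominant[OF assms(2) slope_fun_neq_0, of a b "- ?g"]
      slope_fun_regular[of a b c d] assms Affine val_slope_fun_pole[of a b]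
    by (simp add: vge_minus)
  have "vge N 0 ?f" using slope_fun_regular[of c d a b] assms Affine by metis
  then have at_N: "val E N (- ?g + ?f) = - 1"
    using val_add_dominant[OF assms(3), of "- ?g" "?f"] slope_fun_neq_0[of c d]
      assms(3) Affine val_slope_fun_pole[of c d]
    by (simp add: val_minus)
  have at_inf: "vge Infinity 0 (?f - ?g)"
  proof -
    have "value_at E Infinity (?f * (X / Y) - ?g * (X / Y)) (1 - 1)"
      by (intro value_at_diff[OF PI] slope_fun_at_inf)
    then have "vge Infinity 1 ((X / Y) * (?f - ?g))" using vge_1_iff[OF PI] by (simp add: algebra_simps)
    then show ?thesis using vge_cancel[OF PI, of "X / Y" 1] X_neq_0 Y_neq_0 val_inf_z by simp
  qed
  have "vge Q 0 (?f - ?g)" if Q: "Q \<in> points E" "Q \<noteq> P" "Q \<noteq> N" for Q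
  proof (cases Q)
    case (Affine x y)
    then show ?thesis
      using slope_fun_regular[of x y a b] slope_fun_regular[of x y c d] Q assms \<open>N = _\<close>
      by (intro vge_diff[OF Q(1)]) auto
  qed (use at_inf in simp)
  then show ?thesis using at_P at_N by (intro exI[of _ "?f - ?g"]) simp
qed

lemma two_simple_poles:
  assumes "P \<in> points E" "N \<in> points E" "P \<noteq> N"
  shows "\<exists>g. g \<noteq> 0 \<and> val E P g = - 1 \<and> val E N g = - 1 \<and>
     (\<forall>Q\<in>points E. Q \<noteq> P \<longrightarrow> Q \<noteq> N \<longrightarrow> vge Q 0 g)"
proof (cases P)
  case (Affine a b)
  then show ?thesis using two_simple_poles_aux assms by blast
next
  case Infinity
  then obtain a b where "N = Affine a b" using assms(3) by (cases N) auto
  then show ?thesis using two_simple_poles_aux[of N a b P] assms by (metis (lifting))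
qed

lemma shift_to_zero:
  assumes "N \<in> points E" "vge N 0 f" obtains c where "vge N 1 (f - \<iota> c)"
proof -
  obtain c where "value_at E N f c" using assms vge_0_iff by blast
  then have "value_at E N (f - \<iota> c) (c - c)"
    by (intro value_at_diff[OF assms(1)] value_at_emb[OF assms(1)])
  then show thesis using that vge_1_iff[OF assms(1)] by simp
qed

lemma val_diff_emb:
  assumes "P \<in> points E" "f \<noteq> 0" "val E P f < 0"
  shows "f - \<iota> c \<noteq> 0 \<and> val E P (f - \<iota> c) = val E P f"
proof -
  have "vge P (val E P f + 1) (\<iota> (- c))"
    by (rule vge_mono[OF assms(1) vge_emb[OF assms(1)]]) (use assms(3) in simp)
  then show ?thesis using val_add_dominant[OF assms(1,2), of "\<iota> (- c)"] by simp
qed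

text \<open>Products add the orders at P; auxiliary poles are removed by first shifting the other
  factor by a constant so that it vanishes there. Order 2 uses two different auxiliary points, one
  per factor. In the later steps only the new factor has an auxiliary pole, so only the old one is
  shifted.\<close>

lemma pole_of_order:
  assumes P: "P \<in> points E" and "k \<ge> 2"
  shows "\<exists>g. g \<noteq> 0 \<and> val E P g = - int k \<and> (\<forall>Q\<in>points E. Q \<noteq> P \<longrightarrow> vge Q 0 g)"
proof -
  obtain N where N: "N \<in> points E" "N \<noteq> P"
    using infinite_points by (metis finite.emptyI finite_insert insertI1 finite_subset subsetI)
  obtain N' where N': "N' \<in> points E" "N' \<noteq> P" "N' \<noteq> N"
    using infinite_points by (metis finite.emptyI finite_insert insertCI finite_subset subsetI)
  obtain g where g: "g \<noteq> 0" "val E P g = - 1" "val E N g = - 1"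
    "\<And>Q. Q \<in> points E \<Longrightarrow> Q \<noteq> P \<Longrightarrow> Q \<noteq> N \<Longrightarrow> vge Q 0 g"
    using two_simple_poles[OF P N(1)] N(2) by metis
  obtain g' where g': "g' \<noteq> 0" "val E P g' = - 1" "val E N' g' = - 1"
    "\<And>Q. Q \<in> points E \<Longrightarrow> Q \<noteq> P \<Longrightarrow> Q \<noteq> N' \<Longrightarrow> vge Q 0 g'"
    using two_simple_poles[OF P N'(1)] N'(2) by metis
  show ?thesis using \<open>k \<ge> 2\<close>
  proof (induction k rule: nat_induct_at_least)
    case base
    obtain c where c: "vge N' 1 (g - \<iota> c)" using shift_to_zero g(4) N' by metis
    obtain c' where c': "vge N 1 (g' - \<iota> c')" using shift_to_zero g'(4) N N'(3) by metis
    let ?h = "(g - \<iota> c) * (g' - \<iota> c')"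
    have "val E P ?h = - 2 \<and> ?h \<noteq> 0"
      using val_mult[OF P] val_diff_emb[OF P g(1)] val_diff_emb[OF P g'(1)] g(2) g'(2) by simp
    moreover have "vge Q 0 ?h" if Q: "Q \<in> points E" "Q \<noteq> P" for Q
    proof -
      consider "Q = N" | "Q = N'" | "Q \<noteq> N" "Q \<noteq> N'" by blast
      then show ?thesis
      proof cases
        case 1
        have "vge N (- 1) (g - \<iota> c)"
          using val_diff_emb[OF N(1) g(1)] g(3) by (simp add: vge_def)
        then show ?thesis using vge_mult[OF N(1) _ c'] 1 by fastforce
      next
        case 2
        have "vge N' (- 1) (g' - \<iota> c')"
          using val_diff_emb[OF N'(1) g'(1)] g'(3) by (simp add: vge_def)
        then show ?thesis using vge_mult[OF N'(1) c] 2 by fastforce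
      next
        case 3
        then have "vge Q 0 (g - \<iota> c)" "vge Q 0 (g' - \<iota> c')"
          using g(4) g'(4) Q by (auto intro!: vge_diff[OF Q(1)] vge_emb[OF Q(1)])
        then show ?thesis using vge_mult[OF Q(1)] by fastforce
      qed
    qed
    ultimately show ?case by (intro exI[of _ ?h]) simp
  next
    case (Suc k)
    then obtain h where h: "h \<noteq> 0" "val E P h = - int k"
      "\<And>Q. Q \<in> points E \<Longrightarrow> Q \<noteq> P \<Longrightarrow> vge Q 0 h" by blast
    obtain c where c: "vge N 1 (h - \<iota> c)" using shift_to_zero h(3) N by metis
    let ?h = "(h - \<iota> c) * g"
    have "val E P ?h = - int (Suc k) \<and> ?h \<noteq> 0"
      using val_mult[OF P] val_diff_emb[OF P h(1)] h(2) g(1,2) Suc(1) by simp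
    moreover have "vge Q 0 ?h" if Q: "Q \<in> points E" "Q \<noteq> P" for Q
    proof (cases "Q = N")
      case True
      have "vge N (- 1) g" using g(3) by (simp add: vge_def)
      then show ?thesis using vge_mult[OF N(1) c] True by fastforce
    next
      case False
      then have "vge Q 0 (h - \<iota> c)" "vge Q 0 g"
        using g(4) h(3) Q by (auto intro!: vge_diff[OF Q(1)] vge_emb[OF Q(1)])
      then show ?thesis using vge_mult[OF Q(1)] by fastforce
    qed
    ultimately show ?case by blast
  qed
qed

end

section \<open>The group law\<close>

context weierstrass
begin

definition has_div :: "'k \<Rightarrow> ('c point \<Rightarrow> int) \<Rightarrow> bool" where
  "has_div f D \<longleftrightarrow> f \<noteq> 0 \<and> (\<forall>Q\<in>points E. val E Q f = D Q)"

lemma has_div_mult: "has_div f D \<Longrightarrow> has_div g D' \<Longrightarrow> has_div (f * g) (\<lambda>Q. D Q + D' Q)"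
  by (auto simp: has_div_def val_mult)

lemma has_div_divide: "has_div f D \<Longrightarrow> has_div g D' \<Longrightarrow> has_div (f / g) (\<lambda>Q. D Q - D' Q)"
  by (auto simp: has_div_def val_divide)

lemma has_div_cong: "has_div f D \<Longrightarrow> (\<And>Q. Q \<in> points E \<Longrightarrow> D Q = D' Q) \<Longrightarrow> has_div f D'"
  by (auto simp: has_div_def)

lemma has_div_1: "has_div 1 (\<lambda>Q. 0)"
  by (auto simp: has_div_def val_1)

lemma val_inf_X_sub: "val E Infinity (X - \<iota> a) = - 2"
  using val_diff_emb[OF Infinity_in_points X_neq_0] by (simp add: val_inf_XY)

lemma pneg_in_points: "P \<in> points E \<Longrightarrow> pneg E P \<in> points E"
  using conj_in_points by (cases P) auto

lemma two_torsion_iff: "- b - a1 E * a - a3 E = b \<longleftrightarrow> deriv_Y a b = 0"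
proof -
  have "deriv_Y a b = b - (- b - a1 E * a - a3 E)" by (simp add: deriv_Y_def)
  then show ?thesis by (metis right_minus_eq)
qed

lemma has_div_vertical:
  assumes P: "Affine a b \<in> points E"
  shows "has_div (X - \<iota> a)
    (\<lambda>Q. pt_div 1 (Affine a b) Q + pt_div 1 (pneg E (Affine a b)) Q - 2 * pt_div 1 Infinity Q)"
  unfolding has_div_def
proof (intro conjI ballI X_sub_neq_0)
  fix Q assume Q: "Q \<in> points E"
  show "val E Q (X - \<iota> a) = pt_div 1 (Affine a b) Q + pt_div 1 (pneg E (Affine a b)) Q
          - 2 * pt_div 1 Infinity Q"
  proof (cases Q)
    case Infinity
    then show ?thesis by (simp add: pt_div_def val_inf_X_sub)
  next
    case (Affine c d)
    note Q' = Q[unfolded Affine]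
    show ?thesis
    proof (cases "a = c")
      case True
      consider "d = b" | "d = - b - a1 E * a - a3 E" "d \<noteq> b"
        using points_same_x[OF P, of d] Q' True by blast
      then show ?thesis
      proof cases
        case 1
        then show ?thesis
          using True Affine val_X_sub[OF Q'] two_torsion_iff[of b a] by (auto simp: pt_div_def)
      next
        case 2
        have "deriv_Y c d = d - b" unfolding deriv_Y_def 2(1) True by simp
        then have "deriv_Y c d \<noteq> 0" using 2 by simp
        then show ?thesis
          using True Affine val_X_sub[OF Q'] 2 by (auto simp: pt_div_def)
      qed
    next
      case False
      then show ?thesis using val_X_sub[OF Q'] Affine by (simp add: pt_div_def)
    qed
  qed
qed

lemma val_ramified_linear:
  assumes P: "Affine c d \<in> points E" and "deriv_Y c d = 0"
  shows "(Y - \<iota> d) + \<iota> e * (X - \<iota> c) \<noteq> 0 \<and> val E (Affine c d) ((Y - \<iota> d) + \<iota> e * (X - \<iota> c)) = 1"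
proof -
  have "vge (Affine c d) 2 (\<iota> e * (X - \<iota> c))"
    using val_X_sub[OF P, of c] assms(2) by (intro vge_emb_mult[OF P]) (simp add: vge_def)
  then show ?thesis
    using val_add_dominant[OF P Y_sub_neq_0, of d] val_Y_sub[OF assms] by simp
qed

text \<open>
  The multiplicities of the zeros of a line function are read off from the product with its
  conjugate, which is a product of vertical lines.
\<close>

lemma has_div_line:
  assumes P1: "Affine x1 (l * x1 + m) \<in> points E" and P2: "Affine x2 (l * x2 + m) \<in> points E"
    and P3: "Affine x3 (l * x3 + m) \<in> points E"
    and poly: "cubic - [:m, l:] * [:m, l:] - linear_coeff * [:m, l:] = [:- x1, 1:] * [:- x2, 1:] * [:- x3, 1:]"
  shows "has_div (Y - (\<iota> l * X + \<iota> m))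
    (\<lambda>Q. pt_div 1 (Affine x1 (l * x1 + m)) Q + pt_div 1 (Affine x2 (l * x2 + m)) Q
        + pt_div 1 (Affine x3 (l * x3 + m)) Q - 3 * pt_div 1 Infinity Q)"
  unfolding has_div_def
proof (intro conjI ballI)
  let ?g = "Y - (\<iota> l * X + \<iota> m)" and ?L = "\<iota> l * X + \<iota> m"
  \<comment> \<open>Up to sign, \<open>?h\<close> is the conjugate of \<open>?g\<close>, so the
    product is a polynomial in X, namely the cubic whose roots are the three X-coordinates.\<close>
  let ?h = "Y + ?L + peval linear_coeff X"
  have "?g = elem [:- m, - l:] 1" by (simp add: elem_def algebra_simps)
  then show g0: "?g \<noteq> 0" using elem_eq_0_iff by simp
  have "?h = elem ([:m, l:] + linear_coeff) 1" by (simp add: elem_def algebra_simps)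
  then have h0: "?h \<noteq> 0" using elem_eq_0_iff by simp
  have "peval (cubic - [:m, l:] * [:m, l:] - linear_coeff * [:m, l:]) X
      = peval ([:- x1, 1:] * [:- x2, 1:] * [:- x3, 1:]) X"
    by (simp only: poly)
  moreover have "peval [:m, l:] X = ?L" "peval [:- x1, 1:] X = X - \<iota> x1"
    "peval [:- x2, 1:] X = X - \<iota> x2" "peval [:- x3, 1:] X = X - \<iota> x3"
    by (simp_all add: algebra_simps)
  ultimately have "peval cubic X - ?L * ?L - peval linear_coeff X * ?L = (X - \<iota> x1) * (X - \<iota> x2) * (X - \<iota> x3)"
    by (simp only: peval_mult peval_diff)
  moreover have "?g * ?h = Y * Y + peval linear_coeff X * Y - ?L * ?L - peval linear_coeff X * ?L"
    by (simp add: algebra_simps)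
  ultimately have gh: "?g * ?h = (X - \<iota> x1) * (X - \<iota> x2) * (X - \<iota> x3)"
    unfolding Y_squared by simp
  fix Q assume Q: "Q \<in> points E"
  show "val E Q ?g = pt_div 1 (Affine x1 (l * x1 + m)) Q + pt_div 1 (Affine x2 (l * x2 + m)) Q
        + pt_div 1 (Affine x3 (l * x3 + m)) Q - 3 * pt_div 1 Infinity Q"
  proof (cases Q)
    case Infinity
    note P = Infinity_in_points
    have "vge Infinity (- 2) (\<iota> l * X + \<iota> m)"
      using vge_mono[OF P vge_emb[OF P]]
      by (intro vge_add[OF P] vge_emb_mult[OF P]) (auto simp: vge_def val_inf_XY)
    then have "vge Infinity (- 2) (- (\<iota> l * X + \<iota> m))" using vge_minus[OF P] by blast
    then have "val E Infinity (Y + - (\<iota> l * X + \<iota> m)) = - 3"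
      using val_add_dominant[OF P Y_neq_0, of "- (\<iota> l * X + \<iota> m)"]
      by (simp add: val_inf_XY)
    then have "val E Infinity (Y - (\<iota> l * X + \<iota> m)) = - 3" by (simp only: add_uminus_conv_diff)
    then show ?thesis using Infinity by (simp add: pt_div_def)
  next
    case (Affine c d)
    note Q' = Q[unfolded Affine]
    have value_g: "value_at E (Affine c d) ?g (d - (l * c + m))"
      by (intro value_at_diff[OF Q'] value_at_add[OF Q'] value_at_mult[OF Q'] value_at_emb[OF Q']
            value_at_X value_at_Y)
    have value_h: "value_at E (Affine c d) ?h (d + (l * c + m) + poly linear_coeff c)"
      by (intro value_at_add[OF Q'] value_at_mult[OF Q'] value_at_emb[OF Q']
            value_at_X value_at_Y value_at_peval)
    show ?thesis
    proof (cases "d = l * c + m")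
      case False
      then have "val E (Affine c d) ?g = 0" using value_at_nz[OF Q' value_g] by simp
      then show ?thesis using False Affine by (auto simp: pt_div_def)
    next
      case True
      have sum: "val E Q ?g + val E Q ?h = val E Q (X - \<iota> x1) + val E Q (X - \<iota> x2) + val E Q (X - \<iota> x3)"
      proof -
        have "val E Q ?g + val E Q ?h = val E Q ((X - \<iota> x1) * (X - \<iota> x2) * (X - \<iota> x3))"
          unfolding gh[symmetric] using val_mult[OF Q g0 h0] by simp
        moreover have "(X - \<iota> x1) * (X - \<iota> x2) \<noteq> 0" using X_sub_neq_0 by (metis mult_eq_0_iff)
        ultimately show ?thesis
          using val_mult[OF Q _ X_sub_neq_0] val_mult[OF Q X_sub_neq_0 X_sub_neq_0] by simp
      qed
      have count: "pt_div 1 (Affine x (l * x + m)) Q = (if x = c then 1 else 0)" for x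
        using True Affine by (auto simp: pt_div_def)
      have count_inf: "pt_div 1 Infinity Q = 0" using Affine by (simp add: pt_div_def)
      have dY: "d + (l * c + m) + poly linear_coeff c = deriv_Y c d"
        using True by (simp add: linear_coeff_def deriv_Y_def algebra_simps)
      show ?thesis
      proof (cases "deriv_Y c d = 0")
        case False
        then have "val E Q ?h = 0" using value_at_nz[OF Q' value_h] dY Affine by simp
        moreover have "val E Q (X - \<iota> x) = pt_div 1 (Affine x (l * x + m)) Q" for x
          using False val_X_sub[OF Q', of x] count[of x] Affine by simp
        ultimately show ?thesis using sum count_inf by simp
      next
        \<comment> \<open>At a point fixed by negation both factors vanish to order exactly 1 and
          each X - x counts double, so the sum formula says that one of the three intersections is
          here.\<close>
        case two: True
        have g: "?g = (Y - \<iota> d) + \<iota> (- l) * (X - \<iota> c)" using True by (simp add: algebra_simps)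
        have "val E Q ?g = 1" unfolding g Affine using val_ramified_linear[OF Q' two] by blast
        moreover have "?h = (Y - \<iota> d) + \<iota> (l + a1 E) * (X - \<iota> c) + \<iota> (deriv_Y c d)"
          unfolding dY[symmetric] by (simp add: linear_coeff_def algebra_simps)
        then have h: "?h = (Y - \<iota> d) + \<iota> (l + a1 E) * (X - \<iota> c)" unfolding two by simp
        have "val E Q ?h = 1" unfolding h Affine using val_ramified_linear[OF Q' two] by blast
        moreover have "val E Q (X - \<iota> x) = 2 * pt_div 1 (Affine x (l * x + m)) Q" for x
          using two val_X_sub[OF Q', of x] count[of x] Affine by simp
        ultimately show ?thesis using sum count_inf by simp
      qed
    qed
  qed
qed

text \<open>Substituting the line gives a monic cubic whose X^2 coefficient determines the third
  root as \<open>x3\<close>. The linear coefficient is forced by two distinct roots or, for a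
  tangent, by the slope condition; the constant term then follows from the root x1.\<close>

lemma cubic_line_factor:
  assumes P1: "Affine x1 (l * x1 + m) \<in> points E" and P2: "Affine x2 (l * x2 + m) \<in> points E"
    and "x1 \<noteq> x2 \<or> (x1 = x2 \<and> l * deriv_Y x1 (l * x1 + m) = deriv_X x1 (l * x1 + m))"
    and x3: "x3 = l\<^sup>2 + a1 E * l - a2 E - x1 - x2"
  shows "cubic - [:m, l:] * [:m, l:] - linear_coeff * [:m, l:] = [:- x1, 1:] * [:- x2, 1:] * [:- x3, 1:]"
proof -
  define e1 where "e1 = a4 E - 2 * l * m - a1 E * m - a3 E * l"
  define e0 where "e0 = a6 E - m\<^sup>2 - a3 E * m"
  have F: "x ^ 3 - (x1 + x2 + x3) * x\<^sup>2 + e1 * x + e0 = 0" if "Affine x (l * x + m) \<in> points E" for x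
    using that unfolding affine_in_points_iff e1_def e0_def x3
    by (simp add: algebra_simps power2_eq_square power3_eq_cube)
  have e1: "e1 = x1 * x2 + x1 * x3 + x2 * x3"
  proof (cases "x1 = x2")
    case False
    have "(x1 - x2) * (e1 - (x1 * x2 + x1 * x3 + x2 * x3)) = 0"
      using F[OF P1] F[OF P2] by algebra
    then show ?thesis using False by simp
  next
    case True
    then have "l * deriv_Y x1 (l * x1 + m) = deriv_X x1 (l * x1 + m)" using assms(3) by simp
    then show ?thesis unfolding True e1_def x3 deriv_Y_def deriv_X_def
      by (simp add: algebra_simps power2_eq_square power3_eq_cube)
  qed
  have e0: "e0 = - x1 * x2 * x3" using F[OF P1] unfolding e1 by algebra
  have "cubic - [:m, l:] * [:m, l:] - linear_coeff * [:m, l:] = [:e0, e1, - (x1 + x2 + x3), 1:]"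
    unfolding e1_def e0_def x3 by (simp add: cubic_def linear_coeff_def algebra_simps power2_eq_square)
  also have "\<dots> = [:- x1, 1:] * [:- x2, 1:] * [:- x3, 1:]"
    unfolding e1 e0 by (simp add: algebra_simps)
  finally show ?thesis .
qed

text \<open>That this divisor is principal is the meaning of addition: adding points is adding their
  classes in the Picard group.\<close>

definition sum_div :: "'c point \<Rightarrow> 'c point \<Rightarrow> 'c point \<Rightarrow> int" where
  "sum_div P Q = (\<lambda>Z. pt_div 1 P Z + pt_div 1 Q Z - pt_div 1 (padd E P Q) Z - pt_div 1 Infinity Z)"

text \<open>Dividing the line through P and Q by the vertical line through the third intersection
  replaces that intersection by its negative, the sum. If Q is the negative of P, the vertical line
  alone is the function.\<close>

lemma padd_divisor:
  assumes P: "P \<in> points E" and Q: "Q \<in> points E"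
  shows "padd E P Q \<in> points E \<and> (\<exists>f. has_div f (sum_div P Q))"
proof (cases P)
  case Infinity
  then show ?thesis using Q has_div_1 by (auto simp: sum_div_def)
next
  case P': (Affine x1 y1)
  show ?thesis
  proof (cases Q)
    case Infinity
    then show ?thesis using P P' has_div_1 by (auto simp: sum_div_def)
  next
    case Q': (Affine x2 y2)
    show ?thesis
    proof (cases "Q = pneg E P")
      case True
      have sum: "padd E P Q = Infinity" using True P' Q' by simp
      have "has_div (X - \<iota> x1) (\<lambda>Z. pt_div 1 P Z + pt_div 1 Q Z - 2 * pt_div 1 Infinity Z)"
        using has_div_vertical[of x1 y1] P unfolding True P' by blast
      then show ?thesis unfolding sum_div_def sum by (auto simp: algebra_simps)
    next
      case False
      define l where "l = (if x1 \<noteq> x2 then (y2 - y1) / (x2 - x1)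
                  else (3 * x1 ^ 2 + 2 * a2 E * x1 + a4 E - a1 E * y1) /
                       (2 * y1 + a1 E * x1 + a3 E))"
      define x3 where "x3 = l ^ 2 + a1 E * l - a2 E - x1 - x2"
      define m where "m = y1 - l * x1"
      have y1: "y1 = l * x1 + m" by (simp add: m_def)
      \<comment> \<open>With equal X-coordinates and Q not the negative of P, the points coincide
        and are not fixed by negation, so the tangent slope has a nonzero denominator.\<close>
      have same: "y2 = y1 \<and> deriv_Y x1 y1 \<noteq> 0" if "x1 = x2"
      proof -
        have "y2 \<noteq> - y1 - a1 E * x1 - a3 E" using False that P' Q' by simp
        moreover from this have "y2 = y1" using points_same_x P Q P' Q' that by blast
        ultimately show ?thesis using two_torsion_iff by metis
      qed
      have slope: "l * deriv_Y x1 y1 = deriv_X x1 y1" if "x1 = x2"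
        using same[OF that] that by (simp add: l_def deriv_Y_def deriv_X_def)
      have y2: "y2 = l * x2 + m"
      proof (cases "x1 = x2")
        case True
        then show ?thesis using same y1 by simp
      next
        case False
        then have "l * (x2 - x1) = y2 - y1" by (simp add: l_def)
        then show ?thesis unfolding m_def by algebra
      qed
      have y3: "l * (x3 - x1) + y1 = l * x3 + m" by (simp add: m_def algebra_simps)
      have sum: "padd E P Q = pneg E (Affine x3 (l * x3 + m))"
      proof -
        have ne: "(Affine x2 y2 = pneg E (Affine x1 y1)) = False" using False P' Q' by simp
        show ?thesis unfolding y3[symmetric]
          by (simp only: P' Q' padd.simps ne if_False Let_def l_def[symmetric] x3_def[symmetric])
      qed
      have P1: "Affine x1 (l * x1 + m) \<in> points E" "Affine x2 (l * x2 + m) \<in> points E"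
        using P Q P' Q' y1 y2 by auto
      have poly: "cubic - [:m, l:] * [:m, l:] - linear_coeff * [:m, l:] = [:- x1, 1:] * [:- x2, 1:] * [:- x3, 1:]"
        by (rule cubic_line_factor[OF P1]) (use slope y1 x3_def in auto)
      then have "poly (cubic - [:m, l:] * [:m, l:] - linear_coeff * [:m, l:]) x3 = 0" by simp
      then have P3: "Affine x3 (l * x3 + m) \<in> points E"
        unfolding affine_in_points_iff
        by (simp add: cubic_def linear_coeff_def algebra_simps power2_eq_square power3_eq_cube)
      have "has_div ((Y - (\<iota> l * X + \<iota> m)) / (X - \<iota> x3))
        (\<lambda>Z. pt_div 1 (Affine x1 (l * x1 + m)) Z + pt_div 1 (Affine x2 (l * x2 + m)) Z
           - pt_div 1 (pneg E (Affine x3 (l * x3 + m))) Z - pt_div 1 Infinity Z)"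
        by (rule has_div_cong[OF has_div_divide[OF has_div_line[OF P1 P3 poly] has_div_vertical[OF P3]]])
           (simp del: pneg.simps)
      then have "\<exists>f. has_div f (\<lambda>Z. pt_div 1 P Z + pt_div 1 Q Z
           - pt_div 1 (pneg E (Affine x3 (l * x3 + m))) Z - pt_div 1 Infinity Z)"
        unfolding P' Q' y1[symmetric] y2[symmetric] by blast
      then show ?thesis using pneg_in_points[OF P3] by (simp only: sum_div_def sum simp_thms)
    qed
  qed
qed

lemma padd_closed: "P \<in> points E \<Longrightarrow> Q \<in> points E \<Longrightarrow> padd E P Q \<in> points E"
  using padd_divisor by blast

text \<open>Such a function has at most one simple pole, hence is constant and has no zero at
  A.\<close>

lemma has_div_two_points:
  assumes "A \<in> points E" "B \<in> points E" and f: "has_div f (\<lambda>Z. pt_div 1 A Z - pt_div 1 B Z)"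
  shows "A = B"
proof -
  have "\<exists>c. f = \<iota> c"
    by (rule constant_if_one_simple_pole[OF assms(2)])
       (use f assms in \<open>auto simp: has_div_def vge_def pt_div_def\<close>)
  then obtain c where c: "f = \<iota> c" by blast
  then have "val E A f = 0" using value_at_nz(2)[OF assms(1) value_at_emb[OF assms(1)]] f
    by (auto simp: has_div_def)
  then show ?thesis using f assms(1) by (auto simp: has_div_def pt_div_def split: if_splits)
qed

text \<open>The two bracketings give functions whose quotient has divisor [(P + Q) + R] -
  [P + (Q + R)]; all other points cancel.\<close>

lemma padd_assoc:
  assumes P: "P \<in> points E" and Q: "Q \<in> points E" and R: "R \<in> points E"
  shows "padd E (padd E P Q) R = padd E P (padd E Q R)"
proof -
  note PQ = padd_closed[OF P Q] and QR = padd_closed[OF Q R]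
  obtain f1 where f1: "has_div f1 (sum_div P Q)" using padd_divisor[OF P Q] by blast
  obtain f2 where f2: "has_div f2 (sum_div (padd E P Q) R)" using padd_divisor[OF PQ R] by blast
  obtain f3 where f3: "has_div f3 (sum_div Q R)" using padd_divisor[OF Q R] by blast
  obtain f4 where f4: "has_div f4 (sum_div P (padd E Q R))" using padd_divisor[OF P QR] by blast
  have "has_div ((f3 * f4) / (f1 * f2)) (\<lambda>Z. pt_div 1 (padd E (padd E P Q) R) Z - pt_div 1 (padd E P (padd E Q R)) Z)"
    by (rule has_div_cong[OF has_div_divide[OF has_div_mult[OF f3 f4] has_div_mult[OF f1 f2]]])
       (simp add: sum_div_def)
  then show ?thesis by (rule has_div_two_points[OF padd_closed[OF PQ R] padd_closed[OF P QR]])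
qed

lemma padd_commute:
  assumes P: "P \<in> points E" and Q: "Q \<in> points E"
  shows "padd E P Q = padd E Q P"
proof -
  obtain f where f: "has_div f (sum_div P Q)" using padd_divisor[OF P Q] by blast
  obtain g where g: "has_div g (sum_div Q P)" using padd_divisor[OF Q P] by blast
  have "has_div (g / f) (\<lambda>Z. pt_div 1 (padd E P Q) Z - pt_div 1 (padd E Q P) Z)"
    by (rule has_div_cong[OF has_div_divide[OF g f]]) (simp add: sum_div_def)
  then show ?thesis by (rule has_div_two_points[OF padd_closed[OF P Q] padd_closed[OF Q P]])
qed

lemma padd_Infinity_right [simp]: "padd E P Infinity = P"
  by (cases P) auto

lemma padd_pneg: "padd E P (pneg E P) = Infinity"
  by (cases P) auto

lemma padd_cancel_left:
  assumes "P \<in> points E" "Q \<in> points E" "R \<in> points E" "padd E P Q = padd E P R"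
  shows "Q = R"
proof -
  have *: "padd E (pneg E P) (padd E P S) = S" if "S \<in> points E" for S
    unfolding padd_assoc[OF pneg_in_points[OF assms(1)] assms(1) that, symmetric]
    unfolding padd_commute[OF pneg_in_points[OF assms(1)] assms(1)] padd_pneg by simp
  show ?thesis using *[OF assms(2)] *[OF assms(3)] assms(4) by metis
qed

section \<open>Integer multiples of a point\<close>

lemma pmult_0 [simp]: "pmult E 0 P = Infinity"
  by (simp add: pmult_def)

lemma pmult_closed:
  assumes "P \<in> points E" shows "pmult E n P \<in> points E"
proof -
  have "(padd E P ^^ k) Infinity \<in> points E" for k
    by (induction k) (auto intro: padd_closed assms)
  then show ?thesis unfolding pmult_def using pneg_in_points by auto
qed

lemma pmult_1: "pmult E 1 P = P"
  by (simp add: pmult_def)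

text \<open>Negative multiples are defined by negating a positive one, so their recurrence needs
  cancellation in the group. The result is one recurrence over all integers.\<close>

lemma pmult_Suc:
  assumes P: "P \<in> points E" shows "pmult E (n + 1) P = padd E (pmult E n P) P"
proof (cases "n \<ge> 0")
  case True
  then have "nat (n + 1) = Suc (nat n)" by simp
  then show ?thesis using True padd_commute[OF P pmult_closed[OF P, of n]] by (simp add: pmult_def)
next
  case False
  \<comment> \<open>With n = - (k + 1), the multiple for n + 1 is the negative of the multiple for
    k.\<close>
  define k where "k = nat (- n) - 1"
  have n: "n = - int (Suc k)" using False by (simp add: k_def)
  let ?A = "(padd E P ^^ k) Infinity"
  have A: "?A = pmult E (int k) P" by (simp add: pmult_def)
  then have A_in: "?A \<in> points E" using pmult_closed[OF P] by metis
  have "nat (int k + 1) = Suc k" by simp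
  then have 2: "pmult E n P = pneg E (padd E P ?A)" unfolding n pmult_def by auto
  have 1: "pmult E (n + 1) P = pneg E ?A" unfolding n pmult_def by auto
  let ?B = "padd E P ?A"
  have B: "?B \<in> points E" by (rule padd_closed[OF P A_in])
  note nB = pneg_in_points[OF B]
  have "padd E ?A (padd E (pneg E ?B) P) = padd E ?A (padd E P (pneg E ?B))"
    using padd_commute[OF nB P] by simp
  also have "\<dots> = padd E (padd E ?A P) (pneg E ?B)" using padd_assoc[OF A_in P nB] by simp
  also have "\<dots> = padd E ?A (pneg E ?A)"
    using padd_commute[OF A_in P] padd_pneg by simp
  finally show ?thesis
    unfolding 1 2 using padd_cancel_left[OF A_in] padd_closed nB P pneg_in_points[OF A_in] by metis
qed

lemma pmult_add:
  assumes P: "P \<in> points E"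
  shows "pmult E (m + n) P = padd E (pmult E m P) (pmult E n P)"
proof (induction n rule: int_induct[where k = 0])
  case base
  show ?case by simp
next
  case (step1 i)
  then show ?case
    using pmult_Suc[OF P, of "m + i"] pmult_Suc[OF P, of i] padd_assoc pmult_closed[OF P] P
    by (simp add: add.assoc)
next
  case (step2 i)
  have "padd E (pmult E (m + (i - 1)) P) P = padd E (padd E (pmult E m P) (pmult E (i - 1) P)) P"
    using step2 pmult_Suc[OF P, of "m + (i - 1)"] pmult_Suc[OF P, of "i - 1"] padd_assoc pmult_closed[OF P] P
    by (simp add: algebra_simps)
  then show ?case
    using padd_cancel_left[OF P] padd_commute[OF P] padd_closed pmult_closed[OF P] by metis
qed

lemma pmult_inj:
  assumes P: "P \<in> points E" and "non_torsion E P" and eq: "pmult E m P = pmult E n P"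
  shows "m = n"
proof (rule ccontr)
  assume ne: "m \<noteq> n"
  have *: False if "i < j" "pmult E i P = pmult E j P" for i j
  proof -
    have "padd E (pmult E i P) (pmult E (j - i) P) = padd E (pmult E i P) Infinity"
      using pmult_add[OF P, of i "j - i"] that(2) by simp
    then have "pmult E (j - i) P = Infinity"
      using padd_cancel_left pmult_closed[OF P] Infinity_in_points by blast
    then show False using assms(2) that(1) by (simp add: non_torsion_def)
  qed
  show False using *[of m n] *[of n m] ne eq by (cases m n rule: linorder_cases) auto
qed

end

section \<open>Translation and polar coefficients\<close>

locale translated_curve = weierstrass E
  for E :: "('c::alg_closed_field, 'k::field) curve" +
  fixes s :: "'c point" and \<tau> :: "'k \<Rightarrow> 'k" and u :: "'c point \<Rightarrow> 'k"
  assumes s_in: "s \<in> points E" and non_torsion: "non_torsion E s"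
    and translation: "translation_automorphism E s \<tau>"
    and uniformizers: "compatible_uniformizers E s \<tau> u"
begin

section \<open>The automorphism \<tau> and its effect on valuations\<close>

lemma tau_bij: "bij \<tau>"
  and tau_add [simp]: "\<tau> (f + g) = \<tau> f + \<tau> g"
  and tau_mult [simp]: "\<tau> (f * g) = \<tau> f * \<tau> g"
  and tau_emb [simp]: "\<tau> (\<iota> c) = \<iota> c"
  using translation by (auto simp: translation_automorphism_def)

lemma tau_value: "P \<in> points E \<Longrightarrow> value_at E P (\<tau> f) c \<longleftrightarrow> value_at E (padd E P s) f c"
  using translation by (auto simp: translation_automorphism_def)

lemma tau_0 [simp]: "\<tau> 0 = 0"
  using tau_emb[of 0] by simp

lemma tau_1 [simp]: "\<tau> 1 = 1"
  using tau_emb[of 1] by simp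

lemma tau_eq_0_iff [simp]: "\<tau> f = 0 \<longleftrightarrow> f = 0"
  using tau_bij tau_0 by (metis bij_is_inj injD)

lemma tau_minus [simp]: "\<tau> (- f) = - \<tau> f"
  using tau_add[of f "- f"] by (simp add: add_eq_0_iff2 del: tau_add)

lemma tau_diff [simp]: "\<tau> (f - g) = \<tau> f - \<tau> g"
  using tau_add[of f "- g"] by simp

lemma tau_inverse [simp]: "\<tau> (inverse f) = inverse (\<tau> f)"
proof (cases "f = 0")
  case False
  have "\<tau> f * \<tau> (inverse f) = 1" unfolding tau_mult[symmetric] using False by simp
  then show ?thesis by (rule inverse_unique[symmetric])
qed simp

lemma tau_divide [simp]: "\<tau> (f / g) = \<tau> f / \<tau> g"
  by (simp add: field_class.field_divide_inverse)

lemma tau_power [simp]: "\<tau> (f ^ n) = \<tau> f ^ n"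
  by (induction n) auto

lemma tau_sum: "\<tau> (sum g A) = (\<Sum>i\<in>A. \<tau> (g i))"
  by (induction A rule: infinite_finite_induct) auto

lemma uniformizer:
  assumes "P \<in> points E"
  shows "u P \<noteq> 0" "val E P (u P) = 1" "\<tau> (u (padd E P s)) = u P"
  using uniformizers assms by (auto simp: compatible_uniformizers_def)

text \<open>Composing the valuation at P with \<tau> gives a normalized valuation whose ring is the
  local ring at P + s, because \<tau> transports values; uniqueness identifies it.\<close>

lemma val_tau:
  assumes P: "P \<in> points E"
  shows "val E P (\<tau> f) = val E (padd E P s) f"
proof -
  have "normalized_valuation_with_ring (local_ring E (padd E P s)) (\<lambda>f. val E P (\<tau> f))"
    unfolding normalized_valuation_with_ring_def
  proof (intro conjI allI impI)
    show "val E P (\<tau> 0) = 0" using val_0[OF P] by simp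
    show "val E P (\<tau> (f * g)) = val E P (\<tau> f) + val E P (\<tau> g)" if "f \<noteq> 0" "g \<noteq> 0" for f g
      using val_mult[OF P] that by simp
    show "min (val E P (\<tau> f)) (val E P (\<tau> g)) \<le> val E P (\<tau> (f + g))"
      if "f \<noteq> 0" "g \<noteq> 0" "f + g \<noteq> 0" for f g
      using nval_add[OF val_nval[OF P], of "\<tau> f" "\<tau> g"] that tau_eq_0_iff[of "f + g"]
      by (simp del: tau_eq_0_iff add: tau_eq_0_iff[of f] tau_eq_0_iff[of g])
    have "\<tau> (inv \<tau> (u P)) = u P" using tau_bij by (meson bij_inv_eq_iff)
    then show "\<exists>f. f \<noteq> 0 \<and> val E P (\<tau> f) = 1" using uniformizer[OF P] tau_0 by metis
    have "f \<in> local_ring E (padd E P s) \<longleftrightarrow> vge P 0 (\<tau> f)" for f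
      unfolding local_ring_def vge_0_iff[OF P] using tau_value[OF P] by blast
    then show "local_ring E (padd E P s) = {f. f = 0 \<or> 0 \<le> val E P (\<tau> f)}"
      by (auto simp: vge_def)
  qed
  then show ?thesis using val_eqI[OF padd_closed[OF P s_in]] by metis
qed

lemma vge_tau: "P \<in> points E \<Longrightarrow> vge P n (\<tau> f) \<longleftrightarrow> vge (padd E P s) n f"
  by (simp add: vge_def val_tau)

section \<open>Expansions in the uniformizers\<close>

abbreviation (input) coeff' :: "nat \<Rightarrow> 'k \<Rightarrow> 'c point \<Rightarrow> 'c" where
  "coeff' k f P \<equiv> polar_coeffs E u f P k"

definition principal_part :: "'c point \<Rightarrow> (nat \<Rightarrow> 'c) \<Rightarrow> nat \<Rightarrow> 'k" where
  "principal_part P c n = (\<Sum>k\<le>n. \<iota> (c k) * inverse (u P) ^ k)"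

lemma principal_part_Suc:
  "principal_part P c (Suc n) = principal_part P c n + \<iota> (c (Suc n)) * inverse (u P) ^ Suc n"
  by (simp add: principal_part_def)

lemma principal_part_diff:
  "principal_part P c n - principal_part P d n = principal_part P (\<lambda>k. c k - d k) n"
  by (simp add: principal_part_def sum_subtractf algebra_simps)

lemma vge_pole_term:
  assumes P: "P \<in> points E" shows "vge P (- int k) (\<iota> c * inverse (u P) ^ k)"
  by (rule vge_emb_mult[OF P])
     (simp add: vge_def val_power[OF P] val_inverse[OF P] uniformizer[OF P])

lemma vge_principal_part:
  assumes P: "P \<in> points E" shows "vge P (- int n) (principal_part P c n)"
  unfolding principal_part_def
  by (intro vge_sum[OF P] vge_mono[OF P vge_pole_term[OF P]]) auto

text \<open>A nonzero top coefficient would dominate all other terms and give order at most 0. This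
  is the uniqueness of expansions.\<close>

lemma principal_part_small:
  assumes P: "P \<in> points E" and "vge P 1 (principal_part P e n)" and "k \<le> n"
  shows "e k = 0"
  using assms(2,3)
proof (induction n arbitrary: k)
  case 0
  then have "value_at E P (\<iota> (e 0)) 0" using vge_1_iff[OF P] by (simp add: principal_part_def)
  then show ?case using value_at_unique[OF P value_at_emb[OF P]] 0 by auto
next
  case (Suc n)
  let ?t = "\<iota> (e (Suc n)) * inverse (u P) ^ Suc n"
  have e: "e (Suc n) = 0"
  proof (rule ccontr)
    assume nz: "e (Suc n) \<noteq> 0"
    have "val E P (\<iota> (e (Suc n))) = 0" using value_at_nz(2)[OF P value_at_emb[OF P] nz] .
    moreover have "val E P (inverse (u P) ^ Suc n) = - int (Suc n)"
      using val_power[OF P, of "inverse (u P)" "Suc n"] uniformizer[OF P] val_inverse[OF P] by simp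
    ultimately have v: "val E P ?t = - int (Suc n)"
      using val_mult[OF P, of "\<iota> (e (Suc n))" "inverse (u P) ^ Suc n"] nz uniformizer[OF P] by simp
    have t0: "?t \<noteq> 0" using nz uniformizer[OF P] by simp
    have "?t + principal_part P e n \<noteq> 0 \<and> val E P (?t + principal_part P e n) = val E P ?t"
      by (rule val_add_dominant[OF P t0]) (use v vge_principal_part[OF P, of n e] in simp)
    then show False
      using Suc.prems(1) v unfolding principal_part_Suc by (simp add: vge_def add.commute)
  qed
  then have "vge P 1 (principal_part P e n)" using Suc.prems(1) by (simp add: principal_part_Suc)
  then show ?case using Suc.IH Suc.prems(2) e by (cases "k = Suc n") auto
qed

text \<open>The top coefficient is the value at P of f times the corresponding power of u;
  subtracting its term lowers the pole order.\<close>

lemma principal_part_exists: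
  assumes P: "P \<in> points E" and "vge P (- int n) f"
  shows "\<exists>c. (\<forall>k>n. c k = 0) \<and> vge P 1 (f - principal_part P c n)"
  using assms(2)
proof (induction n arbitrary: f)
  case 0
  then obtain c where "vge P 1 (f - \<iota> c)" using shift_to_zero[OF P] by auto
  then show ?case by (intro exI[of _ "\<lambda>k. if k = 0 then c else 0"]) (simp add: principal_part_def)
next
  case (Suc n)
  note u = uniformizer[OF P]
  let ?U = "u P ^ Suc n"
  have U: "?U \<noteq> 0" "val E P ?U = int (Suc n)" using u val_power[OF P u(1), of "Suc n"] by auto
  have "vge P 0 (?U * f)" using vge_cancel[OF P U(1), of 0 f] U(2) Suc.prems by simp
  then obtain c where c: "vge P 1 (?U * f - \<iota> c)" using shift_to_zero[OF P] by blast
  have "?U * f - \<iota> c = ?U * (f - \<iota> c * inverse (u P) ^ Suc n)"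
    using U(1) by (simp add: right_diff_distrib power_inverse field_simps)
  then have "vge P (1 - int (Suc n)) (f - \<iota> c * inverse (u P) ^ Suc n)"
    using c vge_cancel[OF P U(1)] U(2) by metis
  then have "vge P (- int n) (f - \<iota> c * inverse (u P) ^ Suc n)" by simp
  then obtain d where d: "\<forall>k>n. d k = 0"
    "vge P 1 (f - \<iota> c * inverse (u P) ^ Suc n - principal_part P d n)"
    using Suc.IH by blast
  let ?d = "d(Suc n := c)"
  have "principal_part P ?d n = principal_part P d n" by (simp add: principal_part_def)
  then have "f - principal_part P ?d (Suc n) = f - \<iota> c * inverse (u P) ^ Suc n - principal_part P d n"
    by (simp add: principal_part_Suc)
  then have "vge P 1 (f - principal_part P ?d (Suc n))" using d(2) by (simp only:)
  moreover have "\<forall>k>Suc n. ?d k = 0" using d(1) by simp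
  ultimately show ?case by blast
qed

lemma pole_bound:
  assumes "P \<in> points E" obtains n where "vge P (- int n) f"
proof
  show "vge P (- int (nat (- val E P f))) f" by (auto simp: vge_def)
qed

text \<open>Connects the description of \<open>polar_coeffs\<close>, whose sum runs over the support
  of c, with truncation at a bound n. The remainder u h with h regular is the same as order at least
  1.\<close>

lemma polar_iff:
  assumes P: "P \<in> points E" and c: "\<forall>k>n. c k = 0"
  shows "(finite {k. c k \<noteq> 0} \<and> (\<exists>h\<in>local_ring E P.
           f = (\<Sum>k | c k \<noteq> 0. \<iota> (c k) * inverse (u P) ^ k) + u P * h)) \<longleftrightarrow>
         vge P 1 (f - principal_part P c n)"
proof -
  have sub: "{k. c k \<noteq> 0} \<subseteq> {..n}" using c by (auto simp: not_less[symmetric])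
  then have fin: "finite {k. c k \<noteq> 0}" using finite_subset by blast
  have "(\<Sum>k | c k \<noteq> 0. \<iota> (c k) * inverse (u P) ^ k) = principal_part P c n"
    unfolding principal_part_def by (rule sum.mono_neutral_left) (use sub in auto)
  moreover have "(\<exists>h\<in>local_ring E P. g = u P * h) \<longleftrightarrow> vge P 1 g" for g
  proof -
    have "vge P 1 (u P * h) \<longleftrightarrow> h \<in> local_ring E P" for h
      unfolding local_ring_def using vge_cancel[OF P uniformizer(1)[OF P]] uniformizer(2)[OF P] vge_0_iff[OF P] by simp
    moreover have "g = u P * (g / u P)" using uniformizer[OF P] by simp
    ultimately show ?thesis by metis
  qed
  ultimately show ?thesis using fin by (metis add_diff_cancel_left' diff_add_cancel add.commute)
qed

lemma coeffs_eqI: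
  assumes P: "P \<in> points E" and c: "\<forall>k>n. c k = 0" and f: "vge P 1 (f - principal_part P c n)"
  shows "polar_coeffs E u f P = c"
  unfolding polar_coeffs_def
proof (rule the_equality)
  show "finite {k. c k \<noteq> 0} \<and> (\<exists>h\<in>local_ring E P.
           f = (\<Sum>k | c k \<noteq> 0. \<iota> (c k) * inverse (u P) ^ k) + u P * h)"
    using polar_iff[OF P c] f by blast
next
  fix d
  assume d: "finite {k. d k \<noteq> 0} \<and> (\<exists>h\<in>local_ring E P.
           f = (\<Sum>k | d k \<noteq> 0. \<iota> (d k) * inverse (u P) ^ k) + u P * h)"
  then obtain b where "\<forall>k\<in>{k. d k \<noteq> 0}. k \<le> b" using finite_nat_set_iff_bounded_le by blast
  then have bound: "\<forall>k>max b n. d k = 0" "\<forall>k>max b n. c k = 0" using c by force+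
  have "vge P 1 (f - principal_part P d (max b n))" using polar_iff[OF P bound(1)] d by blast
  moreover have "vge P 1 (f - principal_part P c (max b n))"
    using polar_iff[OF P bound(2)] polar_iff[OF P c] f by blast
  ultimately have "vge P 1 ((f - principal_part P d (max b n)) - (f - principal_part P c (max b n)))"
    using vge_diff[OF P] by blast
  then have "vge P 1 (principal_part P (\<lambda>k. c k - d k) (max b n))"
    unfolding principal_part_diff[symmetric] by (simp add: algebra_simps)
  then have "c k - d k = 0" if "k \<le> max b n" for k
    using principal_part_small[OF P _ that, of "\<lambda>k. c k - d k"] by simp
  then show "d = c" using bound by (metis eq_iff_diff_eq_0 ext not_le)
qed

lemma coeffs_spec:
  assumes P: "P \<in> points E" and f: "vge P (- int n) f"
  shows "(\<forall>k>n. coeff' k f P = 0) \<and> vge P 1 (f - principal_part P (polar_coeffs E u f P) n)"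
  using principal_part_exists[OF assms] coeffs_eqI[OF P] by metis

lemma coeff_add:
  assumes P: "P \<in> points E" shows "coeff' k (f + g) P = coeff' k f P + coeff' k g P"
proof -
  obtain m where m: "vge P (- int m) f" using pole_bound[OF P] .
  obtain n where n: "vge P (- int n) g" using pole_bound[OF P] .
  let ?n = "max m n"
  have f: "vge P (- int ?n) f" and g: "vge P (- int ?n) g"
    using vge_mono[OF P m] vge_mono[OF P n] by auto
  have "vge P 1 ((f - principal_part P (polar_coeffs E u f P) ?n) + (g - principal_part P (polar_coeffs E u g P) ?n))"
    using coeffs_spec[OF P f] coeffs_spec[OF P g] vge_add[OF P] by blast
  also have "(f - principal_part P (polar_coeffs E u f P) ?n) + (g - principal_part P (polar_coeffs E u g P) ?n)
      = (f + g) - principal_part P (\<lambda>k. coeff' k f P + coeff' k g P) ?n"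
    by (simp add: principal_part_def sum.distrib algebra_simps)
  finally have "polar_coeffs E u (f + g) P = (\<lambda>k. coeff' k f P + coeff' k g P)"
    using coeffs_spec[OF P f] coeffs_spec[OF P g] by (intro coeffs_eqI[OF P]) auto
  then show ?thesis by simp
qed

lemma coeff_emb_mult:
  assumes P: "P \<in> points E" shows "coeff' k (\<iota> a * f) P = a * coeff' k f P"
proof -
  obtain n where n: "vge P (- int n) f" using pole_bound[OF P] .
  have "vge P 1 (\<iota> a * (f - principal_part P (polar_coeffs E u f P) n))"
    using coeffs_spec[OF P n] vge_emb_mult[OF P] by blast
  also have "\<iota> a * (f - principal_part P (polar_coeffs E u f P) n)
      = \<iota> a * f - principal_part P (\<lambda>k. a * coeff' k f P) n"
    by (simp add: principal_part_def sum_distrib_left algebra_simps)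
  finally have "polar_coeffs E u (\<iota> a * f) P = (\<lambda>k. a * coeff' k f P)"
    using coeffs_spec[OF P n] by (intro coeffs_eqI[OF P]) auto
  then show ?thesis by simp
qed

lemma coeff_emb:
  assumes P: "P \<in> points E" shows "coeff' k (\<iota> a) P = (if k = 0 then a else 0)"
proof -
  have "polar_coeffs E u (\<iota> a) P = (\<lambda>k. if k = 0 then a else 0)"
    by (rule coeffs_eqI[OF P, of 0]) (auto simp: principal_part_def vge_def)
  then show ?thesis by simp
qed

lemma coeff_0: "P \<in> points E \<Longrightarrow> coeff' k 0 P = 0"
  using coeff_emb[where a = 0] by simp

lemma coeff_minus: "P \<in> points E \<Longrightarrow> coeff' k (- f) P = - coeff' k f P"
  using coeff_emb_mult[where a = "- 1"] by simp

lemma coeff_diff: "P \<in> points E \<Longrightarrow> coeff' k (f - g) P = coeff' k f P - coeff' k g P"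
  using coeff_add[where f = f and g = "- g"] coeff_minus[where f = g] by simp

lemma coeff_sum: "P \<in> points E \<Longrightarrow> coeff' k (sum g A) P = (\<Sum>i\<in>A. coeff' k (g i) P)"
  by (induction A rule: infinite_finite_induct) (auto simp: coeff_0 coeff_add)

text \<open>From here on pole orders, Riemann-Roch spaces and constancy can all be expressed by
  vanishing of coefficients.\<close>

lemma vge_iff_coeff:
  assumes P: "P \<in> points E"
  shows "vge P (- int n) f \<longleftrightarrow> (\<forall>k>n. coeff' k f P = 0)"
proof
  assume "vge P (- int n) f"
  then show "\<forall>k>n. coeff' k f P = 0" using coeffs_spec[OF P] by blast
next
  assume *: "\<forall>k>n. coeff' k f P = 0"
  let ?c = "polar_coeffs E u f P"
  obtain m where m: "vge P (- int m) f" using pole_bound[OF P] .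
  have "vge P (- int n) (\<iota> (?c k) * inverse (u P) ^ k)" for k
  proof (cases "k \<le> n")
    case True
    then show ?thesis using vge_mono[OF P vge_pole_term[OF P]] by simp
  next
    case False
    then show ?thesis using * P by simp
  qed
  then have "vge P (- int n) (principal_part P ?c m)"
    unfolding principal_part_def by (intro vge_sum[OF P])
  moreover have "vge P (- int n) (f - principal_part P ?c m)"
    using coeffs_spec[OF P m] vge_mono[OF P] by fastforce
  ultimately show "vge P (- int n) f" using vge_add[OF P] by fastforce
qed

text \<open>Multiplication by u makes the constant term and the remainder vanish at P, so the
  coefficient of 1/u survives as a value.\<close>

lemma simple_pole_coeff:
  assumes P: "P \<in> points E" and "value_at E P (f * u P) c"
  shows "coeff' 1 f P = c" "\<And>k. k > 1 \<Longrightarrow> coeff' k f P = 0"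
proof -
  note u = uniformizer[OF P]
  have "vge P 0 (u P * f)" using assms vge_0_iff[OF P] by (auto simp: mult.commute)
  then have f: "vge P (- int 1) f" using vge_cancel[OF P u(1), of 0 f] u(2) by simp
  then show "\<And>k. k > 1 \<Longrightarrow> coeff' k f P = 0" using vge_iff_coeff[OF P] by blast
  let ?c0 = "coeff' 0 f P" and ?c1 = "coeff' 1 f P"
  have "vge P 1 (f - (\<iota> ?c0 + \<iota> ?c1 * inverse (u P)))"
    using coeffs_spec[OF P f] by (simp add: principal_part_def)
  then have "vge P 1 (u P * (f - (\<iota> ?c0 + \<iota> ?c1 * inverse (u P))))"
    using vge_cancel[OF P u(1), of 1] u(2) vge_mono[OF P] by fastforce
  moreover have "vge P 1 (\<iota> ?c0 * u P)" using u(2) by (intro vge_emb_mult[OF P]) (simp add: vge_def)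
  ultimately have "vge P 1 (u P * (f - (\<iota> ?c0 + \<iota> ?c1 * inverse (u P))) + \<iota> ?c0 * u P)"
    using vge_add[OF P] by blast
  also have "u P * (f - (\<iota> ?c0 + \<iota> ?c1 * inverse (u P))) + \<iota> ?c0 * u P = f * u P - \<iota> ?c1"
    using u(1) by (simp add: algebra_simps)
  finally have "value_at E P (f * u P - \<iota> ?c1) 0" using vge_1_iff[OF P] by simp
  moreover have "value_at E P (f * u P - \<iota> ?c1) (c - ?c1)"
    by (intro value_at_diff[OF P] assms value_at_emb[OF P])
  ultimately show "?c1 = c" using value_at_unique[OF P] by (metis eq_iff_diff_eq_0)
qed

text \<open>Compatibility of the uniformizers means that \<tau> carries the expansion at P + s term
  by term to the expansion at P.\<close>

lemma coeff_tau:
  assumes P: "P \<in> points E" shows "coeff' k (\<tau> f) P = coeff' k f (padd E P s)"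
proof -
  let ?Q = "padd E P s"
  have Q: "?Q \<in> points E" by (rule padd_closed[OF P s_in])
  obtain n where n: "vge ?Q (- int n) f" using pole_bound[OF Q] .
  let ?c = "polar_coeffs E u f ?Q"
  have "vge P 1 (\<tau> (f - principal_part ?Q ?c n))"
    using coeffs_spec[OF Q n] vge_tau[OF P] by blast
  also have "\<tau> (f - principal_part ?Q ?c n) = \<tau> f - principal_part P ?c n"
    using uniformizer(3)[OF P] by (simp add: principal_part_def tau_sum)
  finally have "polar_coeffs E u (\<tau> f) P = ?c"
    using coeffs_spec[OF Q n] by (intro coeffs_eqI[OF P]) auto
  then show ?thesis by simp
qed

text \<open>Zeros of a nonzero function are poles of its inverse, and these are finite in
  number.\<close>

lemma eq_0_if_infinitely_many_zeros:
  assumes "infinite {P \<in> points E. value_at E P f 0}"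
  shows "f = 0"
proof (rule ccontr)
  assume f: "f \<noteq> 0"
  have "{P \<in> points E. value_at E P f 0} \<subseteq> {P \<in> points E. \<not> vge P 0 (inverse f)}"
  proof clarify
    fix P assume P: "P \<in> points E" and "value_at E P f 0" "vge P 0 (inverse f)"
    then show False using vge_1_iff[OF P, of f] f by (auto simp: vge_def val_inverse[OF P])
  qed
  then show False using finite_poles assms finite_subset by blast
qed

lemma s_affine: "s \<noteq> Infinity"
  using non_torsion pmult_1[of s] by (metis non_torsion_def zero_less_one)

section \<open>Polar coefficients at the pair o, s\<close>

context
  fixes xs ys assumes s_eq: "s = Affine xs ys"
begin

lemma deriv_Y_s: "deriv_Y xs ys \<noteq> 0"
proof
  assume "deriv_Y xs ys = 0"
  then have "- ys - a1 E * xs - a3 E = ys" using two_torsion_iff by blast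
  then have "pneg E s = s" using s_eq by simp
  then have "pmult E (1 + 1) s = Infinity"
    using pmult_Suc[OF s_in, of 1] pmult_1[of s] padd_pneg[of s] by simp
  then show False using non_torsion by (simp add: non_torsion_def)
qed

text \<open>The addition formula at the generic point: both sides have equal values at every point
  other than o, s and -s, and a function with infinitely many zeros is 0.\<close>

lemma tau_X:
  defines "l \<equiv> (Y - \<iota> ys) / (X - \<iota> xs)"
  shows "\<tau> X = l\<^sup>2 + \<iota> (a1 E) * l - \<iota> (a2 E) - X - \<iota> xs"
proof -
  let ?Z = "l\<^sup>2 + \<iota> (a1 E) * l - \<iota> (a2 E) - X - \<iota> xs"
  let ?S = "{Infinity, Affine xs ys, Affine xs (- ys - a1 E * xs - a3 E)}"
  have "points E - ?S \<subseteq> {P \<in> points E. value_at E P (\<tau> X - ?Z) 0}"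
  proof
    fix P assume P': "P \<in> points E - ?S"
    then obtain a b where P: "P = Affine a b" by (cases P) auto
    have Pin: "Affine a b \<in> points E" using P' P by simp
    have ne: "a \<noteq> xs" using points_same_x[of xs ys b] s_in s_eq P P' by auto
    define m where "m = (b - ys) / (a - xs)"
    have m': "(ys - b) / (xs - a) = m"
      unfolding m_def using ne by (metis minus_diff_eq minus_divide_divide)
    have "\<exists>y. padd E P s = Affine (m\<^sup>2 + a1 E * m - a2 E - a - xs) y"
      using ne m' unfolding P s_eq by (simp add: Let_def)
    then have "value_at E (padd E P s) X (m\<^sup>2 + a1 E * m - a2 E - a - xs)"
      using value_at_X by auto
    then have 1: "value_at E P (\<tau> X) (m\<^sup>2 + a1 E * m - a2 E - a - xs)"
      using tau_value Pin P by blast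
    have l: "value_at E P l m" unfolding l_def m_def P
      by (intro value_at_divide[OF Pin] value_at_diff[OF Pin] value_at_X value_at_Y value_at_emb[OF Pin])
         (use ne in simp)
    have "value_at E P ?Z (m * m + a1 E * m - a2 E - a - xs)"
      unfolding P power2_eq_square
      by (intro value_at_add[OF Pin] value_at_diff[OF Pin] value_at_mult[OF Pin] value_at_X
            value_at_emb[OF Pin] l[unfolded P])
    then have "value_at E P (\<tau> X - ?Z) ((m\<^sup>2 + a1 E * m - a2 E - a - xs) - (m * m + a1 E * m - a2 E - a - xs))"
      using 1 Pin P value_at_diff by blast
    then show "P \<in> {P \<in> points E. value_at E P (\<tau> X - ?Z) 0}"
      using Pin P by (simp add: power2_eq_square)
  qed
  then have "infinite {P \<in> points E. value_at E P (\<tau> X - ?Z) 0}"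
    using infinite_points by (meson Diff_infinite_finite finite.emptyI finite.insertI finite_subset)
  then show ?thesis using eq_0_if_infinitely_many_zeros by fastforce
qed

text \<open>
  This value replaces the residue theorem: it expresses that the translation preserves the
  invariant differential at the pair of points \<open>o\<close>, \<open>s\<close>.
\<close>

lemma tau_X_times_slope_fun:
  "value_at E Infinity (\<tau> (X - \<iota> xs) * slope_fun xs ys) (- deriv_Y xs ys)"
proof -
  note P = Infinity_in_points
  define D where "D = X - \<iota> xs"
  define \<alpha> where "\<alpha> = deriv_X xs ys"
  \<comment> \<open>By the equation of s, \<open>\<beta>\<close> equals
    \<open>deriv_Y xs ys * ys - deriv_X xs ys * xs\<close>; the linear numerator obtained below is
    therefore a multiple of the line tangent to the curve at s.\<close>
  define \<beta> where "\<beta> = a6 E + ys\<^sup>2 + a1 E * xs * ys - a2 E * xs\<^sup>2 - 2 * xs ^ 3"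
  define y' where "y' = - ys - a1 E * xs - a3 E"
  have D0: "D \<noteq> 0" unfolding D_def by (rule X_sub_neq_0)
  \<comment> \<open>The Weierstrass equation reduces the cleared numerator to a linear polynomial in
    X and Y. Its order at infinity is -3, against -4 for D^2, so the quotient has a simple zero that
    meets the simple pole of the slope function.\<close>
  have "\<tau> (X - \<iota> xs) * D\<^sup>2 = (Y - \<iota> ys)\<^sup>2 + \<iota> (a1 E) * (Y - \<iota> ys) * D - (\<iota> (a2 E) + X + 2 * \<iota> xs) * D\<^sup>2"
    using D0 unfolding tau_diff tau_emb tau_X unfolding D_def[symmetric]
    by (simp add: field_simps power2_eq_square)
  also have "\<dots> = - \<iota> (deriv_Y xs ys) * Y + \<iota> \<alpha> * X + \<iota> \<beta>"
    using Y_squared' unfolding D_def \<alpha>_def \<beta>_def deriv_Y_def deriv_X_def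
    by (simp add: algebra_simps power2_eq_square power3_eq_cube)
  finally have 1: "\<tau> (X - \<iota> xs) = (- \<iota> (deriv_Y xs ys) * Y + \<iota> \<alpha> * X + \<iota> \<beta>) / D\<^sup>2"
    using D0 by (simp add: field_simps)
  \<comment> \<open>The product behaves at infinity like a constant times Y^2 / X^3, which is the
    inverse of the unit T and has value 1.\<close>
  have T: "1 / inf_T = Y\<^sup>2 / X ^ 3"
  proof -
    have "inf_T = Y * (X / Y) ^ 3" using inf_identity Y_neq_0 by (simp add: field_simps)
    also have "\<dots> = X ^ 3 / Y\<^sup>2" using Y_neq_0 by (simp add: field_simps power2_eq_square power3_eq_cube)
    finally show ?thesis by simp
  qed
  have "\<tau> (X - \<iota> xs) * slope_fun xs ys
     = (\<iota> (- deriv_Y xs ys) + \<iota> \<alpha> * (X / Y) + \<iota> \<beta> * (1 / Y)) * (\<iota> 1 - \<iota> y' * (1 / Y))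
       * (\<iota> 1 / inf_T) / ((\<iota> 1 - \<iota> xs * (1 / X)) * (\<iota> 1 - \<iota> xs * (1 / X)) * (\<iota> 1 - \<iota> xs * (1 / X)))"
  proof -
    have a: "- \<iota> (deriv_Y xs ys) * Y + \<iota> \<alpha> * X + \<iota> \<beta>
        = Y * (\<iota> (- deriv_Y xs ys) + \<iota> \<alpha> * (X / Y) + \<iota> \<beta> * (1 / Y))"
      using Y_neq_0 by (simp add: field_simps)
    have b: "Y - \<iota> y' = Y * (\<iota> 1 - \<iota> y' * (1 / Y))"
      using Y_neq_0 by (simp add: field_simps)
    have c: "D = X * (\<iota> 1 - \<iota> xs * (1 / X))"
      using X_neq_0 by (simp add: D_def field_simps)
    have alg: "(Y * A) / (X * C)\<^sup>2 * ((Y * B) / (X * C)) = A * B * (Y\<^sup>2 / X ^ 3) / (C * C * C)" for A B C :: 'k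
      by (simp add: power2_eq_square power3_eq_cube mult_ac)
    have S: "slope_fun xs ys = (Y - \<iota> y') / D" by (simp only: slope_fun_def y'_def D_def)
    show ?thesis unfolding 1 S a b emb_1 T
      unfolding c alg emb_1 by simp
  qed
  moreover have "value_at E Infinity \<dots> ((- deriv_Y xs ys + \<alpha> * 0 + \<beta> * 0) * (1 - y' * 0) * (1 / 1)
      / ((1 - xs * 0) * (1 - xs * 0) * (1 - xs * 0)))"
    by (intro gval_inf_T[folded value_at_eq_gval] gval_fst[of "X / Y" "1 / Y" 0 0, folded value_at_eq_gval] value_at_divide[OF P] value_at_diff[OF P] value_at_add[OF P] value_at_mult[OF P] value_at_emb[OF P]
          value_at_inf_inverse) simp_all
  ultimately show ?thesis by simp
qed

text \<open>Let e be the value of u_s / (X - xs) at s; the coefficient at s is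
  \<open>deriv_Y xs ys\<close> times e. At o the same e reappears as the value of \<tau>(u_s / (X -
  xs)), and \<tau>(u_s) = u_o, so \<open>tau_X_times_slope_fun\<close> gives the opposite
  coefficient.\<close>

lemma residues_slope_fun:
  "\<exists>e. e \<noteq> 0 \<and> coeff' 1 (slope_fun xs ys) s = e \<and> coeff' 1 (slope_fun xs ys) Infinity = - e"
proof -
  note P = Infinity_in_points
  note s' = s_in[unfolded s_eq]
  let ?D = "X - \<iota> xs" and ?l = "slope_fun xs ys"
  note D0 = X_sub_neq_0[of xs]
  have "val E s ?D = 1" using val_X_sub[OF s', of xs] deriv_Y_s s_eq by simp
  then have "val E s (u s / ?D) = 0"
    using val_divide[OF s_in uniformizer(1)[OF s_in] D0] uniformizer(2)[OF s_in] by simp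
  moreover have "u s / ?D \<noteq> 0" using uniformizer(1)[OF s_in] D0 by (metis divide_eq_0_iff)
  ultimately obtain e where e: "e \<noteq> 0" "value_at E s (u s / ?D) e"
    using val_0_value[OF s_in] by blast
  have "value_at E s ((?l * ?D) * (u s / ?D)) (deriv_Y xs ys * e)"
    using slope_fun_at_pole[OF s'] e s_eq by (intro value_at_mult[OF s_in]) simp
  moreover have "(?l * ?D) * (u s / ?D) = ?l * u s" using D0 by simp
  ultimately have 1: "coeff' 1 ?l s = deriv_Y xs ys * e" using simple_pole_coeff[OF s_in] by metis
  have "value_at E Infinity (\<tau> (u s / ?D)) e"
    using e tau_value[OF P] padd.simps(1)[of E s] by metis
  then have "value_at E Infinity ((\<tau> ?D * ?l) * \<tau> (u s / ?D)) (- deriv_Y xs ys * e)"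
    by (intro value_at_mult[OF P] tau_X_times_slope_fun)
  moreover have "(\<tau> ?D * ?l) * \<tau> (u s / ?D) = ?l * u Infinity"
  proof -
    have "\<tau> ?D \<noteq> 0" using D0 tau_eq_0_iff by metis
    moreover have "\<tau> (u s) = u Infinity" using uniformizer(3)[OF P] by simp
    ultimately show ?thesis unfolding tau_divide by (simp del: tau_diff)
  qed
  ultimately have "coeff' 1 ?l Infinity = - deriv_Y xs ys * e" using simple_pole_coeff[OF P] by metis
  then show ?thesis using 1 e deriv_Y_s by (intro exI[of _ "deriv_Y xs ys * e"]) simp
qed

end

end

section \<open>Ancillary functions\<close>

lemma supp_sum_eq:
  assumes "finite B" "B \<subseteq> A" "\<And>a. a \<in> A \<Longrightarrow> g a \<noteq> 0 \<Longrightarrow> a \<in> B"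
  shows "supp_sum g A = sum g B"
  unfolding supp_sum_def by (rule sum.mono_neutral_left) (use assms in auto)

text \<open>A nonzero inner sum exhibits a nonzero term, which places the outer index in the finite
  box; hence each support may be enlarged to the corresponding side of the box.\<close>

lemma supp_sum_triple:
  fixes g :: "'a \<Rightarrow> 'b \<Rightarrow> 'd \<Rightarrow> 'e::comm_monoid_add"
  assumes fin: "finite A" "finite B" "finite C" and sub: "A \<subseteq> A'" "C \<subseteq> C'"
    and zero: "\<And>a b c. a \<in> A' \<Longrightarrow> c \<in> C' \<Longrightarrow> g a b c \<noteq> 0 \<Longrightarrow> a \<in> A \<and> b \<in> B \<and> c \<in> C"
  shows "supp_sum (\<lambda>a. supp_sum (\<lambda>b. supp_sum (\<lambda>c. g a b c) C') UNIV) A'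
     = (\<Sum>(a, b, c)\<in>A \<times> B \<times> C. g a b c)"
proof -
  have 1: "supp_sum (\<lambda>c. g a b c) C' = (\<Sum>c\<in>C. g a b c)" if "a \<in> A'" for a b
    by (rule supp_sum_eq) (use fin sub zero that in blast)+
  have 2: "supp_sum (\<lambda>b. supp_sum (\<lambda>c. g a b c) C') UNIV = (\<Sum>b\<in>B. \<Sum>c\<in>C. g a b c)" if a: "a \<in> A'" for a
    unfolding 1[OF a]
  proof (rule supp_sum_eq)
    fix b assume "(\<Sum>c\<in>C. g a b c) \<noteq> 0"
    then obtain c where "c \<in> C" "g a b c \<noteq> 0" by (meson sum.not_neutral_contains_not_neutral)
    then show "b \<in> B" using zero a sub by blast
  qed (use fin in auto)
  have "supp_sum (\<lambda>a. supp_sum (\<lambda>b. supp_sum (\<lambda>c. g a b c) C') UNIV) A'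
      = (\<Sum>a\<in>A. supp_sum (\<lambda>b. supp_sum (\<lambda>c. g a b c) C') UNIV)"
  proof (rule supp_sum_eq)
    fix a assume a: "a \<in> A'" "supp_sum (\<lambda>b. supp_sum (\<lambda>c. g a b c) C') UNIV \<noteq> 0"
    then obtain b where "b \<in> B" "(\<Sum>c\<in>C. g a b c) \<noteq> 0"
      using 2 by (metis (mono_tags, lifting) sum.not_neutral_contains_not_neutral)
    then obtain c where "c \<in> C" "g a b c \<noteq> 0" by (meson sum.not_neutral_contains_not_neutral)
    then show "a \<in> A" using zero a sub by blast
  qed (use fin sub in auto)
  also have "\<dots> = (\<Sum>a\<in>A. \<Sum>b\<in>B. \<Sum>c\<in>C. g a b c)"
    using 2 sub by (intro sum.cong) auto
  finally show ?thesis by (simp add: sum.cartesian_product)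
qed

context translated_curve
begin

section \<open>Multiples of s, powers of \<tau> and the space of summable functions\<close>

abbreviation shift :: "'c point \<Rightarrow> int \<Rightarrow> 'c point" where
  "shift P n \<equiv> padd E P (pmult E n s)"

lemma shift_closed: "P \<in> points E \<Longrightarrow> shift P n \<in> points E"
  using padd_closed pmult_closed[OF s_in] by blast

lemma shift_shift: "P \<in> points E \<Longrightarrow> shift (shift P m) n = shift P (m + n)"
  using padd_assoc pmult_closed[OF s_in] pmult_add[OF s_in] by simp

lemma shift_s: "P \<in> points E \<Longrightarrow> shift (padd E P s) n = shift P (n + 1)"
  using shift_shift[of P 1 n] pmult_1[of s] by (simp add: add.commute)

lemma padd_shift_s: "P \<in> points E \<Longrightarrow> padd E (shift P n) s = shift P (n + 1)"
  using shift_shift[of P n 1] pmult_1[of s] by simp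

lemma shift_eq_iff:
  assumes "P \<in> points E" "Q \<in> points E" shows "shift P n = Q \<longleftrightarrow> P = shift Q (- n)"
  using shift_shift[OF assms(1), of n "- n"] shift_shift[OF assms(2), of "- n" n] by auto

lemma shift_neq: "P \<in> points E \<Longrightarrow> P \<noteq> Infinity \<Longrightarrow> shift P n \<noteq> pmult E n s"
  using shift_eq_iff[OF _ pmult_closed[OF s_in, of n], of P n] pmult_add[OF s_in, of n "- n"] by auto

lemma shift_inj: "P \<in> points E \<Longrightarrow> shift P m = shift P n \<Longrightarrow> m = n"
  using padd_cancel_left pmult_closed[OF s_in] pmult_inj[OF s_in non_torsion] by metis

lemma tau_power_Suc: "tau_power \<tau> (i + 1) f = \<tau> (tau_power \<tau> i f)"
proof (cases "i \<ge> 0")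
  case True
  then have "nat (i + 1) = Suc (nat i)" by simp
  then show ?thesis using True by (simp add: tau_power_def)
next
  case False
  define k where "k = nat (- i) - 1"
  have i: "i = - int (Suc k)" using False by (simp add: k_def)
  have "\<tau> (inv \<tau> g) = g" for g using tau_bij by (meson bij_inv_eq_iff)
  then have "\<tau> (tau_power \<tau> i f) = (inv \<tau> ^^ k) f" by (simp add: i tau_power_def nat_add_distrib)
  moreover have "tau_power \<tau> (i + 1) f = (inv \<tau> ^^ k) f" by (auto simp: i tau_power_def)
  ultimately show ?thesis by simp
qed

lemma tau_power_0: "tau_power \<tau> 0 f = f"
  by (simp add: tau_power_def)

lemma coeff_tau_power:
  assumes "P \<in> points E" shows "coeff' k (tau_power \<tau> i f) P = coeff' k f (shift P i)"
  using assms
proof (induction i arbitrary: P rule: int_induct[where k = 0])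
  case base
  then show ?case by (simp add: tau_power_0)
next
  case (step1 i)
  then show ?case
    using coeff_tau[OF step1.prems] padd_closed[OF step1.prems s_in] shift_s[OF step1.prems]
    by (simp add: tau_power_Suc)
next
  case (step2 i)
  let ?P = "shift P (- 1)"
  have P': "?P \<in> points E" using shift_closed[OF step2.prems] .
  have "padd E ?P s = P" using padd_shift_s[OF step2.prems, of "- 1"] by simp
  then have "coeff' k (tau_power \<tau> (i - 1) f) P = coeff' k (tau_power \<tau> i f) ?P"
    using coeff_tau[OF P'] tau_power_Suc[of "i - 1" f] by simp
  also have "\<dots> = coeff' k f (shift P (i - 1))"
    using step2.IH[OF P'] shift_shift[OF step2.prems, of "- 1" i] by simp
  finally show ?case .
qed

lemma summable_add:
  "elliptically_summable \<tau> f \<Longrightarrow> elliptically_summable \<tau> g \<Longrightarrow> elliptically_summable \<tau> (f + g)"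
proof -
  assume "elliptically_summable \<tau> f" "elliptically_summable \<tau> g"
  then obtain a b where "f = \<tau> a - a" "g = \<tau> b - b" unfolding elliptically_summable_def by blast
  then show ?thesis unfolding elliptically_summable_def by (intro exI[of _ "a + b"]) simp
qed

lemma summable_emb_mult: "elliptically_summable \<tau> f \<Longrightarrow> elliptically_summable \<tau> (\<iota> c * f)"
proof -
  assume "elliptically_summable \<tau> f"
  then obtain a where "f = \<tau> a - a" unfolding elliptically_summable_def by blast
  then have "\<iota> c * f = \<tau> (\<iota> c * a) - \<iota> c * a" by (simp add: right_diff_distrib)
  then show ?thesis unfolding elliptically_summable_def by blast
qed

lemma summable_0: "elliptically_summable \<tau> 0"
  unfolding elliptically_summable_def by (intro exI[of _ 0]) simp

lemma summable_diff:
  "elliptically_summable \<tau> f \<Longrightarrow> elliptically_summable \<tau> g \<Longrightarrow> elliptically_summable \<tau> (f - g)"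
  using summable_add[of f "\<iota> (- 1) * g"] summable_emb_mult[of g "- 1"] by simp

lemma summable_sum:
  "(\<And>i. i \<in> A \<Longrightarrow> elliptically_summable \<tau> (g i)) \<Longrightarrow> elliptically_summable \<tau> (sum g A)"
  by (induction A rule: infinite_finite_induct) (auto intro: summable_add summable_0)

text \<open>The difference telescopes into steps of the form \<tau>(g) - g with g a power of \<tau>
  applied to f.\<close>

lemma summable_tau_power: "elliptically_summable \<tau> (tau_power \<tau> i f - f)"
proof (induction i rule: int_induct[where k = 0])
  case base
  then show ?case using summable_0 by (simp add: tau_power_0)
next
  case (step1 i)
  have "elliptically_summable \<tau> (\<tau> (tau_power \<tau> i f) - tau_power \<tau> i f)"
    unfolding elliptically_summable_def by blast
  then show ?case using summable_add[OF _ step1(2)] by (fastforce simp: tau_power_Suc)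
next
  case (step2 i)
  have "elliptically_summable \<tau> (\<tau> (tau_power \<tau> (i - 1) f) - tau_power \<tau> (i - 1) f)"
    unfolding elliptically_summable_def by blast
  then have "elliptically_summable \<tau> (tau_power \<tau> i f - tau_power \<tau> (i - 1) f)"
    using tau_power_Suc[of "i - 1" f] by simp
  then show ?case using summable_diff[OF step2(2)] by fastforce
qed

text \<open>The exempted pair (Q, 1) allows a simple pole at Q and nothing else. This is the form in
  which constancy is used below.\<close>

lemma constant_if_coeffs:
  assumes Q: "Q \<in> points E"
    and zero: "\<And>P k. P \<in> points E \<Longrightarrow> k \<ge> 1 \<Longrightarrow> (P, k) \<noteq> (Q, 1) \<Longrightarrow> coeff' k f P = 0"
  shows "\<exists>c. f = \<iota> c"
proof (rule constant_if_one_simple_pole[OF Q])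
  have "vge Q (- int 1) f" unfolding vge_iff_coeff[OF Q] using zero[OF Q] by auto
  then show "vge Q (- 1) f" by simp
  show "vge P 0 f" if P: "P \<in> points E" "P \<noteq> Q" for P
  proof -
    have "vge P (- int 0) f" unfolding vge_iff_coeff[OF P(1)] using zero[OF P(1)] P(2) by auto
    then show ?thesis by simp
  qed
qed

lemma eq_if_coeffs:
  assumes Q: "Q \<in> points E"
    and eq: "\<And>P k. P \<in> points E \<Longrightarrow> k \<ge> 1 \<Longrightarrow> (P, k) \<noteq> (Q, 1) \<Longrightarrow> coeff' k f P = coeff' k g P"
    and eq0: "R \<in> points E" "coeff' 0 f R = coeff' 0 g R"
  shows "f = g"
proof -
  have "\<exists>c. f - g = \<iota> c"
    by (rule constant_if_coeffs[OF Q]) (use eq in \<open>auto simp: coeff_diff\<close>)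
  then obtain c where c: "f - g = \<iota> c" by blast
  have "coeff' 0 (f - g) R = 0" using eq0 by (simp add: coeff_diff)
  then have "c = 0" unfolding c by (simp add: coeff_emb[OF eq0(1)])
  then show ?thesis using c by simp
qed

lemma finite_coeffs: "finite {(P, k). P \<in> points E \<and> k \<ge> 1 \<and> coeff' k f P \<noteq> 0}"
proof -
  have "\<exists>n. \<forall>k>n. coeff' k f P = 0" if P: "P \<in> points E" for P
    using pole_bound[OF P] vge_iff_coeff[OF P] by metis
  then obtain n where n: "\<And>P k. P \<in> points E \<Longrightarrow> k > n P \<Longrightarrow> coeff' k f P = 0" by metis
  have "{(P, k). P \<in> points E \<and> k \<ge> 1 \<and> coeff' k f P \<noteq> 0}
     \<subseteq> (SIGMA P:{P \<in> points E. \<not> vge P 0 f}. {..n P})"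
  proof clarify
    fix P k assume P: "P \<in> points E" and k: "1 \<le> k" "coeff' k f P \<noteq> 0"
    have "\<not> vge P (- int 0) f" unfolding vge_iff_coeff[OF P] using k by (metis less_le_trans zero_less_one)
    moreover have "k \<le> n P" using n[OF P, of k] k by force
    ultimately show "P \<in> {P \<in> points E. \<not> vge P 0 f} \<and> k \<in> {..n P}" using P by simp
  qed
  then show ?thesis using finite_subset finite_poles by fastforce
qed

lemma finite_orbit_support:
  assumes "P \<in> points E" "k \<ge> 1" shows "finite {n. coeff' k f (shift P n) \<noteq> 0}"
proof (rule finite_imageD)
  show "inj_on (\<lambda>n. (shift P n, k)) {n. coeff' k f (shift P n) \<noteq> 0}"
    using shift_inj[OF assms(1)] by (auto simp: inj_on_def)
  show "finite ((\<lambda>n. (shift P n, k)) ` {n. coeff' k f (shift P n) \<noteq> 0})"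
    by (rule finite_subset[OF _ finite_coeffs[of f]]) (use assms shift_closed in auto)
qed

section \<open>The functions \<open>zeta\<close>\<close>

lemma RR_space_iff:
  assumes D: "\<And>P. D P = int (n P)"
  shows "f \<in> RR_space E D \<longleftrightarrow> (\<forall>P\<in>points E. \<forall>k>n P. coeff' k f P = 0)"
proof -
  have "f \<in> RR_space E D \<longleftrightarrow> (\<forall>P\<in>points E. vge P (- int (n P)) f)"
    unfolding RR_space_def vge_def D by force
  then show ?thesis using vge_iff_coeff by blast
qed

text \<open>The slope function of s divided by its coefficient at s; the coefficient at o is then -1
  because the two are opposite. A constant adjusts the constant term at o.\<close>

lemma zeta_exists:
  "\<exists>g. (\<forall>Q\<in>points E. \<forall>k\<ge>1. coeff' k g Q = (if k = 1 then of_bool (Q = s) - of_bool (Q = Infinity) else 0)) \<and>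
       coeff' 0 g Infinity = 0"
proof -
  obtain xs ys where s_eq: "s = Affine xs ys" using s_affine by (cases s) auto
  let ?l = "slope_fun xs ys"
  note P = Infinity_in_points
  obtain e where e: "e \<noteq> 0" "coeff' 1 ?l s = e" "coeff' 1 ?l Infinity = - e"
    using residues_slope_fun[OF s_eq] by blast
  define i where "i = inverse e"
  let ?g = "\<iota> i * ?l"
  have reg: "coeff' k ?l Q = 0" if Q: "Q \<in> points E" "Q \<noteq> s" "Q \<noteq> Infinity" and "k \<ge> 1" for Q k
  proof -
    obtain a b where "Q = Affine a b" using Q by (cases Q) auto
    then have "vge Q (- int 0) ?l" using slope_fun_regular[of a b xs ys] Q s_in s_eq by simp
    then show ?thesis unfolding vge_iff_coeff[OF Q(1)] using that by simp
  qed
  have "vge s (- int 1) ?l" using val_slope_fun_pole[of xs ys] s_in s_eq by (simp add: vge_def)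
  then have at_s: "coeff' k ?l s = 0" if "k > 1" for k unfolding vge_iff_coeff[OF s_in] using that by blast
  have "vge Infinity (- int 1) ?l" using val_slope_fun_inf by (simp add: vge_def)
  then have at_inf: "coeff' k ?l Infinity = 0" if "k > 1" for k unfolding vge_iff_coeff[OF P] using that by blast
  let ?h = "?g - \<iota> (coeff' 0 ?g Infinity)"
  have "coeff' k ?h Q = (if k = 1 then of_bool (Q = s) - of_bool (Q = Infinity) else 0)"
    if Q: "Q \<in> points E" and k: "k \<ge> 1" for Q k
  proof -
    have "coeff' k ?h Q = i * coeff' k ?l Q"
      using k by (simp add: coeff_diff[OF Q] coeff_emb_mult[OF Q] coeff_emb[OF Q])
    then show ?thesis using e i_def reg[OF Q _ _ k] at_s[of k] at_inf[of k] k s_affine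
      by (cases "Q = s"; cases "Q = Infinity"; cases "k = 1") auto
  qed
  moreover have "coeff' 0 ?h Infinity = 0" by (simp add: coeff_diff[OF P] coeff_emb[OF P])
  ultimately show ?thesis by blast
qed

text \<open>The defining conditions are equivalent to prescribing every coefficient of order at
  least 1 and the constant term at o, which leaves exactly one function.\<close>

lemma zeta_basic_coeffs:
  "Q \<in> points E \<Longrightarrow> k \<ge> 1 \<Longrightarrow> coeff' k (zeta_basic E s u) Q
      = (if k = 1 then of_bool (Q = s) - of_bool (Q = Infinity) else 0)"
  "coeff' 0 (zeta_basic E s u) Infinity = 0"
proof -
  let ?cond = "\<lambda>g. (\<forall>Q\<in>points E. \<forall>k\<ge>1. coeff' k g Q = (if k = 1 then of_bool (Q = s) - of_bool (Q = Infinity) else 0)) \<and>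
       coeff' 0 g Infinity = 0"
  note P = Infinity_in_points
  obtain g where g: "?cond g" using zeta_exists by blast
  define n where "n Q = (if Q = s \<or> Q = Infinity then 1 else 0 :: nat)" for Q
  have D: "pt_div 1 s Q + pt_div 1 Infinity Q = int (n Q)" for Q
    using s_affine by (auto simp: n_def pt_div_def)
  note RR = RR_space_iff[of "\<lambda>Q. pt_div 1 s Q + pt_div 1 Infinity Q" n, OF D]
  have cond: "(h \<in> RR_space E (\<lambda>Q. pt_div 1 s Q + pt_div 1 Infinity Q) \<and>
        coeff' 1 h s = 1 \<and> coeff' 1 h Infinity = - 1 \<and> coeff' 0 h Infinity = 0) \<longleftrightarrow> ?cond h" for h
  proof
    assume h: "h \<in> RR_space E (\<lambda>Q. pt_div 1 s Q + pt_div 1 Infinity Q) \<and>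
        coeff' 1 h s = 1 \<and> coeff' 1 h Infinity = - 1 \<and> coeff' 0 h Infinity = 0"
    then have z: "\<And>Q k. Q \<in> points E \<Longrightarrow> k > n Q \<Longrightarrow> coeff' k h Q = 0" using RR by blast
    have "coeff' k h Q = (if k = 1 then of_bool (Q = s) - of_bool (Q = Infinity) else 0)"
      if Q: "Q \<in> points E" "k \<ge> 1" for Q k
      using z[OF Q(1), of k] h s_affine Q(2)
      by (cases "Q = s"; cases "Q = Infinity"; cases "k = 1") (auto simp: n_def)
    then show "?cond h" using h by blast
  next
    assume h: "?cond h"
    then show "h \<in> RR_space E (\<lambda>Q. pt_div 1 s Q + pt_div 1 Infinity Q) \<and>
        coeff' 1 h s = 1 \<and> coeff' 1 h Infinity = - 1 \<and> coeff' 0 h Infinity = 0"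
      unfolding RR using s_in s_affine P by (auto simp: n_def split: if_splits)
  qed
  have "zeta_basic E s u = g"
    unfolding zeta_basic_def cond
  proof (rule the_equality[of ?cond])
    show "?cond g" by (rule g)
    show "h = g" if h: "?cond h" for h
      by (rule eq_if_coeffs[OF P _ P]) (use h g in auto)
  qed
  then show "Q \<in> points E \<Longrightarrow> k \<ge> 1 \<Longrightarrow> coeff' k (zeta_basic E s u) Q
      = (if k = 1 then of_bool (Q = s) - of_bool (Q = Infinity) else 0)"
    "coeff' 0 (zeta_basic E s u) Infinity = 0" using g by auto
qed

text \<open>One recurrence replaces the three cases of the definition; the values n = 0 and n = -1
  are where the cases change.\<close>

lemma zeta_Suc:
  "zeta E s \<tau> u (n + 1) 0 = zeta E s \<tau> u n 0 + tau_power \<tau> (- n) (zeta_basic E s u)"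
proof -
  let ?t = "\<lambda>i. tau_power \<tau> (- i) (zeta_basic E s u)"
  consider "n > 0" | "n = 0" | "n = - 1" | "n < - 1" by linarith
  then show ?thesis
  proof cases
    case 1
    then have "{0..n} = insert n {0..n - 1}" by auto
    then have "(\<Sum>i\<in>{0..n}. ?t i) = (\<Sum>i\<in>{0..n - 1}. ?t i) + ?t n" by (simp add: add.commute)
    then show ?thesis using 1 by (simp add: zeta_def)
  next
    case 4
    then have "{n..- 1} = insert n {n + 1..- 1}" by auto
    then show ?thesis using 4 by (simp add: zeta_def)
  qed (simp_all add: zeta_def)
qed

lemma zeta_0: "zeta E s \<tau> u 0 0 = 0"
  by (simp add: zeta_def)

text \<open>The power \<tau>^(-n) of the basic function has its poles at (n + 1) s and n s, so the
  polar coefficients telescope to n s and o.\<close>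

lemma zeta_coeffs:
  assumes Q: "Q \<in> points E" and k: "k \<ge> 1"
  shows "coeff' k (zeta E s \<tau> u n 0) Q
      = (if k = 1 then of_bool (Q = pmult E n s) - of_bool (Q = Infinity) else 0)"
proof -
  define c where "c n = (if k = 1 then of_bool (Q = pmult E n s) - of_bool (Q = Infinity) else (0 :: 'c))" for n
  have step: "coeff' k (zeta E s \<tau> u (n + 1) 0) Q = coeff' k (zeta E s \<tau> u n 0) Q + (c (n + 1) - c n)" for n
  proof -
    have a: "shift Q (- n) = s \<longleftrightarrow> Q = pmult E (n + 1) s"
      using shift_eq_iff[OF Q s_in, of "- n"] padd_commute[OF s_in pmult_closed[OF s_in, of n]]
        pmult_Suc[OF s_in, of n] by auto
    have b: "shift Q (- n) = Infinity \<longleftrightarrow> Q = pmult E n s"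
      using shift_eq_iff[OF Q Infinity_in_points, of "- n"] by simp
    have "coeff' k (tau_power \<tau> (- n) (zeta_basic E s u)) Q = c (n + 1) - c n"
      unfolding c_def
      using zeta_basic_coeffs(1)[OF shift_closed[OF Q] k, of "- n"] a b by (simp add: coeff_tau_power[OF Q])
    then show ?thesis by (simp add: zeta_Suc coeff_add[OF Q])
  qed
  have "coeff' k (zeta E s \<tau> u n 0) Q = c n"
  proof (induction n rule: int_induct[where k = 0])
    case base
    then show ?case by (simp add: zeta_0 coeff_0[OF Q] c_def)
  next
    case (step1 i)
    then show ?case using step[of i] by simp
  next
    case (step2 i)
    then show ?case using step[of "i - 1"] by simp
  qed
  then show ?thesis by (simp add: c_def)
qed

lemma zeta_mod_summable:
  "elliptically_summable \<tau> (zeta E s \<tau> u n 0 - \<iota> (of_int n) * zeta_basic E s u)"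
proof -
  let ?z = "zeta_basic E s u"
  let ?d = "\<lambda>n. zeta E s \<tau> u n 0 - \<iota> (of_int n) * ?z"
  have step: "?d (n + 1) = ?d n + (tau_power \<tau> (- n) ?z - ?z)" for n
    unfolding zeta_Suc by (simp add: algebra_simps)
  show ?thesis
  proof (induction n rule: int_induct[where k = 0])
    case base
    then show ?case using summable_0 by (simp add: zeta_0)
  next
    case (step1 i)
    then show ?case unfolding step using summable_add summable_tau_power by blast
  next
    case (step2 i)
    have "?d (i - 1) = ?d i - (tau_power \<tau> (- (i - 1)) ?z - ?z)" using step[of "i - 1"] by simp
    then show ?case using step2 summable_diff summable_tau_power by metis
  qed
qed

text \<open>Triangular elimination from the highest pole order downwards, in a space R closed under
  linear combinations that has a function of each exact order from m to n. The bound n + 1 >= m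
  admits the empty range.\<close>

lemma prescribe_coeffs:
  assumes P: "P \<in> points E"
    and basis: "\<And>k. m \<le> k \<Longrightarrow> k \<le> n \<Longrightarrow> \<exists>h. R h \<and> coeff' k h P \<noteq> 0 \<and> (\<forall>j>k. coeff' j h P = 0)"
    and R: "R 0" "\<And>g h. R g \<Longrightarrow> R h \<Longrightarrow> R (g + h)" "\<And>c h. R h \<Longrightarrow> R (\<iota> c * h)"
    and "n + 1 \<ge> m"
  shows "\<exists>g. R g \<and> (\<forall>j. m \<le> j \<longrightarrow> coeff' j g P = (if j \<le> n then c j else 0))"
  using \<open>n + 1 \<ge> m\<close> basis
proof (induction n arbitrary: c)
  case 0
  show ?case
  proof (cases "m = 0")
    case False
    then have "m = 1" using 0 by simp
    then show ?thesis using R(1) by (intro exI[of _ 0]) (auto simp: coeff_0[OF P])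
  next
    case True
    then obtain h where h: "R h" "coeff' 0 h P \<noteq> 0" "\<forall>j>0. coeff' j h P = 0" using 0(2)[of 0] by auto
    define a where "a = c 0 / coeff' 0 h P"
    have "R (\<iota> a * h)" using R(3) h(1) by blast
    moreover have "coeff' j (\<iota> a * h) P = (if j \<le> 0 then c j else 0)" for j
      unfolding coeff_emb_mult[OF P] using h by (auto simp: a_def)
    ultimately show ?thesis by blast
  qed
next
  case (Suc n)
  show ?case
  proof (cases "n + 1 \<ge> m")
    case False
    then have "m = n + 2" using Suc.prems(1) by simp
    then show ?thesis using R(1) by (intro exI[of _ 0]) (auto simp: coeff_0[OF P])
  next
    case True
    then obtain h where h: "R h" "coeff' (Suc n) h P \<noteq> 0" "\<forall>j>Suc n. coeff' j h P = 0"
      using Suc.prems(2)[of "Suc n"] by auto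
    define a where "a = c (Suc n) / coeff' (Suc n) h P"
    \<comment> \<open>Adding a multiple of h also changes the lower coefficients, so the induction
      is applied to targets corrected beforehand.\<close>
    have IH: "\<exists>g. R g \<and> (\<forall>j. m \<le> j \<longrightarrow> coeff' j g P = (if j \<le> n then c j - a * coeff' j h P else 0))"
      by (rule Suc.IH[OF True]) (use Suc.prems(2) in auto)
    then obtain g where g: "R g" "\<And>j. m \<le> j \<Longrightarrow> coeff' j g P = (if j \<le> n then c j - a * coeff' j h P else 0)"
      by blast
    have "coeff' j (g + \<iota> a * h) P = (if j \<le> Suc n then c j else 0)" if "m \<le> j" for j
      unfolding coeff_add[OF P] coeff_emb_mult[OF P] using g(2)[OF that] h
      by (cases "j = Suc n"; cases "j \<le> n") (auto simp: a_def)
    moreover have "R (g + \<iota> a * h)" using R g(1) h(1) by blast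
    ultimately show ?thesis by blast
  qed
qed

section \<open>The functions \<open>phi\<close> and \<open>phi_hat\<close>\<close>

lemma leading_coeff_nonzero:
  assumes P: "P \<in> points E" and "g \<noteq> 0" "val E P g = - int k" "k \<ge> 1"
  shows "coeff' k g P \<noteq> 0" "\<forall>j>k. coeff' j g P = 0"
proof -
  have "vge P (- int k) g" using assms by (simp add: vge_def)
  then show 1: "\<forall>j>k. coeff' j g P = 0" using vge_iff_coeff[OF P] by blast
  have "\<not> vge P (- int (k - 1)) g" using assms by (simp add: vge_def of_nat_diff)
  then obtain j where "j > k - 1" "coeff' j g P \<noteq> 0" using vge_iff_coeff[OF P] by blast
  moreover from this have "j = k" using 1 by (metis Suc_diff_1 Suc_leI assms(4) le_neq_implies_less less_le_trans zero_less_one)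
  ultimately show "coeff' k g P \<noteq> 0" by simp
qed

lemma coeff_0_if_regular:
  assumes "P \<in> points E" "vge P 0 g" "k \<ge> 1" shows "coeff' k g P = 0"
  using vge_iff_coeff[OF assms(1), of 0 g] assms by simp

text \<open>The conditions on \<open>phi\<close> in terms of coefficients; for P different from N,
  the coefficient of order 1 at N is the only one of positive order left free.\<close>

definition phi_cond :: "'c point \<Rightarrow> 'c point \<Rightarrow> nat \<Rightarrow> 'k \<Rightarrow> bool" where
  "phi_cond P N k g \<longleftrightarrow>
     (\<forall>Q\<in>points E. \<forall>j\<ge>1. Q \<noteq> P \<longrightarrow> (Q, j) \<noteq> (N, 1) \<longrightarrow> coeff' j g Q = 0) \<and>
     (\<forall>j\<ge>1. coeff' j g P = of_bool (j = k)) \<and> coeff' 0 g N = 0"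

lemma phi_cond_unique:
  assumes "P \<in> points E" "N \<in> points E" "P \<noteq> N" "phi_cond P N k g" "phi_cond P N k h"
  shows "g = h"
proof (rule eq_if_coeffs[OF assms(2) _ assms(2)])
  show "coeff' j g Q = coeff' j h Q" if "Q \<in> points E" "1 \<le> j" "(Q, j) \<noteq> (N, 1)" for Q j
    using that assms(4,5) unfolding phi_cond_def by (cases "Q = P") auto
qed (use assms in \<open>auto simp: phi_cond_def\<close>)

text \<open>For elimination, order 1 at P is supplied by a function with a second simple pole at N,
  and higher orders by functions with a pole at P only. Subtracting a constant then normalizes the
  constant term at N.\<close>

lemma phi_cond_exists:
  assumes P: "P \<in> points E" and N: "N \<in> points E" and ne: "P \<noteq> N" and k: "k \<ge> 1"
  shows "\<exists>g. phi_cond P N k g"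
proof -
  let ?R = "\<lambda>g. \<forall>Q\<in>points E. \<forall>j\<ge>1. Q \<noteq> P \<longrightarrow> (Q, j) \<noteq> (N, 1) \<longrightarrow> coeff' j g Q = 0"
  have "\<exists>g. ?R g \<and> (\<forall>j. 1 \<le> j \<longrightarrow> coeff' j g P = (if j \<le> k then of_bool (j = k) else 0))"
  proof (rule prescribe_coeffs[OF P])
    fix i :: nat assume i: "1 \<le> i" "i \<le> k"
    show "\<exists>h. ?R h \<and> coeff' i h P \<noteq> 0 \<and> (\<forall>j>i. coeff' j h P = 0)"
    proof (cases "i = 1")
      case True
      obtain g where g: "g \<noteq> 0" "val E P g = - 1" "val E N g = - 1"
        "\<And>Q. Q \<in> points E \<Longrightarrow> Q \<noteq> P \<Longrightarrow> Q \<noteq> N \<Longrightarrow> vge Q 0 g"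
        using two_simple_poles[OF P N ne] by blast
      have "?R g"
      proof (intro ballI allI impI)
        fix Q and j :: nat assume Q: "Q \<in> points E" "1 \<le> j" "Q \<noteq> P" "(Q, j) \<noteq> (N, 1)"
        show "coeff' j g Q = 0"
        proof (cases "Q = N")
          case True
          have "vge N (- int 1) g" using g(3) by (simp add: vge_def)
          then have "\<forall>k>1. coeff' k g N = 0" unfolding vge_iff_coeff[OF N] .
          then show ?thesis using True Q by auto
        next
          case False
          then show ?thesis using coeff_0_if_regular[OF Q(1) g(4)] Q by blast
        qed
      qed
      then show ?thesis using leading_coeff_nonzero[OF P g(1), of 1] g(2) True by auto
    next
      case False
      then have "i \<ge> 2" using i by simp
      then obtain g where g: "g \<noteq> 0" "val E P g = - int i"
        "\<And>Q. Q \<in> points E \<Longrightarrow> Q \<noteq> P \<Longrightarrow> vge Q 0 g"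
        using pole_of_order[OF P] by blast
      have "?R g" using coeff_0_if_regular g(3) by blast
      then show ?thesis using leading_coeff_nonzero[OF P g(1,2) i(1)] by blast
    qed
  next
    show "?R 0" using coeff_0 by blast
  next
    show "?R (g + h)" if "?R g" "?R h" for g h
      using that by (simp add: coeff_add)
  next
    show "?R (\<iota> c * h)" if "?R h" for c h
      using that by (simp add: coeff_emb_mult)
  qed simp
  then obtain g where g: "?R g" "\<forall>j. 1 \<le> j \<longrightarrow> coeff' j g P = (if j \<le> k then of_bool (j = k) else 0)"
    by blast
  have "phi_cond P N k (g - \<iota> (coeff' 0 g N))"
    unfolding phi_cond_def
  proof (intro conjI ballI allI impI)
    fix Q and j :: nat assume "Q \<in> points E" "1 \<le> j" "Q \<noteq> P" "(Q, j) \<noteq> (N, 1)"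
    then show "coeff' j (g - \<iota> (coeff' 0 g N)) Q = 0" using g(1) by (simp add: coeff_diff coeff_emb)
  next
    fix j :: nat assume "1 \<le> j"
    then show "coeff' j (g - \<iota> (coeff' 0 g N)) P = of_bool (j = k)"
      using g(2) k by (auto simp: coeff_diff[OF P] coeff_emb[OF P])
  qed (simp add: coeff_diff[OF N] coeff_emb[OF N])
  then show ?thesis by blast
qed

lemma phi_the:
  assumes P: "P \<in> points E" and N: "N \<in> points E" and ne: "P \<noteq> N" and k: "k \<ge> 1"
  shows "phi_cond P N k (THE g. g \<in> RR_space E (\<lambda>Q. pt_div (int k) P Q + pt_div 1 N Q) \<and>
           coeff' k g P = 1 \<and> (\<forall>j\<ge>1. j \<noteq> k \<longrightarrow> coeff' j g P = 0) \<and> coeff' 0 g N = 0)"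
proof -
  define n where "n Q = (if Q = P then k else if Q = N then 1 else 0 :: nat)" for Q
  have D: "pt_div (int k) P Q + pt_div 1 N Q = int (n Q)" for Q
    using ne by (auto simp: n_def pt_div_def)
  note RR = RR_space_iff[of "\<lambda>Q. pt_div (int k) P Q + pt_div 1 N Q" n, OF D]
  have "(g \<in> RR_space E (\<lambda>Q. pt_div (int k) P Q + pt_div 1 N Q) \<and>
           coeff' k g P = 1 \<and> (\<forall>j\<ge>1. j \<noteq> k \<longrightarrow> coeff' j g P = 0) \<and> coeff' 0 g N = 0) \<longleftrightarrow> phi_cond P N k g" for g
  proof
    assume g: "g \<in> RR_space E (\<lambda>Q. pt_div (int k) P Q + pt_div 1 N Q) \<and>
           coeff' k g P = 1 \<and> (\<forall>j\<ge>1. j \<noteq> k \<longrightarrow> coeff' j g P = 0) \<and> coeff' 0 g N = 0"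
    then have z: "\<And>Q j. Q \<in> points E \<Longrightarrow> j > n Q \<Longrightarrow> coeff' j g Q = 0" using RR by blast
    have "coeff' j g Q = 0" if "Q \<in> points E" "j \<ge> 1" "Q \<noteq> P" "(Q, j) \<noteq> (N, 1)" for Q j
      using z[OF that(1), of j] that by (auto simp: n_def split: if_splits)
    then show "phi_cond P N k g" using g unfolding phi_cond_def by auto
  next
    assume g: "phi_cond P N k g"
    have "coeff' j g Q = 0" if "Q \<in> points E" "j > n Q" for Q j
      using g that unfolding phi_cond_def by (cases "Q = P") (auto simp: n_def split: if_splits)
    then show "g \<in> RR_space E (\<lambda>Q. pt_div (int k) P Q + pt_div 1 N Q) \<and>
           coeff' k g P = 1 \<and> (\<forall>j\<ge>1. j \<noteq> k \<longrightarrow> coeff' j g P = 0) \<and> coeff' 0 g N = 0"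
      unfolding RR using g k unfolding phi_cond_def by auto
  qed
  then show ?thesis
    using theI'[of "phi_cond P N k"] phi_cond_exists[OF assms] phi_cond_unique[OF P N ne] by auto
qed

text \<open>Here the free coefficient is the one of order 1 at P itself; the second condition
  includes j = 0 and so fixes the constant.\<close>

definition phi_hat_cond :: "'c point \<Rightarrow> nat \<Rightarrow> 'k \<Rightarrow> bool" where
  "phi_hat_cond P k g \<longleftrightarrow>
     (\<forall>Q\<in>points E. \<forall>j\<ge>1. Q \<noteq> P \<longrightarrow> coeff' j g Q = 0) \<and>
     (\<forall>j. j \<noteq> 1 \<longrightarrow> coeff' j g P = of_bool (j = k))"

lemma phi_hat_cond_unique:
  assumes P: "P \<in> points E" and "k \<ge> 2" "phi_hat_cond P k g" "phi_hat_cond P k h"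
  shows "g = h"
proof (rule eq_if_coeffs[OF P _ P])
  show "coeff' j g Q = coeff' j h Q" if "Q \<in> points E" "1 \<le> j" "(Q, j) \<noteq> (P, 1)" for Q j
    using that assms(3,4) unfolding phi_hat_cond_def by (cases "Q = P") auto
qed (use assms in \<open>auto simp: phi_hat_cond_def\<close>)

text \<open>Elimination stops at order 2, since no function with a single simple pole is available
  to adjust order 1.\<close>

lemma phi_hat_cond_exists:
  assumes P: "P \<in> points E" and k: "k \<ge> 2"
  shows "\<exists>g. phi_hat_cond P k g"
proof -
  let ?R = "\<lambda>g. \<forall>Q\<in>points E. \<forall>j\<ge>1. Q \<noteq> P \<longrightarrow> coeff' j g Q = 0"
  have "\<exists>g. ?R g \<and> (\<forall>j. 2 \<le> j \<longrightarrow> coeff' j g P = (if j \<le> k then of_bool (j = k) else 0))"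
  proof (rule prescribe_coeffs[OF P])
    fix i :: nat assume i: "2 \<le> i" "i \<le> k"
    then obtain g where g: "g \<noteq> 0" "val E P g = - int i"
        "\<And>Q. Q \<in> points E \<Longrightarrow> Q \<noteq> P \<Longrightarrow> vge Q 0 g"
      using pole_of_order[OF P] by blast
    have "?R g" using coeff_0_if_regular g(3) by blast
    then show "\<exists>h. ?R h \<and> coeff' i h P \<noteq> 0 \<and> (\<forall>j>i. coeff' j h P = 0)"
      using leading_coeff_nonzero[OF P g(1,2)] i by auto
  next
    show "?R 0" using coeff_0 by blast
  next
    show "?R (g + h)" if "?R g" "?R h" for g h
      using that by (simp add: coeff_add)
  next
    show "?R (\<iota> c * h)" if "?R h" for c h
      using that by (simp add: coeff_emb_mult)
  qed (use k in simp)
  then obtain g where g: "?R g" "\<forall>j. 2 \<le> j \<longrightarrow> coeff' j g P = (if j \<le> k then of_bool (j = k) else 0)"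
    by blast
  have "phi_hat_cond P k (g - \<iota> (coeff' 0 g P))"
    unfolding phi_hat_cond_def
  proof (intro conjI ballI allI impI)
    fix Q and j :: nat assume "Q \<in> points E" "1 \<le> j" "Q \<noteq> P"
    then show "coeff' j (g - \<iota> (coeff' 0 g P)) Q = 0" using g(1) by (simp add: coeff_diff coeff_emb)
  next
    fix j :: nat assume "j \<noteq> 1"
    then consider "j = 0" | "j \<ge> 2" by linarith
    then show "coeff' j (g - \<iota> (coeff' 0 g P)) P = of_bool (j = k)"
      using g(2) k by cases (auto simp: coeff_diff[OF P] coeff_emb[OF P])
  qed
  then show ?thesis by blast
qed

lemma phi_hat_cond:
  assumes k: "k \<ge> 2"
  shows "phi_hat_cond (pmult E n s) k (phi_hat E s u n k)"
proof -
  let ?P = "pmult E n s"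
  have P: "?P \<in> points E" by (rule pmult_closed[OF s_in])
  define m where "m Q = (if Q = ?P then k else 0 :: nat)" for Q
  have D: "pt_div (int k) ?P Q = int (m Q)" for Q
    by (auto simp: m_def pt_div_def)
  note RR = RR_space_iff[of "pt_div (int k) ?P" m, OF D]
  have "(g \<in> RR_space E (pt_div (int k) ?P) \<and> coeff' k g ?P = 1 \<and>
        (\<forall>j. j \<noteq> 1 \<longrightarrow> j \<noteq> k \<longrightarrow> coeff' j g ?P = 0)) \<longleftrightarrow> phi_hat_cond ?P k g" for g
  proof
    assume g: "g \<in> RR_space E (pt_div (int k) ?P) \<and> coeff' k g ?P = 1 \<and>
        (\<forall>j. j \<noteq> 1 \<longrightarrow> j \<noteq> k \<longrightarrow> coeff' j g ?P = 0)"
    then have z: "\<And>Q j. Q \<in> points E \<Longrightarrow> j > m Q \<Longrightarrow> coeff' j g Q = 0" using RR by blast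
    have "coeff' j g Q = 0" if "Q \<in> points E" "j \<ge> 1" "Q \<noteq> ?P" for Q j
      using z[OF that(1), of j] that by (auto simp: m_def)
    then show "phi_hat_cond ?P k g" using g unfolding phi_hat_cond_def by auto
  next
    assume g: "phi_hat_cond ?P k g"
    have "coeff' j g Q = 0" if "Q \<in> points E" "j > m Q" for Q j
      using g that k unfolding phi_hat_cond_def by (cases "Q = ?P") (auto simp: m_def)
    then show "g \<in> RR_space E (pt_div (int k) ?P) \<and> coeff' k g ?P = 1 \<and>
        (\<forall>j. j \<noteq> 1 \<longrightarrow> j \<noteq> k \<longrightarrow> coeff' j g ?P = 0)"
      unfolding RR using g k unfolding phi_hat_cond_def by auto
  qed
  then have "phi_hat E s u n k = (THE g. phi_hat_cond ?P k g)" unfolding phi_hat_def by simp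
  then show ?thesis
    using theI'[of "phi_hat_cond ?P k"] phi_hat_cond_exists[OF P k] phi_hat_cond_unique[OF P k] by metis
qed

text \<open>The coefficients of \<tau>^(-n)(g) at Q are those of g at Q - n s, so conditions at P
  and N become conditions at P + n s and N + n s.\<close>

lemma phi_cond_shift:
  assumes P: "P \<in> points E" and N: "N \<in> points E" and g: "phi_cond P N k g"
  shows "phi_cond (shift P n) (shift N n) k (tau_power \<tau> (- n) g)"
proof -
  have c: "coeff' j (tau_power \<tau> (- n) g) Q = coeff' j g (shift Q (- n))" if "Q \<in> points E" for j Q
    using coeff_tau_power[OF that] .
  have unshift: "shift (shift R n) (- n) = R" if "R \<in> points E" for R using shift_shift[OF that, of n "- n"] by simp
  show ?thesis unfolding phi_cond_def
  proof (intro conjI ballI allI impI)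
    fix Q and j :: nat assume Q: "Q \<in> points E" "1 \<le> j" "Q \<noteq> shift P n" "(Q, j) \<noteq> (shift N n, 1)"
    have "shift Q (- n) \<noteq> P" "(shift Q (- n), j) \<noteq> (N, 1)"
      using Q shift_eq_iff[OF Q(1) P, of "- n"] shift_eq_iff[OF Q(1) N, of "- n"] by auto
    then show "coeff' j (tau_power \<tau> (- n) g) Q = 0"
      using g Q shift_closed unfolding c[OF Q(1)] phi_cond_def by blast
  qed (use g in \<open>auto simp: c shift_closed P N unshift phi_cond_def\<close>)
qed

lemma phi_hat_cond_shift:
  assumes P: "P \<in> points E" and g: "phi_hat_cond P k g"
  shows "phi_hat_cond (shift P n) k (tau_power \<tau> (- n) g)"
proof -
  have c: "coeff' j (tau_power \<tau> (- n) g) Q = coeff' j g (shift Q (- n))" if "Q \<in> points E" for j Q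
    using coeff_tau_power[OF that] .
  have unshift: "shift (shift R n) (- n) = R" if "R \<in> points E" for R using shift_shift[OF that, of n "- n"] by simp
  show ?thesis unfolding phi_hat_cond_def
  proof (intro conjI ballI allI impI)
    fix Q and j :: nat assume Q: "Q \<in> points E" "1 \<le> j" "Q \<noteq> shift P n"
    have "shift Q (- n) \<noteq> P"
      using Q shift_eq_iff[OF Q(1) P, of "- n"] by auto
    then show "coeff' j (tau_power \<tau> (- n) g) Q = 0"
      using g Q shift_closed unfolding c[OF Q(1)] phi_hat_cond_def by blast
  qed (use g in \<open>auto simp: c shift_closed P unshift phi_hat_cond_def\<close>)
qed

end

section \<open>Reduction modulo summable functions\<close>

context translated_curve
begin

section \<open>Orbits with chosen representatives\<close>

context
  fixes r :: "'c point set \<Rightarrow> 'c point"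
  assumes r_in: "\<And>w. w \<in> orbits E s \<Longrightarrow> r w \<in> w"
begin

lemma orbit_eq:
  assumes w: "w \<in> orbits E s"
  shows "r w \<in> points E" "w = range (shift (r w))"
proof -
  obtain P where P: "P \<in> points E" "w = range (shift P)"
    using w unfolding orbits_def by auto
  then obtain m where m: "r w = shift P m" using r_in[OF w] by auto
  then show rw: "r w \<in> points E" using shift_closed P by simp
  have "shift P n = shift (r w) (n - m)" for n using shift_shift[OF P(1), of m "n - m"] m by simp
  moreover have "shift (r w) n = shift P (m + n)" for n using shift_shift[OF P(1)] m by simp
  ultimately show "w = range (shift (r w))" unfolding P(2) by (metis (no_types, lifting) order_antisym rangeI image_subsetI)
qed

lemma orbit_cover:
  assumes P: "P \<in> points E" shows "\<exists>w\<in>orbits E s. \<exists>n. P = shift (r w) n"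
proof -
  let ?w = "range (shift P)"
  have w: "?w \<in> orbits E s" using P unfolding orbits_def by blast
  have "P \<in> ?w" using pmult_0 padd_Infinity_right by (metis rangeI)
  then have "P \<in> range (shift (r ?w))" using orbit_eq(2)[OF w] by simp
  then show ?thesis using w by blast
qed

text \<open>A coset is determined by any of its points, and s is non-torsion; together with
  \<open>orbit_cover\<close>, points correspond one-to-one to pairs of an orbit and an
  integer.\<close>

lemma orbit_unique:
  assumes w: "w \<in> orbits E s" and w': "w' \<in> orbits E s" and eq: "shift (r w) n = shift (r w') n'"
  shows "w = w' \<and> n = n'"
proof -
  note rw = orbit_eq(1)[OF w] and rw' = orbit_eq(1)[OF w']
  have 1: "r w' = shift (r w) (n - n')"
    using eq shift_shift[OF rw, of n "- n'"] shift_shift[OF rw', of n' "- n'"] by simp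
  have "shift (r w') m = shift (r w) (n - n' + m)" for m
    unfolding 1 shift_shift[OF rw] ..
  then have "range (shift (r w')) \<subseteq> range (shift (r w))" by auto
  moreover have 2: "r w = shift (r w') (n' - n)"
    using eq shift_shift[OF rw, of n "- n"] shift_shift[OF rw', of n' "- n"] by simp
  have "shift (r w) m = shift (r w') (n' - n + m)" for m
    by (subst 2) (rule shift_shift[OF rw'])
  then have "range (shift (r w)) \<subseteq> range (shift (r w'))" by auto
  ultimately have "w = w'" using orbit_eq(2)[OF w] orbit_eq(2)[OF w'] by auto
  then show ?thesis using eq shift_inj[OF rw] by auto
qed

abbreviation \<phi> :: "'c point set \<Rightarrow> int \<Rightarrow> nat \<Rightarrow> 'k" where "\<phi> \<equiv> phi E s r u"
abbreviation \<zeta> :: "int \<Rightarrow> 'k" where "\<zeta> n \<equiv> zeta E s \<tau> u n 0"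
abbreviation dconst :: "'c point set \<Rightarrow> nat \<Rightarrow> 'c" where "dconst \<equiv> d_const E s r u"

lemma phi_spec:
  assumes w: "w \<in> orbits E s" and "r w \<noteq> Infinity" and "k \<ge> 1"
  shows "phi_cond (shift (r w) n) (pmult E n s) k (\<phi> w n k)"
proof -
  have "shift (r w) n \<noteq> pmult E n s"
    using shift_neq[OF orbit_eq(1)[OF w] assms(2)] .
  then show ?thesis
    using phi_the[OF shift_closed[OF orbit_eq(1)[OF w]] pmult_closed[OF s_in] _ assms(3)] assms(2)
    by (simp add: phi_def Let_def)
qed

lemma phi_hat_spec:
  assumes "r w = Infinity" and "k \<ge> 2"
  shows "phi_hat_cond (pmult E n s) k (\<phi> w n k)"
  using phi_hat_cond[OF assms(2)] assms by (simp add: phi_def)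

text \<open>The translate of the function for n = 0 satisfies the conditions that characterize the
  function for n. It follows that d may be read off at n = 0.\<close>

lemma phi_shift:
  assumes w: "w \<in> orbits E s" and k: "k \<ge> 1"
  shows "\<phi> w n k = tau_power \<tau> (- n) (\<phi> w 0 k)"
proof (cases "r w = Infinity")
  case False
  note rw = orbit_eq(1)[OF w] and spec = phi_spec[OF w False k]
  have "phi_cond (shift (r w) n) (pmult E n s) k (tau_power \<tau> (- n) (\<phi> w 0 k))"
    using phi_cond_shift[OF rw Infinity_in_points, of k "\<phi> w 0 k" n] spec[of 0] by simp
  moreover have "shift (r w) n \<noteq> pmult E n s"
    using shift_neq[OF rw False] .
  ultimately show ?thesis
    using phi_cond_unique[OF shift_closed[OF rw] pmult_closed[OF s_in]] spec by blast
next
  case True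
  show ?thesis
  proof (cases "k = 1")
    case k1: True
    have "tau_power \<tau> (- n) 0 = 0"
    proof (rule eq_if_coeffs[OF Infinity_in_points _ Infinity_in_points])
    qed (auto simp: coeff_tau_power shift_closed coeff_0 pmult_closed s_in)
    then show ?thesis using True k1 by (simp add: phi_def)
  next
    case False
    then have k2: "k \<ge> 2" using k by simp
    note spec = phi_hat_spec[OF True k2]
    have "phi_hat_cond (pmult E n s) k (tau_power \<tau> (- n) (\<phi> w 0 k))"
      using phi_hat_cond_shift[OF Infinity_in_points, of k "\<phi> w 0 k" n] spec[of 0] by simp
    then show ?thesis using phi_hat_cond_unique[OF pmult_closed[OF s_in] k2] spec by blast
  qed
qed

text \<open>The multiple of \<open>\<zeta> n\<close> trades the simple pole of \<open>\<phi>\<close>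
  at n s for one at o. If the representative is o and k = 1, then \<open>\<phi>\<close> is 0, d is
  1, and \<open>\<zeta> n\<close> alone supplies the pole.\<close>

definition psi :: "'c point set \<Rightarrow> int \<Rightarrow> nat \<Rightarrow> 'k" where
  "psi w n k = \<phi> w n k + \<iota> (dconst w k) * \<zeta> n"

lemma coeff_1_phi:
  assumes w: "w \<in> orbits E s" and k: "k \<ge> 1" and nd: "\<not> (r w = Infinity \<and> k = 1)"
  shows "coeff' 1 (\<phi> w n k) (pmult E n s) = - dconst w k"
proof -
  have "shift (pmult E n s) (- n) = Infinity" using pmult_add[OF s_in, of n "- n"] by simp
  then have "coeff' 1 (\<phi> w n k) (pmult E n s) = coeff' 1 (\<phi> w 0 k) Infinity"
    unfolding phi_shift[OF w k, of n] coeff_tau_power[OF pmult_closed[OF s_in]] by simp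
  then show ?thesis using nd by (auto simp: d_const_def)
qed

text \<open>Apart from order 1 at o, these functions are dual to the coefficient functionals. The
  free coefficient of \<open>\<phi>\<close>, always of order 1 at n s, is cancelled by the pole of
  \<open>\<zeta> n\<close>, whether or not n s is the main pole.\<close>

lemma psi_coeff:
  assumes w: "w \<in> orbits E s" and k: "k \<ge> 1" and Q: "Q \<in> points E" and j: "j \<ge> 1"
    and ne: "(Q, j) \<noteq> (Infinity, 1)"
  shows "coeff' j (psi w n k) Q = of_bool (Q = shift (r w) n \<and> j = k)"
proof -
  let ?N = "pmult E n s"
  have psi: "coeff' j (psi w n k) Q = coeff' j (\<phi> w n k) Q
      + dconst w k * (if j = 1 then of_bool (Q = ?N) - of_bool (Q = Infinity) else 0)"
    unfolding psi_def by (simp only: coeff_add[OF Q] coeff_emb_mult[OF Q] zeta_coeffs[OF Q j])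
  show ?thesis
  proof (cases "r w = Infinity")
    case False
    note spec = phi_spec[OF w False k, of n]
    have PN: "shift (r w) n \<noteq> ?N"
      using shift_neq[OF orbit_eq(1)[OF w] False] .
    show ?thesis
    proof (cases "(Q, j) = (?N, 1)")
      case True
      then show ?thesis using psi coeff_1_phi[OF w k, of n] False PN ne by auto
    next
      case other: False
      then have "coeff' j (\<phi> w n k) Q = of_bool (Q = shift (r w) n \<and> j = k)"
        using spec Q j unfolding phi_cond_def by (cases "Q = shift (r w) n") auto
      then show ?thesis using psi other ne by auto
    qed
  next
    case True
    then have P: "shift (r w) n = ?N" by simp
    show ?thesis
    proof (cases "k = 1")
      case k1: True
      then have "\<phi> w n k = 0" "dconst w k = 1" using True by (simp_all add: phi_def d_const_def)
      then show ?thesis using psi P k1 ne by (auto simp: coeff_0[OF Q])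
    next
      case False
      then have "k \<ge> 2" using k by simp
      note spec = phi_hat_spec[OF True this, of n]
      show ?thesis
      proof (cases "(Q, j) = (?N, 1)")
        case True
        then show ?thesis using psi coeff_1_phi[OF w k, of n] False P ne by auto
      next
        case other: False
        then have "coeff' j (\<phi> w n k) Q = of_bool (Q = shift (r w) n \<and> j = k)"
          using spec Q j unfolding phi_hat_cond_def P by (cases "Q = pmult E n s") auto
        then show ?thesis using psi other ne by auto
      qed
    qed
  qed
qed

text \<open>A triple (w, n, k) is determined by its point and k, so finitely many nonzero
  coefficients mean finitely many triples; their three projections span the box.\<close>

lemma finite_support:
  obtains W N K where "finite W" "finite N" "finite K" "W \<subseteq> orbits E s" "K \<subseteq> {1..}"
    "\<And>w n k. w \<in> orbits E s \<Longrightarrow> k \<ge> 1 \<Longrightarrow> coeff' k f (shift (r w) n) \<noteq> 0 \<Longrightarrow> w \<in> W \<and> n \<in> N \<and> k \<in> K"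
proof -
  let ?T = "{(w, n, k). w \<in> orbits E s \<and> k \<ge> 1 \<and> coeff' k f (shift (r w) n) \<noteq> 0}"
  let ?h = "\<lambda>(w, n, k). (shift (r w) n, k)"
  have "inj_on ?h ?T"
    using orbit_unique by (auto simp: inj_on_def)
  moreover have "?h ` ?T \<subseteq> {(P, k). P \<in> points E \<and> k \<ge> 1 \<and> coeff' k f P \<noteq> 0}"
    using shift_closed orbit_eq(1) by auto
  then have "finite (?h ` ?T)" using finite_coeffs finite_subset by blast
  ultimately have T: "finite ?T" using finite_imageD by blast
  show thesis
  proof (rule that[of "fst ` ?T" "(fst \<circ> snd) ` ?T" "(snd \<circ> snd) ` ?T"])
    fix w n k
    assume "w \<in> orbits E s" "k \<ge> 1" "coeff' k f (shift (r w) n) \<noteq> 0"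
    then have "(w, n, k) \<in> ?T" by simp
    then show "w \<in> fst ` ?T \<and> n \<in> (fst \<circ> snd) ` ?T \<and> k \<in> (snd \<circ> snd) ` ?T"
      by (metis (no_types, lifting) comp_apply fst_conv image_eqI snd_conv)
  qed (use T in auto)
qed

lemma Ores_eq:
  assumes w: "w \<in> orbits E s" and N: "finite N" "\<And>n. coeff' k f (shift (r w) n) \<noteq> 0 \<Longrightarrow> n \<in> N"
  shows "Ores E u f w k = (\<Sum>n\<in>N. coeff' k f (shift (r w) n))"
proof -
  obtain p where p: "r w = p" "p \<in> points E" "w = range (shift p)" using orbit_eq[OF w] by blast
  have "Ores E u f w k = (\<Sum>P\<in>shift p ` N. coeff' k f P)"
    unfolding Ores_def by (rule supp_sum_eq) (use N p in auto)
  also have "\<dots> = (\<Sum>n\<in>N. coeff' k f (shift p n))"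
    by (subst sum.reindex) (auto intro: inj_onI shift_inj[OF p(2)])
  finally show ?thesis unfolding p(1) .
qed

text \<open>Along an orbit the coefficients of \<tau>(g) - g are the differences of a finitely
  supported sequence on the integers, so their sum telescopes to 0.\<close>

lemma Ores_summable:
  assumes f: "elliptically_summable \<tau> f" and w: "w \<in> orbits E s" and k: "k \<ge> 1"
  shows "Ores E u f w k = 0"
proof -
  obtain g where g: "f = \<tau> g - g" using f unfolding elliptically_summable_def by blast
  note rw = orbit_eq(1)[OF w]
  let ?a = "\<lambda>n. coeff' k g (shift (r w) n)"
  define A where "A = {n. ?a n \<noteq> 0}"
  have A: "finite A" unfolding A_def by (rule finite_orbit_support[OF rw k])
  \<comment> \<open>The differences a(n + 1) - a(n) can be nonzero only on the support A and on A
    moved back by one.\<close>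
  let ?B = "A \<union> (\<lambda>n. n - 1) ` A"
  have f_coeff: "coeff' k f (shift (r w) n) = ?a (n + 1) - ?a n" for n
    unfolding g coeff_diff[OF shift_closed[OF rw]] coeff_tau[OF shift_closed[OF rw]] padd_shift_s[OF rw] ..
  have "Ores E u f w k = (\<Sum>n\<in>?B. coeff' k f (shift (r w) n))"
  proof (rule Ores_eq[OF w])
    show "finite ?B" using A by simp
    fix n assume "coeff' k f (shift (r w) n) \<noteq> 0"
    then have "n + 1 \<in> A \<or> n \<in> A" unfolding f_coeff A_def by auto
    moreover have "n = (n + 1) - 1" by simp
    ultimately show "n \<in> ?B" by blast
  qed
  also have "\<dots> = (\<Sum>n\<in>?B. ?a (n + 1)) - (\<Sum>n\<in>?B. ?a n)"
    unfolding f_coeff sum_subtractf ..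
  also have "(\<Sum>n\<in>?B. ?a (n + 1)) = (\<Sum>n\<in>(\<lambda>n. n + 1) ` ?B. ?a n)"
    by (subst sum.reindex) (auto simp: inj_on_def)
  also have "\<dots> = (\<Sum>n\<in>A. ?a n)"
    by (rule sum.mono_neutral_right) (use A in \<open>auto simp: A_def image_Un image_image\<close>)
  also have "(\<Sum>n\<in>?B. ?a n) = (\<Sum>n\<in>A. ?a n)"
    by (rule sum.mono_neutral_right) (use A in \<open>auto simp: A_def\<close>)
  finally show ?thesis by simp
qed

lemma decomposition:
  assumes fin: "finite W" "finite N" "finite K" and sub: "W \<subseteq> orbits E s" "K \<subseteq> {1..}"
    and supp: "\<And>w n k. w \<in> orbits E s \<Longrightarrow> k \<ge> 1 \<Longrightarrow> coeff' k f (shift (r w) n) \<noteq> 0 \<Longrightarrow> w \<in> W \<and> n \<in> N \<and> k \<in> K"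
  shows "f = \<iota> (PanOres0 E s \<tau> r u f)
      + (\<Sum>(w, n, k)\<in>W \<times> N \<times> K. \<iota> (coeff' k f (shift (r w) n)) * psi w n k)"
proof -
  let ?I = "W \<times> N \<times> K"
  let ?S = "\<Sum>(w, n, k)\<in>?I. \<iota> (coeff' k f (shift (r w) n)) * psi w n k"
  note PI = Infinity_in_points
  have coeff_S: "coeff' j ?S Q = (\<Sum>(w, n, k)\<in>?I. coeff' k f (shift (r w) n) * coeff' j (psi w n k) Q)"
    if "Q \<in> points E" for j Q
    unfolding coeff_sum[OF that] by (rule sum.cong) (auto simp: coeff_emb_mult[OF that])
  have "\<exists>c. f - ?S = \<iota> c"
  proof (rule constant_if_coeffs[OF PI])
    fix Q and j :: nat assume Q: "Q \<in> points E" and j: "1 \<le> j" and ne: "(Q, j) \<noteq> (Infinity, 1)"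
    obtain w0 n0 where w0: "w0 \<in> orbits E s" "Q = shift (r w0) n0" using orbit_cover[OF Q] by blast
    have "coeff' j ?S Q = (\<Sum>i\<in>?I. if i = (w0, n0, j) then coeff' j f Q else 0)"
      unfolding coeff_S[OF Q]
    proof (rule sum.cong[OF refl])
      fix i assume i: "i \<in> ?I"
      obtain w n k where i': "i = (w, n, k)" by (cases i) auto
      have w: "w \<in> orbits E s" and k: "k \<ge> 1" using i i' sub by auto
      have "Q = shift (r w) n \<longleftrightarrow> w = w0 \<and> n = n0"
        using orbit_unique[OF w w0(1), of n n0] w0(2) by metis
      then show "(case i of (w, n, k) \<Rightarrow> coeff' k f (shift (r w) n) * coeff' j (psi w n k) Q)
          = (if i = (w0, n0, j) then coeff' j f Q else 0)"
        unfolding i' using psi_coeff[OF w k Q j ne] by auto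
    qed
    also have "\<dots> = (if (w0, n0, j) \<in> ?I then coeff' j f Q else 0)"
      by (rule sum.delta) (use fin in auto)
    also have "\<dots> = coeff' j f Q"
    proof (cases "coeff' j f Q = 0")
      case False
      then have "w0 \<in> W \<and> n0 \<in> N \<and> j \<in> K" using supp[OF w0(1) j] w0(2) by metis
      then show ?thesis by simp
    qed simp
    finally show "coeff' j (f - ?S) Q = 0" by (simp add: coeff_diff[OF Q])
  qed
  then obtain c where c: "f - ?S = \<iota> c" by blast
  \<comment> \<open>The remaining constant is read off at o, where \<open>e_const\<close> is by
    definition the constant term of \<open>psi\<close>.\<close>
  have "c = coeff' 0 (f - ?S) Infinity" unfolding c by (simp add: coeff_emb[OF PI])
  also have "\<dots> = coeff' 0 f Infinity - (\<Sum>(w, n, k)\<in>?I. coeff' k f (shift (r w) n) * e_const E s \<tau> r u w n k)"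
    unfolding coeff_diff[OF PI] coeff_S[OF PI] unfolding e_const_def psi_def ..
  also have "\<dots> = PanOres0 E s \<tau> r u f"
  proof -
    have "supp_sum (\<lambda>w. supp_sum (\<lambda>n. supp_sum (\<lambda>k.
         coeff' k f (shift (r w) n) * e_const E s \<tau> r u w n k) {1..}) (UNIV :: int set)) (orbits E s)
        = (\<Sum>(w, n, k)\<in>?I. coeff' k f (shift (r w) n) * e_const E s \<tau> r u w n k)"
    proof (rule supp_sum_triple[OF fin sub])
      fix w n k assume "w \<in> orbits E s" "k \<in> {1..}" "coeff' k f (shift (r w) n) * e_const E s \<tau> r u w n k \<noteq> 0"
      then show "w \<in> W \<and> n \<in> N \<and> k \<in> K" using supp[of w k n] by simp
    qed
    then show ?thesis unfolding PanOres0_def by simp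
  qed
  finally have "PanOres0 E s \<tau> r u f = c" ..
  then have "f - ?S = \<iota> (PanOres0 E s \<tau> r u f)" using c by (simp only:)
  moreover have "a - d = b \<Longrightarrow> a = b + d" for a b d :: 'k by (simp add: diff_eq_eq)
  ultimately show ?thesis by blast
qed

lemma reduction_mod_summable:
  assumes ores: "\<And>w k. w \<in> orbits E s \<Longrightarrow> k \<ge> 1 \<Longrightarrow> Ores E u f w k = 0"
  shows "elliptically_summable \<tau> (f - (\<iota> (PanOres0 E s \<tau> r u f) + \<iota> (PanOres1 E s r u f) * zeta_basic E s u))"
proof -
  obtain W N K where fin: "finite W" "finite N" "finite K" and sub: "W \<subseteq> orbits E s" "K \<subseteq> {1..}"
    and supp: "\<And>w n k. w \<in> orbits E s \<Longrightarrow> k \<ge> 1 \<Longrightarrow> coeff' k f (shift (r w) n) \<noteq> 0 \<Longrightarrow> w \<in> W \<and> n \<in> N \<and> k \<in> K"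
    using finite_support[of f] by metis
  let ?I = "W \<times> N \<times> K" and ?z = "zeta_basic E s u"
  let ?c = "\<lambda>w n k. coeff' k f (shift (r w) n)"
  have psi: "elliptically_summable \<tau> (psi w n k - (\<phi> w 0 k + \<iota> (of_int n * dconst w k) * ?z))"
    if "w \<in> orbits E s" "k \<ge> 1" for w n k
  proof -
    have "elliptically_summable \<tau> ((tau_power \<tau> (- n) (\<phi> w 0 k) - \<phi> w 0 k)
        + \<iota> (dconst w k) * (\<zeta> n - \<iota> (of_int n) * ?z))"
      by (intro summable_add summable_emb_mult summable_tau_power zeta_mod_summable)
    also have "(tau_power \<tau> (- n) (\<phi> w 0 k) - \<phi> w 0 k) + \<iota> (dconst w k) * (\<zeta> n - \<iota> (of_int n) * ?z)
        = psi w n k - (\<phi> w 0 k + \<iota> (of_int n * dconst w k) * ?z)"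
      unfolding psi_def phi_shift[OF that, of n] by (simp add: algebra_simps)
    finally show ?thesis .
  qed
  have "elliptically_summable \<tau>
      (\<Sum>(w, n, k)\<in>?I. \<iota> (?c w n k) * (psi w n k - (\<phi> w 0 k + \<iota> (of_int n * dconst w k) * ?z)))"
  proof (rule summable_sum, clarify)
    fix w n k assume "w \<in> W" "n \<in> N" "k \<in> K"
    then show "elliptically_summable \<tau> (\<iota> (?c w n k) * (psi w n k - (\<phi> w 0 k + \<iota> (of_int n * dconst w k) * ?z)))"
      using sub by (intro summable_emb_mult psi) auto
  qed
  also have "(\<Sum>(w, n, k)\<in>?I. \<iota> (?c w n k) * (psi w n k - (\<phi> w 0 k + \<iota> (of_int n * dconst w k) * ?z)))
      = (\<Sum>(w, n, k)\<in>?I. \<iota> (?c w n k) * psi w n k)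
        - (\<Sum>(w, n, k)\<in>?I. \<iota> (?c w n k) * \<phi> w 0 k)
        - (\<Sum>(w, n, k)\<in>?I. \<iota> (of_int n * ?c w n k * dconst w k)) * ?z"
    unfolding sum_distrib_right sum_subtractf[symmetric]
    by (rule sum.cong) (auto simp: algebra_simps)
  \<comment> \<open>As \<open>\<phi> w 0 k\<close> does not involve n, summing over n first puts an
    orbital residue in front of it.\<close>
  also have "(\<Sum>(w, n, k)\<in>?I. \<iota> (?c w n k) * \<phi> w 0 k) = 0"
  proof -
    have "(\<Sum>(w, n, k)\<in>?I. \<iota> (?c w n k) * \<phi> w 0 k) = (\<Sum>w\<in>W. \<Sum>n\<in>N. \<Sum>k\<in>K. \<iota> (?c w n k) * \<phi> w 0 k)"
      by (simp add: sum.cartesian_product)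
    also have "\<dots> = (\<Sum>w\<in>W. \<Sum>k\<in>K. \<Sum>n\<in>N. \<iota> (?c w n k) * \<phi> w 0 k)"
      by (rule sum.cong[OF refl]) (rule sum.swap)
    also have "\<dots> = (\<Sum>w\<in>W. \<Sum>k\<in>K. \<iota> (\<Sum>n\<in>N. ?c w n k) * \<phi> w 0 k)"
      by (simp add: emb_sum sum_distrib_right)
    also have "\<dots> = 0"
    proof (intro sum.neutral ballI)
      fix w k assume "w \<in> W" "k \<in> K"
      then have w: "w \<in> orbits E s" and k: "k \<ge> 1" using sub by auto
      have "Ores E u f w k = (\<Sum>n\<in>N. ?c w n k)"
        by (rule Ores_eq[OF w fin(2)]) (use supp[OF w k] in blast)
      then show "\<iota> (\<Sum>n\<in>N. ?c w n k) * \<phi> w 0 k = 0" using ores[OF w k] by simp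
    qed
    finally show ?thesis .
  qed
  also have "(\<Sum>(w, n, k)\<in>?I. \<iota> (of_int n * ?c w n k * dconst w k)) = \<iota> (PanOres1 E s r u f)"
  proof -
    have "PanOres1 E s r u f = (\<Sum>(w, n, k)\<in>?I. of_int n * ?c w n k * dconst w k)"
      unfolding PanOres1_def
    proof (rule supp_sum_triple[OF fin sub])
      fix w n k assume "w \<in> orbits E s" "k \<in> {1..}" "of_int n * ?c w n k * dconst w k \<noteq> 0"
      then show "w \<in> W \<and> n \<in> N \<and> k \<in> K" using supp[of w k n] by auto
    qed
    then show ?thesis by (simp add: emb_sum case_prod_unfold)
  qed
  finally have "elliptically_summable \<tau> ((\<Sum>(w, n, k)\<in>?I. \<iota> (?c w n k) * psi w n k) - \<iota> (PanOres1 E s r u f) * ?z)"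
    by simp
  moreover have "(\<Sum>(w, n, k)\<in>?I. \<iota> (?c w n k) * psi w n k) = f - \<iota> (PanOres0 E s \<tau> r u f)"
  proof -
    have "a = b + d \<Longrightarrow> d = a - b" for a b d :: 'k by simp
    then show ?thesis using decomposition[OF fin sub supp] by blast
  qed
  ultimately show ?thesis by (simp add: diff_diff_eq)
qed

end

lemma normal_form_not_summable:
  assumes "elliptically_summable \<tau> (\<iota> A + \<iota> B * zeta_basic E s u)"
  shows "A = 0 \<and> B = 0"
proof -
  let ?z = "zeta_basic E s u"
  note PI = Infinity_in_points
  obtain g where g: "\<iota> A + \<iota> B * ?z = \<tau> g - g" using assms unfolding elliptically_summable_def by blast
  have rec: "coeff' k g (padd E Q s) - coeff' k g Q
      = (if k = 1 then B * (of_bool (Q = s) - of_bool (Q = Infinity)) else 0)"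
    if Q: "Q \<in> points E" and k: "k \<ge> 1" for Q k
  proof -
    have "coeff' k g (padd E Q s) - coeff' k g Q = coeff' k (\<iota> A + \<iota> B * ?z) Q"
      unfolding g coeff_diff[OF Q] coeff_tau[OF Q] ..
    then show ?thesis
      using k by (simp add: coeff_add[OF Q] coeff_emb[OF Q] coeff_emb_mult[OF Q] zeta_basic_coeffs(1)[OF Q k])
  qed
  have coeff_g: "coeff' k g Q = (if k = 1 \<and> Q = s then - B else 0)" if Q: "Q \<in> points E" and k: "k \<ge> 1" for Q k
  proof -
    \<comment> \<open>For k = 1 the coefficient of g jumps by - B from o to s and by B from s to 2
      s. Adding B at the point s compensates both jumps, so h is constant along the orbit.\<close>
    define h where "h n = coeff' k g (shift Q n) + (if k = 1 \<and> shift Q n = s then B else 0)" for n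
    have "h (n + 1) = h n" for n
    proof -
      have "shift Q (n + 1) = s \<longleftrightarrow> shift Q n = Infinity"
      proof -
        have "padd E (shift Q n) s = s \<longleftrightarrow> shift Q n = Infinity"
          using padd_cancel_left[OF s_in shift_closed[OF Q] PI, of n] padd_commute[OF s_in shift_closed[OF Q], of n]
          by auto
        then show ?thesis unfolding padd_shift_s[OF Q] .
      qed
      then show ?thesis
        using rec[OF shift_closed[OF Q] k, of n] unfolding padd_shift_s[OF Q] h_def
        by (auto simp: algebra_simps split: if_splits)
    qed
    then have const: "h n = h 0" for n
    proof (induction n rule: int_induct[where k = 0])
      case (step2 i)
      then show ?case using step2(3)[of "i - 1"] by simp
    qed auto
    have "finite {n. coeff' k g (shift Q n) \<noteq> 0}" by (rule finite_orbit_support[OF Q k])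
    moreover have "finite {n. shift Q n = s}"
    proof (cases "\<exists>m. shift Q m = s")
      case True
      then obtain m where "shift Q m = s" by blast
      then have "{n. shift Q n = s} \<subseteq> {m}" using shift_inj[OF Q] by auto
      then show ?thesis using finite_subset by blast
    qed auto
    ultimately have "finite ({n. coeff' k g (shift Q n) \<noteq> 0} \<union> {n. shift Q n = s})" by blast
    \<comment> \<open>Finitely many n give a pole of g or the point s; at any other n the constant h
      takes the value 0.\<close>
    then obtain n where n: "n \<notin> {n. coeff' k g (shift Q n) \<noteq> 0} \<union> {n. shift Q n = s}"
      using ex_new_if_finite infinite_UNIV_int by blast
    then have "h n = 0" unfolding h_def by auto
    then have "h 0 = 0" using const[of n] by simp
    then show ?thesis unfolding h_def by (auto simp: add_eq_0_iff2 split: if_splits)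
  qed
  \<comment> \<open>The exempted pair is (s, 1), the only place where g can have a polar
    coefficient.\<close>
  have "\<exists>c. g = \<iota> c" by (rule constant_if_coeffs[OF s_in]) (auto simp: coeff_g)
  then have zero: "\<iota> A + \<iota> B * ?z = 0" using g by auto
  have "B = coeff' 1 (\<iota> A + \<iota> B * ?z) s"
    using s_affine by (simp add: coeff_add[OF s_in] coeff_emb[OF s_in] coeff_emb_mult[OF s_in] zeta_basic_coeffs(1)[OF s_in])
  then have "B = 0" unfolding zero by (simp add: coeff_0[OF s_in])
  then show ?thesis using zero by simp
qed

end

theorem theorem1p1:
  fixes E :: "('c::alg_closed_field, 'k::field) curve"
    and s :: "'c point" and \<tau> :: "'k \<Rightarrow> 'k"
    and \<R> :: "'c point set \<Rightarrow> 'c point" and \<U> :: "'c point \<Rightarrow> 'k"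
    and f :: 'k
  assumes "elliptic_curve E"
    and "s \<in> points E" and "non_torsion E s"
    and "translation_automorphism E s \<tau>"
    and "tau_pinning E s \<tau> \<R> \<U>"
  shows "elliptically_summable \<tau> f \<longleftrightarrow>
           (\<forall>\<omega>\<in>orbits E s. \<forall>k\<ge>1. Ores E \<U> f \<omega> k = 0) \<and>
           PanOres0 E s \<tau> \<R> \<U> f = 0 \<and>
           PanOres1 E s \<R> \<U> f = 0"
proof -
  interpret translated_curve E s \<tau> \<U>
    by unfold_locales (use assms in \<open>auto simp: tau_pinning_def\<close>)
  have R: "\<R> w \<in> w" if "w \<in> orbits E s" for w
    using assms(5) that by (simp add: tau_pinning_def)
  let ?n = "\<iota> (PanOres0 E s \<tau> \<R> \<U> f) + \<iota> (PanOres1 E s \<R> \<U> f) * zeta_basic E s \<U>"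
  show ?thesis
  proof
    assume f: "elliptically_summable \<tau> f"
    then have ores: "Ores E \<U> f w k = 0" if "w \<in> orbits E s" "k \<ge> 1" for w k
      using Ores_summable[OF R] that by blast
    \<comment> \<open>Vanishing orbital residues already make f congruent to \<open>?n\<close>; as f
      is summable, so is \<open>?n\<close>, and its two coefficients must vanish.\<close>
    have "elliptically_summable \<tau> (f - (f - ?n))"
      by (intro summable_diff f reduction_mod_summable R ores)
    then show "(\<forall>\<omega>\<in>orbits E s. \<forall>k\<ge>1. Ores E \<U> f \<omega> k = 0) \<and>
           PanOres0 E s \<tau> \<R> \<U> f = 0 \<and> PanOres1 E s \<R> \<U> f = 0"
      using normal_form_not_summable ores by simp
  next
    assume *: "(\<forall>\<omega>\<in>orbits E s. \<forall>k\<ge>1. Ores E \<U> f \<omega> k = 0) \<and>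
           PanOres0 E s \<tau> \<R> \<U> f = 0 \<and> PanOres1 E s \<R> \<U> f = 0"
    then have "elliptically_summable \<tau> (f - ?n)"
      by (intro reduction_mod_summable R) auto
    then show "elliptically_summable \<tau> f" using * by simp
  qed
qed

end
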